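(* Let $h:\mathcal X\to\mathbb R$, let $f(\tau,X)=\sum_{v\in N_o(\tau)}h(X_v)$ for $(\tau,X)\in\mathcal T_{*,1}[\mathcal X]$, and let $L_n=L_n^{\mathsf{CM}}$ be the neighborhood empirical measure of the vertex-marked $\mathsf{CM}(\alpha_n,\kappa)$ random graph sequence with limiting degree distribution $\alpha\in\mathcal P(\{0,1,\dots,M\})$ and true law $\eta_1^\alpha$. Suppose $\mathbb E_{\eta_1^\alpha}[f]<c<\kappa\max_{x\in\mathcal X}h(x)$. Let $\gamma\in\mathcal P(\{0,1,\dots,M\}\times\mathcal X)$ and $\lambda>0$ be the unique solution of $$\gamma(n,x)=\alpha(n)\frac{\nu(x)\exp\{\lambda nh(x)\}}{\sum_{y\in\mathcal X}\nu(y)\exp\{\lambda nh(y)\}},\quad n\in\{0,\dots,M\},\ x\in\mathcal X,\qquad \sum_{m=0}^M\sum_{y\in\mathcal X}m\,h(y)\gamma(m,y)=c,$$ let $\psi_\gamma(x)=\frac1\kappa\sum_{n=0}^Mn\,\gamma(n,x)$ for $x\in\mathcal X$, and let $\mu^{*,c}\in\mathcal P(\mathcal T_{*,1}[\mathcal X])$ be $$\mu^{*,c}(\tau,X)=\gamma(\deg_\tau(o),X_o)\prod_{v\in N_o(\tau)}\psi_\gamma(X_v).$$ Then for any open set $A\subset\mathcal P(\mathcal T_{*,1}[\mathcal X])$ containing $\mu^{*,c}$, $$\lim_{\delta\downarrow0}\limsup_{n\to\infty}\frac1n\log\mathbb P\big(L_n\notin A\,\big|\,\langle L_n,f\rangle\ge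 c-\delta\big)<0.$$ In particular, $$\lim_{\delta\downarrow0}\lim_{n\to\infty}\mathbb P\big(L_n\in\cdot\,\big|\,\langle L_n,f\rangle\ge c-\delta\big)=\delta_{\mu^{*,c}}(\cdot).$$
   Context: $\mathcal X$ is a nonempty finite set and $\nu\in\mathcal P(\mathcal X)$; there are no edge marks. $\mathcal T_{*,1}[\mathcal X]$ is the set of isomorphism classes of rooted trees of depth at most 1 (stars rooted at their center $o$) with marks $X_v\in\mathcal X$ on the vertices; $N_o(\tau)$ is the set of neighbors of the root and $\deg_\tau(o)=|N_o(\tau)|$. $\mathcal P(\cdot)$ carries the weak topology, and $\langle L,f\rangle=\int f\,dL$. The product formula for $\mu^{*,c}$ is understood for stars whose leaves are labeled: $\mu^{*,c}$ is the law of the star whose (root degree, root mark) has law $\gamma$ and whose leaf marks are, given these, i.i.d. with law $\psi_\gamma$. The last displayed limit is in the sense of weak convergence. $\mathsf{CM}(\alpha_n,\kappa)$ sequence: $M\in\mathbb N$, $\kappa>0$, $\alpha$ is a probability measure on $\{0,\dots,M\}$ with mean $\kappa$; $\alpha_n$ are probability measures on $\{0,\dots,M\}$ with $\alpha_n(\{i\})\in\{0,1/n,\dots,1\}$, $n\sum_ii\,\alpha_n(\{i\})$ even, and $\alpha_n\to\alpha$; $G_n$ is uniform over simple graphs on the vertex set $\{1,\dots,n\}$ with empirical degree distribution $\alpha_n$. Given $G_n$ the vertex marks are i.i.d. with law $\nu$. $L_n=\frac1n\sum_{v\in G_n}\delta_{\mathrm{cl}_v}$, where $\mathrm{cl}_v\in\mathcal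 T_{*,1}[\mathcal X]$ is the marked star formed by $v$ (root), its neighbors and the edges joining $v$ to them. The true law $\eta_1^\alpha$ is the law of the star with root degree of law $\alpha$ and i.i.d. vertex marks of law $\nu$ independent of the root degree.
   Formalization: Existence of the unique solution (γ, λ) is asserted for c < κ·max of h over the support of ν, since for ν without full support it can fail under c < κ·max over 𝒳; both limits are proved for every solution. *)

theory Defs
  imports "HOL-Probability.Probability" "HOL-Probability.Product_PMF"
begin

section \<open>Marked stars up to isomorphism\<close>

text \<open>
  A rooted tree of depth at most 1 with vertex marks is determined up to isomorphism by the mark of
  the root and the multiset of the marks of the leaves. The lemmas \<open>star_class_eq_iff\<close> and
  \<open>star_class_surj\<close> say that the type below is in bijection with the isomorphism classes.
\<close>

datatype 'x star = Star (root_mark: 'x) (leaf_marks: "'x multiset")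

definition star_class :: "('v \<Rightarrow> 'x) \<Rightarrow> 'v \<Rightarrow> 'v set \<Rightarrow> 'x star" where
  "star_class X v N = Star (X v) (image_mset X (mset_set N))"

lemma star_class_eq_iff:
  assumes "finite N" "finite N'"
  shows "star_class X v N = star_class X' v' N' \<longleftrightarrow>
    X v = X' v' \<and> (\<exists>\<phi>. bij_betw \<phi> N N' \<and> (\<forall>u\<in>N. X' (\<phi> u) = X u))"
proof -
  have "image_mset X (mset_set N) = image_mset X' (mset_set N') \<longleftrightarrow>
    (\<exists>\<phi>. bij_betw \<phi> N N' \<and> (\<forall>u\<in>N. X' (\<phi> u) = X u))" (is "?L \<longleftrightarrow> ?R")
  proof
    assume ?R
    then obtain \<phi> where b: "bij_betw \<phi> N N'" and e: "\<forall>u\<in>N. X' (\<phi> u) = X u" by blast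
    have "mset_set N' = image_mset \<phi> (mset_set N)"
      using b by (simp add: bij_betw_def image_mset_mset_set)
    then have "image_mset X' (mset_set N') = image_mset (X' \<circ> \<phi>) (mset_set N)"
      by (simp add: multiset.map_comp)
    also have "\<dots> = image_mset X (mset_set N)"
      by (rule image_mset_cong) (use e assms in auto)
    finally show ?L by simp
  next
    assume L: ?L
    have c: "card {u\<in>N. X u = y} = card {u\<in>N'. X' u = y}" for y
    proof -
      have "size (filter_mset ((=) y) (image_mset X (mset_set N))) =
            size (filter_mset ((=) y) (image_mset X' (mset_set N')))" using L by simp
      then show ?thesis using assms by (simp add: filter_mset_image_mset eq_commute)
    qed
    have "\<forall>y. \<exists>\<phi>. bij_betw \<phi> {u\<in>N. X u = y} {u\<in>N'. X' u = y}"
      using c assms by (auto intro!: finite_same_card_bij)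
    then obtain \<Phi> where P: "\<And>y. bij_betw (\<Phi> y) {u\<in>N. X u = y} {u\<in>N'. X' u = y}" by metis
    have in1: "\<Phi> (X u) u \<in> N' \<and> X' (\<Phi> (X u) u) = X u" if "u \<in> N" for u
      using bij_betw_apply[OF P[of "X u"], of u] that by auto
    have "inj_on (\<lambda>u. \<Phi> (X u) u) N"
    proof (rule inj_onI)
      fix u w assume a: "u \<in> N" "w \<in> N" "\<Phi> (X u) u = \<Phi> (X w) w"
      then have "X u = X w" using in1 by metis
      then show "u = w" using a P[of "X u"] by (auto simp: bij_betw_def inj_on_def)
    qed
    moreover have "N' \<subseteq> (\<lambda>u. \<Phi> (X u) u) ` N"
    proof
      fix w assume "w \<in> N'"
      then have "w \<in> \<Phi> (X' w) ` {u\<in>N. X u = X' w}" using P[of "X' w"] by (auto simp: bij_betw_def)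
      then obtain u where u: "u \<in> N" "X u = X' w" "w = \<Phi> (X' w) u" by blast
      show "w \<in> (\<lambda>u. \<Phi> (X u) u) ` N"
      proof (rule image_eqI)
        show "w = \<Phi> (X u) u" by (simp only: u(2)) (rule u(3))
      qed (rule u(1))
    qed
    ultimately have "bij_betw (\<lambda>u. \<Phi> (X u) u) N N'" using in1 by (auto simp: bij_betw_def)
    then show ?R using in1 by blast
  qed
  then show ?thesis by (simp add: star_class_def)
qed

lemma star_class_surj:
  "\<exists>(X :: nat \<Rightarrow> 'x) N. finite N \<and> 0 \<notin> N \<and> star_class X 0 N = s"
proof (cases s)
  case (Star x A)
  obtain xs where xs: "mset xs = A" by (metis ex_mset)
  define X where "X = (\<lambda>i. if i = 0 then x else xs ! (i - 1))"
  have "image_mset X (mset_set {1..<Suc (length xs)}) = mset (map X [1..<Suc (length xs)])"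
    by (simp only: mset_map mset_upt)
  also have "map X [1..<Suc (length xs)] = xs"
    by (rule nth_equalityI) (auto simp: X_def simp del: upt_Suc)
  finally have "star_class X 0 {1..<Suc (length xs)} = s"
    by (simp add: star_class_def Star xs X_def)
  then show ?thesis by (intro exI[of _ X] exI[of _ "{1..<Suc (length xs)}"]) auto
qed

definition leaf_sum :: "('x \<Rightarrow> real) \<Rightarrow> 'x star \<Rightarrow> real" where
  "leaf_sum h \<tau> = (\<Sum>x\<in>#leaf_marks \<tau>. h x)"

text \<open>
  Law of the star whose pair (root degree, root mark) has law \<open>\<gamma>\<close> and whose leaves, labeled
  \<open>0, \<dots>, m - 1\<close> when the root degree is \<open>m\<close>, carry marks that are, given this pair, i.i.d. with law
  \<open>\<psi>\<close>. (The value \<open>undefined\<close> is the one that \<open>Pi_pmf\<close> gives outside the index set.)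
\<close>

definition star_law :: "(nat \<times> 'x) pmf \<Rightarrow> 'x pmf \<Rightarrow> 'x star pmf" where
  "star_law \<gamma> \<psi> = bind_pmf \<gamma> (\<lambda>(m, x).
     map_pmf (\<lambda>Y. Star x (image_mset Y (mset_set {..<m}))) (Pi_pmf {..<m} undefined (\<lambda>_. \<psi>)))"

definition true_law :: "nat pmf \<Rightarrow> 'x pmf \<Rightarrow> 'x star pmf" where
  "true_law \<alpha> \<nu> = star_law (pair_pmf \<alpha> \<nu>) \<nu>"


section \<open>Weak topology and weak convergence\<close>

text \<open>
  Probability measures on a countable discrete space, such as \<open>'x star\<close> for finite \<open>'x\<close>, are
  represented by the type \<open>pmf\<close>. Every bounded function on such a space is a continuous test
  function. Measures on \<open>'x star pmf\<close> itself are general Borel measures.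
\<close>

definition weak_topology :: "'a pmf topology" where
  "weak_topology = topology_generated_by
     {{p. measure_pmf.expectation p g \<in> U} | (g :: 'a \<Rightarrow> real) U. bounded (range g) \<and> open U}"

lemma topspace_weak_topology [simp]: "topspace (weak_topology :: 'a pmf topology) = UNIV"
proof -
  have "(UNIV :: 'a pmf set) \<in>
    {{p. measure_pmf.expectation p g \<in> U} | (g :: 'a \<Rightarrow> real) U. bounded (range g) \<and> open U}"
    by (auto intro!: exI[of _ "\<lambda>_. 0"] exI[of _ UNIV])
  then show ?thesis
    unfolding weak_topology_def topology_generated_by_topspace by blast
qed

definition borel_of :: "'b topology \<Rightarrow> 'b measure" where
  "borel_of T = sigma (topspace T) {U. openin T U}"

definition borel_prob :: "'b topology \<Rightarrow> 'b measure \<Rightarrow> bool" where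
  "borel_prob T Q \<longleftrightarrow> prob_space Q \<and> sets Q = sets (borel_of T)"

definition weak_limit :: "'b topology \<Rightarrow> ('i \<Rightarrow> 'b measure) \<Rightarrow> 'b measure \<Rightarrow> 'i filter \<Rightarrow> bool" where
  "weak_limit T Q Q' F \<longleftrightarrow> (\<forall>g. continuous_map T euclideanreal g \<and> bounded (g ` topspace T) \<longrightarrow>
     ((\<lambda>i. \<integral>y. g y \<partial>Q i) \<longlongrightarrow> (\<integral>y. g y \<partial>Q')) F)"


section \<open>The marked configuration model\<close>

text \<open>Simple graphs on \<open>{1..n}\<close> are represented by their sets of edges.\<close>

definition simple_graphs :: "nat \<Rightarrow> nat set set set" where
  "simple_graphs n = {E. \<forall>e\<in>E. e \<subseteq> {1..n} \<and> card e = 2}"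

definition nbrs :: "nat set set \<Rightarrow> nat \<Rightarrow> nat set" where
  "nbrs E v = {u. {v, u} \<in> E}"

definition cm_graphs :: "nat \<Rightarrow> nat pmf \<Rightarrow> nat set set set" where
  "cm_graphs n a = {E \<in> simple_graphs n.
     \<forall>i. real (card {v\<in>{1..n}. card (nbrs E v) = i}) / real n = pmf a i}"

definition CM_sequence :: "nat \<Rightarrow> real \<Rightarrow> nat pmf \<Rightarrow> (nat \<Rightarrow> nat pmf) \<Rightarrow> bool" where
  "CM_sequence M \<kappa> \<alpha> \<alpha>n \<longleftrightarrow>
     0 < \<kappa> \<and> set_pmf \<alpha> \<subseteq> {0..M} \<and> (\<Sum>i=0..M. real i * pmf \<alpha> i) = \<kappa> \<and>
     (\<forall>n\<ge>1. set_pmf (\<alpha>n n) \<subseteq> {0..M} \<and>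
        (\<forall>i. \<exists>k\<le>n. pmf (\<alpha>n n) i = real k / real n) \<and>
        (\<exists>k::nat. real n * (\<Sum>i=0..M. real i * pmf (\<alpha>n n) i) = real (2 * k))) \<and>
     limitin weak_topology \<alpha>n \<alpha> sequentially"

text \<open>
  Joint law of the graph and the vertex marks. The set \<open>cm_graphs n a\<close> can be empty for finitely
  many \<open>n\<close> along a \<open>CM_sequence\<close>; \<open>pmf_of_set\<close> is unspecified there, without effect on limits.
\<close>

definition marked_CM :: "nat \<Rightarrow> nat pmf \<Rightarrow> 'x pmf \<Rightarrow> (nat set set \<times> (nat \<Rightarrow> 'x)) pmf" where
  "marked_CM n a \<nu> = pair_pmf (pmf_of_set (cm_graphs n a)) (Pi_pmf {1..n} undefined (\<lambda>_. \<nu>))"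

text \<open>The law of \<open>cl\<^sub>v\<close> for a uniformly chosen vertex \<open>v\<close>, which is \<open>1/n\<close> times the sum of the
  point masses at \<open>cl\<^sub>v\<close>.\<close>

definition nbhd_empirical :: "nat \<Rightarrow> nat set set \<times> (nat \<Rightarrow> 'x) \<Rightarrow> 'x star pmf" where
  "nbhd_empirical n = (\<lambda>(E, X). map_pmf (\<lambda>v. star_class X v (nbrs E v)) (pmf_of_set {1..n}))"

lemma finite_nbrs: "E \<in> simple_graphs n \<Longrightarrow> finite (nbrs E v)"
  by (rule finite_subset[of _ "{1..n}"]) (auto simp: simple_graphs_def nbrs_def)


section \<open>Conditioning on a large neighborhood average\<close>

definition mean_exceeds ::
  "('x star \<Rightarrow> real) \<Rightarrow> real \<Rightarrow> nat \<Rightarrow> nat set set \<times> (nat \<Rightarrow> 'x) \<Rightarrow> bool" where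
  "mean_exceeds f b n \<omega> \<longleftrightarrow> b \<le> measure_pmf.expectation (nbhd_empirical n \<omega>) f"

definition cond_law ::
  "(nat \<Rightarrow> nat pmf) \<Rightarrow> 'x pmf \<Rightarrow> ('x star \<Rightarrow> real) \<Rightarrow> real \<Rightarrow> nat \<Rightarrow> 'x star pmf measure" where
  "cond_law \<alpha>n \<nu> f b n =
     distr (uniform_measure (measure_pmf (marked_CM n (\<alpha>n n) \<nu>)) {\<omega>. mean_exceeds f b n \<omega>})
       (borel_of weak_topology) (nbhd_empirical n)"

definition ln_ereal :: "real \<Rightarrow> ereal" where
  "ln_ereal p = (if p = 0 then - \<infinity> else ereal (ln p))"

definition tilted_solution ::
  "nat \<Rightarrow> nat pmf \<Rightarrow> 'x::finite pmf \<Rightarrow> ('x \<Rightarrow> real) \<Rightarrow> real \<Rightarrow> (nat \<times> 'x) pmf \<Rightarrow> real \<Rightarrow> bool" where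
  "tilted_solution M \<alpha> \<nu> h c \<gamma> t \<longleftrightarrow>
     0 < t \<and> set_pmf \<gamma> \<subseteq> {0..M} \<times> UNIV \<and>
     (\<forall>n\<in>{0..M}. \<forall>x. pmf \<gamma> (n, x) =
        pmf \<alpha> n * (pmf \<nu> x * exp (t * real n * h x) / (\<Sum>y\<in>UNIV. pmf \<nu> y * exp (t * real n * h y)))) \<and>
     (\<Sum>m=0..M. \<Sum>y\<in>UNIV. real m * h y * pmf \<gamma> (m, y)) = c"

definition size_biased :: "nat \<Rightarrow> real \<Rightarrow> (nat \<times> 'x) pmf \<Rightarrow> 'x pmf" where
  "size_biased M \<kappa> \<gamma> = embed_pmf (\<lambda>x. 1 / \<kappa> * (\<Sum>n=0..M. real n * pmf \<gamma> (n, x)))"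

lemma pmf_size_biased:
  fixes \<gamma> :: "(nat \<times> 'x::finite) pmf" and \<nu> :: "'x pmf"
  assumes "CM_sequence M \<kappa> \<alpha> \<alpha>n" "tilted_solution M \<alpha> \<nu> h c \<gamma> t"
  shows "pmf (size_biased M \<kappa> \<gamma>) x = 1 / \<kappa> * (\<Sum>n=0..M. real n * pmf \<gamma> (n, x))"
  unfolding size_biased_def
proof (rule pmf_embed_pmf)
  have k: "0 < \<kappa>" and m: "(\<Sum>i=0..M. real i * pmf \<alpha> i) = \<kappa>"
    using assms(1) by (auto simp: CM_sequence_def)
  show nn: "0 \<le> 1 / \<kappa> * (\<Sum>n=0..M. real n * pmf \<gamma> (n, x))" for x
    using k by (intro mult_nonneg_nonneg sum_nonneg) auto
  have marg: "(\<Sum>x\<in>UNIV. pmf \<gamma> (n, x)) = pmf \<alpha> n" if "n \<in> {0..M}" for n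
  proof -
    let ?w = "\<lambda>x. pmf \<nu> x * exp (t * real n * h x)"
    obtain x0 where "x0 \<in> set_pmf \<nu>" using set_pmf_not_empty[of \<nu>] by blast
    then have "pmf \<nu> x0 > 0" by (rule pmf_positive)
    then have "sum ?w UNIV > 0"
      by (intro sum_pos2[of _ x0]) auto
    moreover have "pmf \<gamma> (n, x) = pmf \<alpha> n * (?w x / sum ?w UNIV)" for x
      using assms(2) that by (simp add: tilted_solution_def)
    ultimately show ?thesis
      by (simp flip: sum_distrib_left sum_divide_distrib)
  qed
  have "(\<Sum>x\<in>UNIV. 1 / \<kappa> * (\<Sum>n=0..M. real n * pmf \<gamma> (n, x))) =
        1 / \<kappa> * (\<Sum>n=0..M. real n * (\<Sum>x\<in>UNIV. pmf \<gamma> (n, x)))"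
    by (simp only: sum_distrib_left) (rule sum.swap)
  also have "\<dots> = 1 / \<kappa> * (\<Sum>n=0..M. real n * pmf \<alpha> n)"
    by (intro arg_cong[where f = "\<lambda>z. 1 / \<kappa> * z"] sum.cong refl) (simp add: marg)
  also have "\<dots> = 1" using m k by simp
  finally have s: "(\<Sum>x\<in>UNIV. 1 / \<kappa> * (\<Sum>n=0..M. real n * pmf \<gamma> (n, x))) = 1" .
  show "(\<integral>\<^sup>+x. ennreal (1 / \<kappa> * (\<Sum>n=0..M. real n * pmf \<gamma> (n, x))) \<partial>count_space UNIV) = 1"
    by (simp only: nn_integral_count_space_finite[OF finite_class.finite_UNIV] sum_ennreal[OF nn] s ennreal_1)
qed

definition mu_star :: "nat \<Rightarrow> real \<Rightarrow> (nat \<times> 'x) pmf \<Rightarrow> 'x star pmf" where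
  "mu_star M \<kappa> \<gamma> = star_law \<gamma> (size_biased M \<kappa> \<gamma>)"

end

theory Submission
  imports Defs
begin

text \<open>
  Regrouped by the vertex carrying the mark, \<open>n\<langle>L\<^sub>n, f\<rangle>\<close> is the sum of \<open>deg(v) h(X\<^sub>v)\<close> over the vertices, and given the
  graph this is a sum of independent variables. Tilting the mark of each vertex \<open>v\<close> by
  \<open>exp (t deg(v) h)\<close> multiplies the law of the marked graph by
  \<open>exp (n (t \<langle>L\<^sub>n, f\<rangle> - \<Lambda>\<^sub>n(t)))\<close>, where \<open>\<Lambda>\<^sub>n(t)\<close> is deterministic. Hence the probability of
  \<open>\<langle>L\<^sub>n, f\<rangle> \<ge> c\<close> has exponential rate \<open>t c - \<Lambda>(t)\<close> for the \<open>t\<close> whose tilted mean is \<open>c\<close>, and it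
  remains to show that under the tilted law \<open>L\<^sub>n\<close> is exponentially concentrated around the star
  law \<open>\<mu>\<^sup>*\<close>.

  For this, fix the marks and switch two uniformly chosen edges of the graph, which preserves the
  uniform law. The expected change of the number of pairs (vertex of degree \<open>d\<close> and mark \<open>x\<close>, set of its
  neighbors with marks \<open>C\<close>) is, up to \<open>O(1/n)\<close>, a combination of this number and of those for
  \<open>C - {#y#}\<close>, with weights proportional to the number of half-edges at vertices of mark \<open>y\<close>. By
  Chatterjee's method this expected change is exponentially concentrated around 0, and induction on
  \<open>C\<close> identifies the limits of all these numbers.
\<close>

section \<open>An exchangeable-pair moment bound\<close>

text \<open>A uniform simple graph has no product structure, so inequalities for independent
  variables control only the marks; for the graph, switches supply an exchangeable pair. They keep
  all degrees and thus the tilted weight, which depends on the graph through its degrees alone.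

  Equations for the numbers of vertices with a given star would link all stars that differ in one
  leaf. Counting subsets of neighbors with marks \<open>C\<close> avoids this: on average the loss
  of a neighbor lowers their number by a known fraction, and a new neighbor of mark \<open>y\<close>
  acts only through \<open>C - {#y#}\<close>. The equations are triangular in \<open>size C\<close>,
  start at the empty multiset, where Hoeffding's inequality applies, and at full size give the
  stars.

  In the decay estimate, the event outside \<open>A\<close> keeps the tilt \<open>t\<close> for
  \<open>c\<close> although the level is \<open>c - \<delta>\<close>; this loses a factor
  \<open>exp (n t \<delta>)\<close>. The probability of the condition has its own tilt, which tends
  to \<open>t\<close> as \<delta> decreases to 0. The gain from concentration under the tilt
  \<open>t\<close> is independent of \<delta> and wins for small \<delta>.\<close>

lemma abs_exp_diff_le:
  fixes a b :: real
  shows "\<bar>exp a - exp b\<bar> \<le> \<bar>a - b\<bar> * (exp a + exp b)"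
proof -
  have *: "exp a - exp b \<le> \<bar>a - b\<bar> * (exp a + exp b)" for a b :: real
  proof -
    have "1 + (b - a) \<le> exp (b - a)" by (rule exp_ge_add_one_self)
    then have "exp a * (1 + (b - a)) \<le> exp a * exp (b - a)" by (intro mult_left_mono) auto
    then have "exp a - exp b \<le> (a - b) * exp a" by (simp add: exp_diff algebra_simps)
    also have "\<dots> \<le> \<bar>a - b\<bar> * (exp a + exp b)"
      by (intro mult_mono) auto
    finally show ?thesis .
  qed
  show ?thesis using *[of a b] *[of b a] by (auto simp: abs_le_iff abs_minus_commute add.commute)
qed

text \<open>
  Chatterjee's exchangeable-pair argument: \<open>sym\<close> says that the pair (state, state after a random
  move) is exchangeable, and \<open>drift\<close> that \<open>W\<close> is, up to \<open>e\<close>, the rescaled expected change of \<open>G\<close>.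
  Exchangeability bounds the logarithmic derivative of the moment generating function of \<open>W\<close> by
  \<open>K \<theta> + e\<close>.
\<close>

lemma exchangeable_mgf_bound:
  fixes G W w :: "'e \<Rightarrow> real" and Q :: "'e \<Rightarrow> 'q set" and T :: "'e \<Rightarrow> 'q \<Rightarrow> 'e"
  assumes fin: "finite S"
    and sym: "\<And>F :: 'e \<Rightarrow> 'e \<Rightarrow> real.
      (\<Sum>x\<in>S. \<Sum>q\<in>Q x. F x (T x q)) = (\<Sum>x\<in>S. \<Sum>q\<in>Q x. F (T x q) x)"
    and w0: "\<And>x. x \<in> S \<Longrightarrow> 0 \<le> w x"
    and winv: "\<And>x q. x \<in> S \<Longrightarrow> q \<in> Q x \<Longrightarrow> w (T x q) = w x"
    and dG: "\<And>x q. x \<in> S \<Longrightarrow> q \<in> Q x \<Longrightarrow> \<bar>G x - G (T x q)\<bar> \<le> a"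
    and dW: "\<And>x q. x \<in> S \<Longrightarrow> q \<in> Q x \<Longrightarrow> \<bar>W x - W (T x q)\<bar> \<le> b"
    and cQ: "\<And>x. x \<in> S \<Longrightarrow> real (card (Q x)) \<le> m"
    and drift: "\<And>x. x \<in> S \<Longrightarrow> \<bar>n * W x - (\<Sum>q\<in>Q x. G x - G (T x q))\<bar> \<le> n * e"
    and n: "0 < n" and a: "0 \<le> a" and b: "0 \<le> b" and K: "a * b * m \<le> K * n"
    and \<theta>: "0 \<le> \<theta>"
  shows "(\<Sum>x\<in>S. w x * exp (\<theta> * W x)) \<le> (\<Sum>x\<in>S. w x) * exp (K * \<theta>\<^sup>2 / 2 + e * \<theta>)"
proof -
  define \<phi> where "\<phi> \<theta> = (\<Sum>x\<in>S. w x * exp (\<theta> * W x))" for \<theta>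
  define \<phi>' where "\<phi>' \<theta> = (\<Sum>x\<in>S. w x * (exp (\<theta> * W x) * W x))" for \<theta>
  have der: "(\<phi> has_real_derivative \<phi>' \<theta>) (at \<theta>)" for \<theta>
    unfolding \<phi>_def \<phi>'_def
    by (auto intro!: derivative_eq_intros sum.cong)
  have \<phi>0: "0 \<le> \<phi> \<theta>" for \<theta> unfolding \<phi>_def by (intro sum_nonneg) (auto simp: w0)
  have bound: "\<phi>' \<theta> \<le> (K * \<theta> + e) * \<phi> \<theta>" if th: "0 \<le> \<theta>" for \<theta>
  proof -
    define E where "E x = exp (\<theta> * W x)" for x
    have "n * \<phi>' \<theta> = (\<Sum>x\<in>S. w x * E x * (n * W x))"
      by (simp add: \<phi>'_def E_def sum_distrib_left mult_ac)
    also have "\<dots> \<le> (\<Sum>x\<in>S. w x * E x * ((\<Sum>q\<in>Q x. G x - G (T x q)) + n * e))"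
    proof (intro sum_mono mult_left_mono)
      fix x assume "x \<in> S"
      then show "n * W x \<le> (\<Sum>q\<in>Q x. G x - G (T x q)) + n * e" using drift[of x] by linarith
    qed (auto simp: w0 E_def)
    also have "\<dots> = (\<Sum>x\<in>S. \<Sum>q\<in>Q x. w x * (G x - G (T x q)) * E x) + n * e * \<phi> \<theta>"
      by (simp add: \<phi>_def E_def algebra_simps sum.distrib sum_distrib_left)
    finally have 1: "n * \<phi>' \<theta> \<le> (\<Sum>x\<in>S. \<Sum>q\<in>Q x. w x * (G x - G (T x q)) * E x) + n * e * \<phi> \<theta>" .
    \<comment> \<open>Averaging the sum with its exchanged form replaces the factor
      \<open>E x\<close> by half of \<open>E x - E (T x q)\<close>, which is of order \<theta>;
      hence the quadratic term in the final exponent.\<close>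
    have "(\<Sum>x\<in>S. \<Sum>q\<in>Q x. w x * (G x - G (T x q)) * E x)
        = (\<Sum>x\<in>S. \<Sum>q\<in>Q x. w (T x q) * (G (T x q) - G x) * E (T x q))"
      by (rule sym)
    also have "\<dots> = (\<Sum>x\<in>S. \<Sum>q\<in>Q x. - (w x * (G x - G (T x q)) * E (T x q)))"
      by (intro sum.cong refl) (simp add: winv algebra_simps)
    finally have "2 * (\<Sum>x\<in>S. \<Sum>q\<in>Q x. w x * (G x - G (T x q)) * E x)
        = (\<Sum>x\<in>S. \<Sum>q\<in>Q x. w x * (G x - G (T x q)) * (E x - E (T x q)))"
      by (simp add: algebra_simps sum.distrib sum_negf sum_subtractf)
    also have "\<dots> \<le> (\<Sum>x\<in>S. \<Sum>q\<in>Q x. w x * (a * (\<theta> * b * (E x + E (T x q)))))"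
    proof (intro sum_mono)
      fix x q assume xq: "x \<in> S" "q \<in> Q x"
      have "(G x - G (T x q)) * (E x - E (T x q)) \<le> \<bar>G x - G (T x q)\<bar> * \<bar>E x - E (T x q)\<bar>"
        by (metis abs_ge_self abs_mult)
      also have "\<dots> \<le> a * (\<theta> * b * (E x + E (T x q)))"
      proof (rule mult_mono[OF dG[OF xq] _ a])
        have "\<bar>E x - E (T x q)\<bar> \<le> \<bar>\<theta> * W x - \<theta> * W (T x q)\<bar> * (E x + E (T x q))"
          unfolding E_def by (rule abs_exp_diff_le)
        also have "\<bar>\<theta> * W x - \<theta> * W (T x q)\<bar> = \<theta> * \<bar>W x - W (T x q)\<bar>"
          using th by (simp add: abs_mult flip: right_diff_distrib)
        also have "\<theta> * \<bar>W x - W (T x q)\<bar> * (E x + E (T x q)) \<le> \<theta> * b * (E x + E (T x q))"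
          using dW[OF xq] th by (intro mult_right_mono mult_left_mono) (auto simp: E_def)
        finally show "\<bar>E x - E (T x q)\<bar> \<le> \<theta> * b * (E x + E (T x q))" .
      qed auto
      finally show "w x * (G x - G (T x q)) * (E x - E (T x q))
          \<le> w x * (a * (\<theta> * b * (E x + E (T x q))))"
        using w0[OF xq(1)] by (simp add: mult.assoc mult_left_mono)
    qed
    also have "\<dots> = a * \<theta> * b * ((\<Sum>x\<in>S. \<Sum>q\<in>Q x. w x * E x) + (\<Sum>x\<in>S. \<Sum>q\<in>Q x. w (T x q) * E (T x q)))"
      by (simp add: winv sum_distrib_left sum.distrib algebra_simps)
    also have "(\<Sum>x\<in>S. \<Sum>q\<in>Q x. w (T x q) * E (T x q)) = (\<Sum>x\<in>S. \<Sum>q\<in>Q x. w x * E x)"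
      by (rule sym)
    finally have "(\<Sum>x\<in>S. \<Sum>q\<in>Q x. w x * (G x - G (T x q)) * E x)
        \<le> a * \<theta> * b * (\<Sum>x\<in>S. \<Sum>q\<in>Q x. w x * E x)" by simp
    also have "\<dots> \<le> a * \<theta> * b * (\<Sum>x\<in>S. m * (w x * E x))"
      using a b th
      by (intro mult_left_mono sum_mono) (auto intro!: mult_right_mono cQ simp: w0 E_def)
    also have "\<dots> = a * b * m * (\<theta> * \<phi> \<theta>)" by (simp add: \<phi>_def E_def flip: sum_distrib_left)
    also have "\<dots> \<le> K * n * (\<theta> * \<phi> \<theta>)" using K th \<phi>0 by (intro mult_right_mono) auto
    finally have "n * \<phi>' \<theta> \<le> n * ((K * \<theta> + e) * \<phi> \<theta>)" using 1 by (simp add: algebra_simps)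
    then show ?thesis using n by simp
  qed
  \<comment> \<open>Gronwall's argument: \<open>\<phi>\<close> is divided by the solution of
    \<open>y' = (K * \<theta> + e) * y\<close> with value 1 at 0.\<close>
  define \<psi> where "\<psi> \<theta> = \<phi> \<theta> * exp (- (K * \<theta>\<^sup>2 / 2 + e * \<theta>))" for \<theta>
  have "\<psi> \<theta> \<le> \<psi> 0"
  proof (rule DERIV_nonpos_imp_nonincreasing[OF \<theta>])
    fix t assume t: "0 \<le> t" "t \<le> \<theta>"
    let ?x = "exp (- (K * t\<^sup>2 / 2 + e * t))"
    have "(\<psi> has_real_derivative (\<phi>' t * ?x + \<phi> t * (?x * - (K * t + e)))) (at t)"
      unfolding \<psi>_def by (auto intro!: derivative_eq_intros der)
    moreover have "\<phi>' t * ?x + \<phi> t * (?x * - (K * t + e)) = ?x * (\<phi>' t - (K * t + e) * \<phi> t)"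
      by (simp add: algebra_simps)
    moreover have "\<dots> \<le> 0" using bound[OF t(1)] by (simp add: mult_le_0_iff)
    ultimately show "\<exists>y. (\<psi> has_real_derivative y) (at t) \<and> y \<le> 0" by metis
  qed
  then have "\<phi> \<theta> * exp (- (K * \<theta>\<^sup>2 / 2 + e * \<theta>)) \<le> (\<Sum>x\<in>S. w x)"
    by (simp add: \<psi>_def \<phi>_def)
  then have "\<phi> \<theta> \<le> (\<Sum>x\<in>S. w x) * exp (K * \<theta>\<^sup>2 / 2 + e * \<theta>)"
    by (simp add: exp_minus field_simps)
  then show ?thesis by (simp add: \<phi>_def)
qed

section \<open>Switches of simple graphs\<close>

lemma finite_simple_graphs: "finite (simple_graphs n)"
  by (rule finite_subset[of _ "Pow (Pow {1..n})"]) (auto simp: simple_graphs_def)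

lemma simple_graphs_edge:
  assumes "E \<in> simple_graphs n" "{u, v} \<in> E"
  shows "u \<noteq> v" "u \<in> {1..n}" "v \<in> {1..n}"
proof -
  have "{u, v} \<subseteq> {1..n}" "card {u, v} = 2" using assms unfolding simple_graphs_def by blast+
  then show "u \<noteq> v" "u \<in> {1..n}" "v \<in> {1..n}" by auto
qed

abbreviation deg :: "nat set set \<Rightarrow> nat \<Rightarrow> nat" where
  "deg E v \<equiv> card (nbrs E v)"

definition arcs :: "nat set set \<Rightarrow> (nat \<times> nat) set" where
  "arcs E = {(u, v). {u, v} \<in> E}"

lemma finite_arcs: "E \<in> simple_graphs n \<Longrightarrow> finite (arcs E)"
  by (rule finite_subset[of _ "{1..n} \<times> {1..n}"]) (auto simp: arcs_def dest: simple_graphs_edge)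

lemma arcs_eq_Sigma: "E \<in> simple_graphs n \<Longrightarrow> arcs E = (SIGMA u:{1..n}. nbrs E u)"
  by (auto simp: arcs_def nbrs_def dest: simple_graphs_edge)

lemma sum_arcs_fst:
  fixes f :: "nat \<Rightarrow> nat \<Rightarrow> real"
  assumes "E \<in> simple_graphs n"
  shows "(\<Sum>(u, v)\<in>arcs E. f u v) = (\<Sum>u\<in>{1..n}. \<Sum>v\<in>nbrs E u. f u v)"
  unfolding arcs_eq_Sigma[OF assms]
  by (subst sum.Sigma) (auto intro: finite_nbrs[OF assms])

lemma sum_arcs_swap:
  fixes f :: "nat \<Rightarrow> nat \<Rightarrow> real"
  shows "(\<Sum>(u, v)\<in>arcs E. f u v) = (\<Sum>(u, v)\<in>arcs E. f v u)"
  by (rule sum.reindex_bij_witness[of _ "\<lambda>(u, v). (v, u)" "\<lambda>(u, v). (v, u)"])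
    (auto simp: arcs_def insert_commute)

lemma sum_arcs_snd:
  fixes f :: "nat \<Rightarrow> real"
  assumes "E \<in> simple_graphs n"
  shows "(\<Sum>(u, v)\<in>arcs E. f v) = (\<Sum>v\<in>{1..n}. real (deg E v) * f v)"
  using sum_arcs_swap[of "\<lambda>u v. f v" E] sum_arcs_fst[OF assms, of "\<lambda>u v. f u"] by simp

text \<open>A switch replaces the edges \<open>uv\<close>, \<open>wz\<close> by \<open>uz\<close>, \<open>wv\<close>; it preserves all degrees and is undone
  by the switch \<open>(u, z, w, v)\<close>.\<close>

definition switches :: "nat set set \<Rightarrow> (nat \<times> nat \<times> nat \<times> nat) set" where
  "switches E = {(u, v, w, z). {u, v} \<in> E \<and> {w, z} \<in> E \<and> u \<noteq> z \<and> w \<noteq> v \<and> {u, z} \<notin> E \<and> {w, v} \<notin> E}"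

fun switch :: "nat set set \<Rightarrow> nat \<times> nat \<times> nat \<times> nat \<Rightarrow> nat set set" where
  "switch E (u, v, w, z) = (E - {{u, v}, {w, z}}) \<union> {{u, z}, {w, v}}"

lemma switches_distinct:
  assumes "E \<in> simple_graphs n" "(u, v, w, z) \<in> switches E"
  shows "u \<noteq> v" "u \<noteq> w" "u \<noteq> z" "v \<noteq> w" "v \<noteq> z" "w \<noteq> z"
  using assms simple_graphs_edge[OF assms(1)] by (auto simp: switches_def)

lemma switches_in_range:
  assumes "E \<in> simple_graphs n" "(u, v, w, z) \<in> switches E"
  shows "{u, v, w, z} \<subseteq> {1..n}"
  using assms simple_graphs_edge[OF assms(1)] by (auto simp: switches_def)

text \<open>Exchanging the two arcs and reversing both of them give the same switch, so a statement
  about the first vertex \<open>u\<close> transfers to the other three.\<close>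

lemma switches_sym:
  assumes "(u, v, w, z) \<in> switches E"
  shows "(w, z, u, v) \<in> switches E" "(v, u, z, w) \<in> switches E" "(z, w, v, u) \<in> switches E"
  using assms by (auto simp: switches_def insert_commute)

lemma switch_sym:
  "switch E (w, z, u, v) = switch E (u, v, w, z)"
  "switch E (v, u, z, w) = switch E (u, v, w, z)"
  "switch E (z, w, v, u) = switch E (u, v, w, z)"
  by (auto simp: insert_commute)

lemma switch_simple:
  assumes "E \<in> simple_graphs n" "q \<in> switches E"
  shows "switch E q \<in> simple_graphs n"
proof -
  obtain u v w z where q: "q = (u, v, w, z)" by (cases q)
  show ?thesis
    using assms switches_distinct[OF assms(1), of u v w z] switches_in_range[OF assms(1), of u v w z]
    by (auto simp: q simple_graphs_def)
qed

lemma nbrs_switch: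
  assumes "E \<in> simple_graphs n" "(u, v, w, z) \<in> switches E"
  shows "nbrs (switch E (u, v, w, z)) u = insert z (nbrs E u - {v})"
  using assms switches_distinct[OF assms] by (auto simp: nbrs_def doubleton_eq_iff)

lemma nbrs_switch_other:
  assumes "x \<notin> {u, v, w, z}"
  shows "nbrs (switch E (u, v, w, z)) x = nbrs E x"
  using assms by (auto simp: nbrs_def doubleton_eq_iff)

lemma card_nbrs_switch:
  assumes E: "E \<in> simple_graphs n" and q: "q \<in> switches E"
  shows "deg (switch E q) x = deg E x"
proof -
  have *: "deg (switch E (u, v, w, z)) u = deg E u"
    if uvwz: "(u, v, w, z) \<in> switches E" for u v w z
  proof -
    have "v \<in> nbrs E u" "z \<notin> nbrs E u" using uvwz by (auto simp: switches_def nbrs_def)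
    then have "card (insert z (nbrs E u - {v})) = deg E u"
      using card_Suc_Diff1[of "nbrs E u" v] finite_nbrs[OF E, of u] by simp
    then show ?thesis by (simp only: nbrs_switch[OF E uvwz])
  qed
  obtain u v w z where q': "q = (u, v, w, z)" by (cases q)
  note s = switches_sym[OF q[unfolded q']]
  show ?thesis
  proof (cases "x \<in> {u, v, w, z}")
    case True
    then consider "x = u" | "x = v" | "x = w" | "x = z" by blast
    then show ?thesis
      unfolding q'
      by cases (use *[OF q[unfolded q']] *[OF s(1)] *[OF s(2)] *[OF s(3)] in \<open>simp_all only: switch_sym\<close>)
  next
    case False
    then show ?thesis unfolding q' by (simp add: nbrs_switch_other del: switch.simps)
  qed
qed

lemma switch_inverse:
  assumes E: "E \<in> simple_graphs n" and q: "(u, v, w, z) \<in> switches E"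
  shows "(u, z, w, v) \<in> switches (switch E (u, v, w, z))"
    and "switch (switch E (u, v, w, z)) (u, z, w, v) = E"
  using q switches_distinct[OF E q] by (auto simp: switches_def doubleton_eq_iff)

text \<open>Performing a switch and recording its inverse is an involution on the pairs (graph,
  switch). This is the exchangeability required by \<open>exchangeable_mgf_bound\<close>, on any set
  of graphs closed under switches.\<close>

lemma sum_switches_swap:
  fixes F :: "nat set set \<Rightarrow> nat set set \<Rightarrow> real"
  assumes S: "S \<subseteq> simple_graphs n" and fin: "\<And>E. E \<in> S \<Longrightarrow> finite (switches E)"
    and closed: "\<And>E q. E \<in> S \<Longrightarrow> q \<in> switches E \<Longrightarrow> switch E q \<in> S"
  shows "(\<Sum>E\<in>S. \<Sum>q\<in>switches E. F E (switch E q)) = (\<Sum>E\<in>S. \<Sum>q\<in>switches E. F (switch E q) E)"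
proof -
  have fS: "finite S" using S finite_simple_graphs by (rule finite_subset)
  define \<Phi> where "\<Phi> = (\<lambda>(E, u, v, w, z). (switch E (u, v, w, z), u, z, w, v))"
  have \<Phi>: "\<Phi> p \<in> Sigma S switches" "\<Phi> (\<Phi> p) = p" if "p \<in> Sigma S switches" for p
  proof -
    obtain E u v w z where p: "p = (E, u, v, w, z)" by (cases p)
    then have E: "E \<in> S" and q: "(u, v, w, z) \<in> switches E" using that by auto
    have E': "E \<in> simple_graphs n" using E S by auto
    show "\<Phi> p \<in> Sigma S switches"
      using closed[OF E q] switch_inverse(1)[OF E' q] by (simp add: \<Phi>_def p del: switch.simps)
    show "\<Phi> (\<Phi> p) = p"
      using switch_inverse(2)[OF E' q] by (simp add: \<Phi>_def p del: switch.simps)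
  qed
  have sn: "switch (fst (\<Phi> p)) (snd (\<Phi> p)) = fst p" "fst (\<Phi> p) = switch (fst p) (snd p)"
    if "p \<in> Sigma S switches" for p
    using \<Phi>(2)[OF that] by (auto simp: \<Phi>_def case_prod_beta prod_eq_iff simp del: switch.simps)
  have "(\<Sum>E\<in>S. \<Sum>q\<in>switches E. F E (switch E q)) = (\<Sum>p\<in>Sigma S switches. F (fst p) (switch (fst p) (snd p)))"
    using fS fin by (subst sum.Sigma) (auto simp: case_prod_beta)
  also have "\<dots> = (\<Sum>p\<in>Sigma S switches. F (switch (fst p) (snd p)) (fst p))"
  proof (rule sum.reindex_bij_witness[of _ \<Phi> \<Phi>])
    fix p assume "p \<in> Sigma S switches"
    note sn = sn[OF this]
    show "F (switch (fst (\<Phi> p)) (snd (\<Phi> p))) (fst (\<Phi> p)) = F (fst p) (switch (fst p) (snd p))"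
      unfolding sn(1) unfolding sn(2) ..
  qed (auto simp: \<Phi>)
  also have "\<dots> = (\<Sum>E\<in>S. \<Sum>q\<in>switches E. F (switch E q) E)"
    using fS fin by (subst sum.Sigma) (auto simp: case_prod_beta)
  finally show ?thesis .
qed

lemma switches_subset: "switches E \<subseteq> (\<lambda>((u, v), (w, z)). (u, v, w, z)) ` (arcs E \<times> arcs E)"
  by (auto simp: switches_def arcs_def image_iff)

lemma finite_switches: "E \<in> simple_graphs n \<Longrightarrow> finite (switches E)"
  by (rule finite_subset[OF switches_subset]) (auto simp: finite_arcs)

lemma card_switches_le:
  assumes "E \<in> simple_graphs n"
  shows "card (switches E) \<le> card (arcs E) * card (arcs E)"
proof -
  have "card (switches E) \<le> card (arcs E \<times> arcs E)"
    by (rule surj_card_le[OF _ switches_subset]) (simp add: finite_arcs[OF assms])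
  then show ?thesis by (simp add: card_cartesian_product)
qed

lemma card_arcs_eq:
  assumes "E \<in> simple_graphs n"
  shows "card (arcs E) = (\<Sum>v\<in>{1..n}. deg E v)"
  unfolding arcs_eq_Sigma[OF assms] by (subst card_SigmaI) (auto intro: finite_nbrs[OF assms])

text \<open>The drift of a sum over vertices of a function of the neighborhood: by symmetry, each of the
  four vertices of a switch contributes equally.\<close>

lemma switch_diff:
  fixes g :: "nat \<Rightarrow> nat set \<Rightarrow> real"
  assumes E: "E \<in> simple_graphs n" and q: "(u, v, w, z) \<in> switches E"
  defines "\<Delta> \<equiv> \<lambda>u v z. g u (insert z (nbrs E u - {v})) - g u (nbrs E u)"
  shows "(\<Sum>x\<in>{1..n}. g x (nbrs (switch E (u, v, w, z)) x)) - (\<Sum>x\<in>{1..n}. g x (nbrs E x))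
    = \<Delta> u v z + \<Delta> v u w + \<Delta> w z v + \<Delta> z w u"
proof -
  let ?E = "switch E (u, v, w, z)"
  have "(\<Sum>x\<in>{1..n}. g x (nbrs ?E x)) - (\<Sum>x\<in>{1..n}. g x (nbrs E x))
      = (\<Sum>x\<in>{1..n}. g x (nbrs ?E x) - g x (nbrs E x))" by (simp add: sum_subtractf)
  also have "\<dots> = (\<Sum>x\<in>{u, v, w, z}. g x (nbrs ?E x) - g x (nbrs E x))"
    by (rule sum.mono_neutral_right) (use switches_in_range[OF E q] nbrs_switch_other in auto)
  also have "\<dots> = (\<Sum>x\<leftarrow>[u, v, w, z]. g x (nbrs ?E x) - g x (nbrs E x))"
    using switches_distinct[OF E q] by (subst sum_list_distinct_conv_sum_set) auto
  also have "\<dots> = \<Delta> u v z + \<Delta> v u w + \<Delta> w z v + \<Delta> z w u"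
    using nbrs_switch[OF E q] nbrs_switch[OF E switches_sym(1)[OF q]]
      nbrs_switch[OF E switches_sym(2)[OF q]] nbrs_switch[OF E switches_sym(3)[OF q]]
    by (simp add: \<Delta>_def switch_sym del: switch.simps)
  finally show ?thesis .
qed

lemma switch_drift:
  fixes g :: "nat \<Rightarrow> nat set \<Rightarrow> real"
  assumes E: "E \<in> simple_graphs n"
  shows "(\<Sum>q\<in>switches E. (\<Sum>x\<in>{1..n}. g x (nbrs (switch E q) x)) - (\<Sum>x\<in>{1..n}. g x (nbrs E x)))
    = 4 * (\<Sum>(u, v, w, z)\<in>switches E. g u (insert z (nbrs E u - {v})) - g u (nbrs E u))"
proof -
  define \<Delta> where "\<Delta> u v z = g u (insert z (nbrs E u - {v})) - g u (nbrs E u)" for u v z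
  have "(\<Sum>q\<in>switches E. (\<Sum>x\<in>{1..n}. g x (nbrs (switch E q) x)) - (\<Sum>x\<in>{1..n}. g x (nbrs E x)))
      = (\<Sum>(u, v, w, z)\<in>switches E. \<Delta> u v z + \<Delta> v u w + \<Delta> w z v + \<Delta> z w u)"
    unfolding \<Delta>_def by (intro sum.cong refl, clarify, rule switch_diff[OF E])
  also have "\<dots> = (\<Sum>(u, v, w, z)\<in>switches E. \<Delta> u v z) + (\<Sum>(u, v, w, z)\<in>switches E. \<Delta> v u w)
      + (\<Sum>(u, v, w, z)\<in>switches E. \<Delta> w z v) + (\<Sum>(u, v, w, z)\<in>switches E. \<Delta> z w u)"
    by (simp add: case_prod_beta sum.distrib)
  also have "(\<Sum>(u, v, w, z)\<in>switches E. \<Delta> v u w) = (\<Sum>(u, v, w, z)\<in>switches E. \<Delta> u v z)"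
    by (rule sum.reindex_bij_witness[of _ "\<lambda>(u, v, w, z). (v, u, z, w)" "\<lambda>(u, v, w, z). (v, u, z, w)"])
      (auto dest: switches_sym)
  also have "(\<Sum>(u, v, w, z)\<in>switches E. \<Delta> w z v) = (\<Sum>(u, v, w, z)\<in>switches E. \<Delta> u v z)"
    by (rule sum.reindex_bij_witness[of _ "\<lambda>(u, v, w, z). (w, z, u, v)" "\<lambda>(u, v, w, z). (w, z, u, v)"])
      (auto dest: switches_sym)
  also have "(\<Sum>(u, v, w, z)\<in>switches E. \<Delta> z w u) = (\<Sum>(u, v, w, z)\<in>switches E. \<Delta> u v z)"
    by (rule sum.reindex_bij_witness[of _ "\<lambda>(u, v, w, z). (z, w, v, u)" "\<lambda>(u, v, w, z). (z, w, v, u)"])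
      (auto dest: switches_sym)
  finally show ?thesis by (simp add: \<Delta>_def)
qed

text \<open>All but \<open>O(n)\<close> of the pairs of arcs are switches.\<close>

lemma sum_switches_approx:
  fixes f :: "nat \<Rightarrow> nat \<Rightarrow> nat \<Rightarrow> real"
  assumes E: "E \<in> simple_graphs n" and M: "\<And>v. deg E v \<le> M"
    and f: "\<And>u v z. \<bar>f u v z\<bar> \<le> B"
  shows "\<bar>(\<Sum>(u, v, w, z)\<in>switches E. f u v z) - (\<Sum>(u, v)\<in>arcs E. \<Sum>(w, z)\<in>arcs E. f u v z)\<bar>
    \<le> real (n * M * (2 * M + 2 * M * M)) * B"
proof -
  define A where "A = (\<lambda>((u, v), (w, z)). (u, v, w, z)) ` (arcs E \<times> arcs E)"
  have inj: "inj_on (\<lambda>((u, v), (w, z)). (u, v, w, z)) X" for X :: "((nat \<times> nat) \<times> (nat \<times> nat)) set"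
    by (auto simp: inj_on_def)
  have fA: "finite A" by (simp add: A_def finite_arcs[OF E])
  have B0: "0 \<le> B" using f[of 0 0 0] by linarith
  have "(\<Sum>(u, v)\<in>arcs E. \<Sum>(w, z)\<in>arcs E. f u v z) = (\<Sum>(u, v, w, z)\<in>A. f u v z)"
    unfolding A_def by (subst sum.reindex[OF inj]) (auto simp: sum.cartesian_product case_prod_beta)
  then have "\<bar>(\<Sum>(u, v, w, z)\<in>switches E. f u v z) - (\<Sum>(u, v)\<in>arcs E. \<Sum>(w, z)\<in>arcs E. f u v z)\<bar>
      = \<bar>\<Sum>(u, v, w, z)\<in>A - switches E. f u v z\<bar>"
    using sum_diff[OF fA switches_subset[of E, folded A_def], of "\<lambda>(u, v, w, z). f u v z"] by linarith
  also have "\<dots> \<le> (\<Sum>(u, v, w, z)\<in>A - switches E. \<bar>f u v z\<bar>)"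
    by (rule order_trans[OF sum_abs]) (simp add: case_prod_beta)
  also have "\<dots> \<le> real (card (A - switches E)) * B"
    by (rule sum_bounded_above[THEN order_trans]) (auto simp: f)
  also have "card (A - switches E) \<le> n * M * (2 * M + 2 * M * M)"
  proof -
    \<comment> \<open>A pair of arcs fails to be a switch if \<open>u = z\<close>,
      \<open>w = v\<close>, \<open>uz\<close> is an edge or \<open>wv\<close> is an edge. For fixed
      \<open>(u, v)\<close> these four cases leave the choices of \<open>(w, z)\<close> in
      \<open>R1 u\<close>, \<open>R2 v\<close>, \<open>R3 u\<close>, \<open>R4 v\<close>.\<close>
    define R1 where "R1 u = (\<lambda>w. (w, u)) ` nbrs E u" for u
    define R2 where "R2 v = Pair v ` nbrs E v" for v
    define R3 where "R3 u = (\<Union>z\<in>nbrs E u. (\<lambda>w. (w, z)) ` nbrs E z)" for u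
    define R4 where "R4 v = (\<Union>w\<in>nbrs E v. Pair w ` nbrs E w)" for v
    have fin: "finite (nbrs E x)" for x by (rule finite_nbrs[OF E])
    have c: "card (R1 u) \<le> M" "card (R2 v) \<le> M" "card (R3 u) \<le> M * M" "card (R4 v) \<le> M * M" for u v
    proof -
      show "card (R1 u) \<le> M" unfolding R1_def using card_image_le[OF fin] M order_trans by blast
      show "card (R2 v) \<le> M" unfolding R2_def using card_image_le[OF fin] M order_trans by blast
      have "card (R3 u) \<le> (\<Sum>z\<in>nbrs E u. card ((\<lambda>w. (w, z)) ` nbrs E z))"
        unfolding R3_def by (rule card_UN_le[OF fin])
      also have "\<dots> \<le> (\<Sum>z\<in>nbrs E u. M)"
        by (intro sum_mono) (use card_image_le[OF fin] M order_trans in blast)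
      also have "\<dots> \<le> M * M" using M[of u] by simp
      finally show "card (R3 u) \<le> M * M" .
      have "card (R4 v) \<le> (\<Sum>w\<in>nbrs E v. card (Pair w ` nbrs E w))"
        unfolding R4_def by (rule card_UN_le[OF fin])
      also have "\<dots> \<le> (\<Sum>z\<in>nbrs E v. M)"
        by (intro sum_mono) (use card_image_le[OF fin] M order_trans in blast)
      also have "\<dots> \<le> M * M" using M[of v] by simp
      finally show "card (R4 v) \<le> M * M" .
    qed
    have finR: "finite (R1 u)" "finite (R2 v)" "finite (R3 u)" "finite (R4 v)" for u v
      by (auto simp: R1_def R2_def R3_def R4_def fin)
    have "A - switches E \<subseteq> (\<lambda>((u, v), (w, z)). (u, v, w, z)) `
        (SIGMA (u, v):arcs E. R1 u \<union> R2 v \<union> R3 u \<union> R4 v)" (is "_ \<subseteq> _ ` ?S")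
    proof
      fix p assume p: "p \<in> A - switches E"
      then obtain u v w z where q: "p = (u, v, w, z)" "(u, v) \<in> arcs E" "(w, z) \<in> arcs E"
        by (auto simp: A_def)
      then have "u = z \<or> w = v \<or> {u, z} \<in> E \<or> {w, v} \<in> E"
        using p by (auto simp: switches_def arcs_def)
      moreover have wz: "{w, z} \<in> E" "{z, w} \<in> E" using q(3) by (auto simp: arcs_def insert_commute)
      ultimately have "(w, z) \<in> R1 u \<union> R2 v \<union> R3 u \<union> R4 v"
        by (auto simp: R1_def R2_def R3_def R4_def nbrs_def insert_commute)
      with q show "p \<in> (\<lambda>((u, v), (w, z)). (u, v, w, z)) ` ?S"
        by (auto intro!: image_eqI[of _ _ "((u, v), (w, z))"])
    qed
    then have "card (A - switches E) \<le> card ?S"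
      by (rule surj_card_le[rotated]) (auto intro!: finite_SigmaI finite_arcs[OF E] simp: finR)
    also have "\<dots> = (\<Sum>(u, v)\<in>arcs E. card (R1 u \<union> R2 v \<union> R3 u \<union> R4 v))"
      by (subst card_SigmaI) (auto simp: finite_arcs[OF E] finR case_prod_beta)
    also have "\<dots> \<le> (\<Sum>(u, v)\<in>arcs E. M + M + M * M + M * M)"
    proof (intro sum_mono, clarify)
      fix u v
      show "card (R1 u \<union> R2 v \<union> R3 u \<union> R4 v) \<le> M + M + M * M + M * M"
        using card_Un_le[of "R1 u \<union> R2 v \<union> R3 u" "R4 v"] card_Un_le[of "R1 u \<union> R2 v" "R3 u"]
          card_Un_le[of "R1 u" "R2 v"] c(1)[of u] c(2)[of v] c(3)[of u] c(4)[of v] by linarith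
    qed
    also have "\<dots> = card (arcs E) * (2 * M + 2 * M * M)" by (simp add: case_prod_beta)
    also have "card (arcs E) \<le> (\<Sum>v\<in>{1..n}. M)" unfolding card_arcs_eq[OF E] by (intro sum_mono M)
    finally show ?thesis by (simp add: mult_right_mono)
  qed
  then have "real (card (A - switches E)) * B \<le> real (n * M * (2 * M + 2 * M * M)) * B"
    using B0 by (intro mult_right_mono) (simp_all only: of_nat_le_iff)
  finally show ?thesis .
qed

section \<open>Counts of marked neighbor sets\<close>

definition sub_count :: "('v \<Rightarrow> 'x) \<Rightarrow> 'x multiset \<Rightarrow> 'v set \<Rightarrow> nat" where
  "sub_count X C N = card {T. T \<subseteq> N \<and> image_mset X (mset_set T) = C}"

lemma finite_sub_count_set: "finite N \<Longrightarrow> finite {T. T \<subseteq> N \<and> P T}"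
  by (rule finite_subset[of _ "Pow N"]) auto

lemma sub_count_le: "finite N \<Longrightarrow> sub_count X C N \<le> 2 ^ card N"
  unfolding sub_count_def
  by (subst card_Pow[symmetric], assumption, rule card_mono) auto

lemma sub_count_mono: "finite N \<Longrightarrow> N' \<subseteq> N \<Longrightarrow> sub_count X C N' \<le> sub_count X C N"
  unfolding sub_count_def by (rule card_mono[OF finite_sub_count_set]) auto

lemma sub_count_empty: "finite N \<Longrightarrow> sub_count X {#} N = 1"
proof -
  assume N: "finite N"
  then have "{T. T \<subseteq> N \<and> image_mset X (mset_set T) = {#}} = {{}}"
    by (auto simp: mset_set_empty_iff dest: finite_subset)
  then show ?thesis by (simp add: sub_count_def)
qed

lemma sub_count_full:
  assumes N: "finite N" and "size C = card N"
  shows "sub_count X C N = (if image_mset X (mset_set N) = C then 1 else 0)"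
proof -
  have "T = N" if "T \<subseteq> N" "image_mset X (mset_set T) = C" for T
  proof (rule card_subset_eq[OF N that(1)])
    have "size (image_mset X (mset_set T)) = card N" using that(2) assms by simp
    then show "card T = card N" by simp
  qed
  then have "{T. T \<subseteq> N \<and> image_mset X (mset_set T) = C}
      = (if image_mset X (mset_set N) = C then {N} else {})" by auto
  then show ?thesis by (simp add: sub_count_def)
qed

text \<open>The subsets are split by whether they contain \<open>z\<close>. The guard matters: if
  the mark of \<open>z\<close> is absent from \<open>C\<close>, then \<open>C - {#X z#}\<close> is
  \<open>C\<close> itself and must not be counted again.\<close>

lemma sub_count_insert:
  assumes N: "finite N" and z: "z \<notin> N"
  shows "sub_count X C (insert z N)
    = sub_count X C N + (if X z \<in># C then sub_count X (C - {#X z#}) N else 0)"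
proof -
  let ?A = "{T. T \<subseteq> N \<and> image_mset X (mset_set T) = C}"
  let ?B = "{T. T \<subseteq> N \<and> add_mset (X z) (image_mset X (mset_set T)) = C}"
  have ins: "image_mset X (mset_set (insert z T)) = add_mset (X z) (image_mset X (mset_set T))"
    if "T \<subseteq> N" for T using that N z by (subst mset_set.insert) (auto dest: finite_subset)
  have "{T. T \<subseteq> insert z N \<and> image_mset X (mset_set T) = C} = ?A \<union> insert z ` ?B" (is "?L = _")
  proof (intro equalityI subsetI)
    fix T assume T: "T \<in> ?L"
    show "T \<in> ?A \<union> insert z ` ?B"
    proof (cases "z \<in> T")
      case True
      then have "T = insert z (T - {z})" "T - {z} \<subseteq> N" using T by auto
      then show ?thesis using T ins[of "T - {z}"] by (intro UnI2 image_eqI[of _ _ "T - {z}"]) auto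
    qed (use T in auto)
  qed (use ins in auto)
  moreover have "?A \<inter> insert z ` ?B = {}" using z by auto
  moreover have "inj_on (insert z) ?B" using z by (auto simp: inj_on_def)
  ultimately have "sub_count X C (insert z N) = card ?A + card ?B"
    unfolding sub_count_def using N
    by (simp add: card_Un_disjoint finite_sub_count_set card_image)
  moreover have "card ?B = (if X z \<in># C then sub_count X (C - {#X z#}) N else 0)"
  proof -
    have "?B = (if X z \<in># C then {T. T \<subseteq> N \<and> image_mset X (mset_set T) = C - {#X z#}} else {})"
      by auto
    then show ?thesis by (simp add: sub_count_def)
  qed
  ultimately show ?thesis by (simp add: sub_count_def)
qed

text \<open>Double counting: a subset \<open>T\<close> survives the removal of \<open>v\<close> iff
  \<open>v \<notin> T\<close>. The difference is taken in the reals; it can be negative only when no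
  subset is counted.\<close>

lemma sum_sub_count_remove:
  assumes N: "finite N"
  shows "(\<Sum>v\<in>N. real (sub_count X C (N - {v}))) = (real (card N) - real (size C)) * real (sub_count X C N)"
proof -
  let ?A = "{T. T \<subseteq> N \<and> image_mset X (mset_set T) = C}"
  have fA: "finite ?A" by (rule finite_sub_count_set[OF N])
  have "(\<Sum>v\<in>N. real (sub_count X C (N - {v}))) = (\<Sum>v\<in>N. \<Sum>T\<in>?A. if v \<notin> T then 1 else 0)"
  proof (rule sum.cong[OF refl])
    fix v assume "v \<in> N"
    then have "{T. T \<subseteq> N - {v} \<and> image_mset X (mset_set T) = C} = {T \<in> ?A. v \<notin> T}" by auto
    then show "real (sub_count X C (N - {v})) = (\<Sum>T\<in>?A. if v \<notin> T then 1 else 0)"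
      unfolding sub_count_def using sum.inter_filter[OF fA, of "\<lambda>_. 1 :: real" "\<lambda>T. v \<notin> T"] by simp
  qed
  also have "\<dots> = (\<Sum>T\<in>?A. \<Sum>v\<in>N. if v \<notin> T then 1 else 0)" by (rule sum.swap)
  also have "\<dots> = (\<Sum>T\<in>?A. real (card N) - real (size C))"
  proof (rule sum.cong[OF refl])
    fix T assume T: "T \<in> ?A"
    then have "size C = card T" by (metis (lifting) mem_Collect_eq size_image_mset size_mset_set)
    moreover have "{v \<in> N. v \<notin> T} = N - T" by auto
    moreover have "card (N - T) = card N - card T" "card T \<le> card N"
      using T N by (auto intro: card_Diff_subset card_mono dest: finite_subset)
    ultimately show "(\<Sum>v\<in>N. if v \<notin> T then 1 else 0) = real (card N) - real (size C)"
      using sum.inter_filter[OF N, of "\<lambda>_. 1 :: real" "\<lambda>v. v \<notin> T"] by (simp add: of_nat_diff)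
  qed
  also have "\<dots> = (real (card N) - real (size C)) * real (sub_count X C N)"
    by (simp add: sub_count_def)
  finally show ?thesis .
qed

text \<open>For \<open>size C = d\<close> this is the number of vertices whose star is \<open>Star x C\<close>.\<close>

definition type_count :: "nat \<Rightarrow> (nat \<Rightarrow> 'x) \<Rightarrow> nat \<Rightarrow> 'x \<Rightarrow> 'x multiset \<Rightarrow> nat set set \<Rightarrow> real" where
  "type_count n X d x C E =
     (\<Sum>u\<in>{1..n}. if deg E u = d \<and> X u = x then real (sub_count X C (nbrs E u)) else 0)"

text \<open>Up to a bounded error, the expected decrease of \<open>type_count / 4\<close> summed over all switches,
  divided by \<open>n\<close>.\<close>

definition count_drift :: "nat \<Rightarrow> (nat \<Rightarrow> 'x) \<Rightarrow> nat \<Rightarrow> 'x \<Rightarrow> 'x multiset \<Rightarrow> nat set set \<Rightarrow> real" where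
  "count_drift n X d x C E =
     (real (card (arcs E)) * real (size C) * type_count n X d x C E
      - (\<Sum>z\<in>{1..n}. real (deg E z) * (if X z \<in># C
           then (real d - real (size C) + 1) * type_count n X d x (C - {#X z#}) E else 0))) / real n"

text \<open>The division by 4 cancels the factor of \<open>switch_drift\<close>. Once the sum over
  switches is extended to all pairs of arcs, the sum over the lost neighbor \<open>v\<close> is
  evaluated by \<open>sum_sub_count_remove\<close>, and the arc \<open>(w, z)\<close> selects the
  new neighbor \<open>z\<close> with weight \<open>deg E z\<close>.\<close>

lemma count_drift_approx:
  assumes E: "E \<in> simple_graphs n" and M: "\<And>v. deg E v \<le> M"
  shows "\<bar>real n * count_drift n X d x C E
      - (\<Sum>q\<in>switches E. type_count n X d x C E / 4 - type_count n X d x C (switch E q) / 4)\<bar>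
    \<le> real n * (real (M * (2 * M + 2 * M * M)) * 2 ^ d)"
proof (cases "n = 0")
  case True
  have "switches E = {}" using switches_in_range[OF E] True by fastforce
  then show ?thesis using True by simp
next
  case False
  define ind where "ind u = (if deg E u = d \<and> X u = x then 1 else 0 :: real)" for u
  \<comment> \<open>The test \<open>card N = d\<close> reads the degree off the neighborhood, so
    that the same \<open>g\<close> describes the graph before and after the switch.\<close>
  define g where "g = (\<lambda>u N. if card N = d \<and> X u = x then real (sub_count X C N) else 0)"
  define a where "a C' u v = real (sub_count X C' (nbrs E u - {v}))" for C' u v
  define b where "b C' u = real (sub_count X C' (nbrs E u))" for C' u
  define up where "up u v z = (if X z \<in># C then a (C - {#X z#}) u v else 0)" for u v z
  define f where "f u v z = ind u * (a C u v + up u v z - b C u)" for u v z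
  have fin: "finite (nbrs E u)" for u by (rule finite_nbrs[OF E])
  have tc: "type_count n X d x C' E = (\<Sum>u\<in>{1..n}. ind u * b C' u)" for C'
    unfolding type_count_def by (intro sum.cong) (auto simp: ind_def b_def)
  have "(\<Sum>q\<in>switches E. type_count n X d x C (switch E q) - type_count n X d x C E)
      = 4 * (\<Sum>(u, v, w, z)\<in>switches E. g u (insert z (nbrs E u - {v})) - g u (nbrs E u))"
    using switch_drift[OF E, of g] by (simp add: g_def type_count_def)
  also have "(\<Sum>(u, v, w, z)\<in>switches E. g u (insert z (nbrs E u - {v})) - g u (nbrs E u))
      = (\<Sum>(u, v, w, z)\<in>switches E. f u v z)"
  proof (intro sum.cong refl, clarify)
    fix u v w z assume q: "(u, v, w, z) \<in> switches E"
    then have vz: "v \<in> nbrs E u" "z \<notin> nbrs E u" by (auto simp: switches_def nbrs_def)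
    then have "card (insert z (nbrs E u - {v})) = deg E u"
      using card_Suc_Diff1[OF fin vz(1)] fin[of u] by simp
    then show "g u (insert z (nbrs E u - {v})) - g u (nbrs E u) = f u v z"
      using sub_count_insert[of "nbrs E u - {v}" z X C] fin vz
      by (simp add: g_def f_def ind_def a_def b_def up_def)
  qed
  finally have 1: "(\<Sum>q\<in>switches E. type_count n X d x C E / 4 - type_count n X d x C (switch E q) / 4)
      = - (\<Sum>(u, v, w, z)\<in>switches E. f u v z)"
    by (simp add: sum_subtractf flip: sum_divide_distrib)
  have nd: "real n * count_drift n X d x C E
      = real (card (arcs E)) * real (size C) * type_count n X d x C E
      - (\<Sum>z\<in>{1..n}. real (deg E z) * (if X z \<in># C
           then (real d - real (size C) + 1) * type_count n X d x (C - {#X z#}) E else 0))"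
    using False by (simp add: count_drift_def)
  \<comment> \<open>The loss \<open>a C u v - b C u\<close> lies in \<open>[- (2 ^ d), 0]\<close>
    and the gain \<open>up u v z\<close> in \<open>[0, 2 ^ d]\<close>; having opposite signs, they
    do not add up to twice the bound.\<close>
  have fb: "\<bar>f u v z\<bar> \<le> 2 ^ d" for u v z
  proof (cases "deg E u = d \<and> X u = x")
    case True
    have le: "b C' u \<le> 2 ^ d" "a C' u v \<le> b C' u" "0 \<le> a C' u v" for C'
    proof -
      have "sub_count X C' (nbrs E u) \<le> 2 ^ d" using sub_count_le[OF fin] True by metis
      then show "b C' u \<le> 2 ^ d" unfolding b_def by (metis of_nat_le_iff of_nat_numeral of_nat_power)
      show "a C' u v \<le> b C' u" unfolding a_def b_def by (intro of_nat_mono sub_count_mono fin Diff_subset)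
    qed (simp add: a_def)
    have "up u v z \<le> 2 ^ d" "0 \<le> up u v z"
      using le[of "C - {#X z#}"] by (auto simp: up_def)
    then show ?thesis using le[of C] True by (simp add: f_def ind_def abs_le_iff)
  qed (auto simp: f_def ind_def)
  have "(\<Sum>(u, v)\<in>arcs E. \<Sum>(w, z)\<in>arcs E. f u v z)
      = (\<Sum>(u, v)\<in>arcs E. \<Sum>z\<in>{1..n}. real (deg E z) * f u v z)"
    by (simp add: sum_arcs_snd[OF E])
  also have "\<dots> = (\<Sum>(u, v)\<in>arcs E. real (card (arcs E)) * (ind u * (a C u v - b C u))
      + (\<Sum>z\<in>{1..n}. real (deg E z) * (ind u * up u v z)))"
    by (simp add: f_def card_arcs_eq[OF E] algebra_simps sum.distrib sum_subtractf sum_distrib_left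
        sum_distrib_right)
  also have "\<dots> = (\<Sum>u\<in>{1..n}. \<Sum>v\<in>nbrs E u. real (card (arcs E)) * (ind u * (a C u v - b C u))
      + (\<Sum>z\<in>{1..n}. real (deg E z) * (ind u * up u v z)))"
    by (rule sum_arcs_fst[OF E])
  also have "\<dots> = real (card (arcs E)) * (\<Sum>u\<in>{1..n}. ind u * ((\<Sum>v\<in>nbrs E u. a C u v) - real (deg E u) * b C u))
      + (\<Sum>u\<in>{1..n}. \<Sum>v\<in>nbrs E u. \<Sum>z\<in>{1..n}. real (deg E z) * (ind u * up u v z))"
    by (simp add: sum.distrib sum_subtractf sum_distrib_left algebra_simps)
  also have "(\<Sum>u\<in>{1..n}. ind u * ((\<Sum>v\<in>nbrs E u. a C u v) - real (deg E u) * b C u))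
      = - (real (size C) * type_count n X d x C E)"
    unfolding tc a_def b_def sum_sub_count_remove[OF fin]
    by (simp add: sum_distrib_left algebra_simps flip: sum_negf)
  also have "(\<Sum>u\<in>{1..n}. \<Sum>v\<in>nbrs E u. \<Sum>z\<in>{1..n}. real (deg E z) * (ind u * up u v z))
      = (\<Sum>z\<in>{1..n}. \<Sum>u\<in>{1..n}. \<Sum>v\<in>nbrs E u. real (deg E z) * (ind u * up u v z))"
    by (subst sum.swap[of _ "{1..n}" "{1..n}"]) (intro sum.cong refl sum.swap)
  also have "\<dots> = (\<Sum>z\<in>{1..n}. real (deg E z) * (\<Sum>u\<in>{1..n}. ind u * (\<Sum>v\<in>nbrs E u. up u v z)))"
    by (simp add: sum_distrib_left)
  also have "\<dots> = (\<Sum>z\<in>{1..n}. real (deg E z) * (if X z \<in># C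
           then (real d - real (size C) + 1) * type_count n X d x (C - {#X z#}) E else 0))"
  proof (rule sum.cong[OF refl])
    fix z
    show "real (deg E z) * (\<Sum>u\<in>{1..n}. ind u * (\<Sum>v\<in>nbrs E u. up u v z))
        = real (deg E z) * (if X z \<in># C
           then (real d - real (size C) + 1) * type_count n X d x (C - {#X z#}) E else 0)"
    proof (cases "X z \<in># C")
      case True
      \<comment> \<open>The multiset is shorter by one mark, which is the origin of the
        \<open>+ 1\<close> in \<open>count_drift\<close>.\<close>
      have sz: "real (size (C - {#X z#})) = real (size C) - 1"
        using True by (metis One_nat_def Suc_pred add_diff_cancel_left' insert_DiffM of_nat_Suc size_add_mset)
      have "(\<Sum>u\<in>{1..n}. ind u * (\<Sum>v\<in>nbrs E u. up u v z))
          = (\<Sum>u\<in>{1..n}. (real d - real (size C) + 1) * (ind u * b (C - {#X z#}) u))"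
        using True
        by (intro sum.cong refl) (auto simp: up_def a_def b_def sum_sub_count_remove[OF fin] ind_def sz)
      then show ?thesis using True by (simp add: tc sum_distrib_left)
    qed (simp add: up_def)
  qed
  finally have 2: "(\<Sum>(u, v)\<in>arcs E. \<Sum>(w, z)\<in>arcs E. f u v z) = - (real n * count_drift n X d x C E)"
    unfolding nd by (simp add: algebra_simps)
  show ?thesis
    using sum_switches_approx[OF E M, of f "2 ^ d", OF fb] unfolding 1 2 by (simp add: mult_ac)
qed

lemma type_count_switch_diff:
  assumes E: "E \<in> simple_graphs n" and q: "q \<in> switches E"
  shows "\<bar>type_count n X d x C E - type_count n X d x C (switch E q)\<bar> \<le> 4 * 2 ^ d"
proof -
  obtain u v w z where q': "q = (u, v, w, z)" by (cases q)
  define g where "g = (\<lambda>u N. if card N = d \<and> X u = x then real (sub_count X C N) else 0)"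
  have g: "0 \<le> g u N" "finite N \<Longrightarrow> g u N \<le> 2 ^ d" for u N
  proof -
    show "g u N \<le> 2 ^ d" if "finite N"
    proof (cases "card N = d \<and> X u = x")
      case True
      then have "sub_count X C N \<le> 2 ^ d" using sub_count_le[OF that] by metis
      then have "real (sub_count X C N) \<le> 2 ^ d" by (metis of_nat_le_iff of_nat_numeral of_nat_power)
      then show ?thesis by (simp add: g_def)
    qed (auto simp: g_def)
  qed (simp add: g_def)
  have *: "\<bar>g u (insert z (nbrs E u - {v})) - g u (nbrs E u)\<bar> \<le> 2 ^ d" for u v z
    using g(1)[of u "nbrs E u"] g(1)[of u "insert z (nbrs E u - {v})"]
      g(2)[of "nbrs E u" u] g(2)[of "insert z (nbrs E u - {v})" u] finite_nbrs[OF E, of u]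
    by (simp add: abs_le_iff)
  have tc: "type_count n X d x C E' = (\<Sum>u\<in>{1..n}. g u (nbrs E' u))" for E'
    by (simp add: type_count_def g_def)
  show ?thesis
    using switch_diff[OF E q[unfolded q'], of g] *[of u z v] *[of v w u] *[of w v z] *[of z u w]
    unfolding q' tc by linarith
qed

lemma card_arcs_le:
  assumes E: "E \<in> simple_graphs n" and M: "\<And>v. deg E v \<le> M"
  shows "card (arcs E) \<le> n * M"
proof -
  have "card (arcs E) \<le> (\<Sum>v\<in>{1..n}. M)" unfolding card_arcs_eq[OF E] by (intro sum_mono M)
  then show ?thesis by simp
qed

text \<open>A switch keeps the degrees, hence all weights in the drift; only the counts move, each
  by at most \<open>4 * 2 ^ d\<close>. The total weight is at most of order \<open>n * M\<close>,
  and the division by \<open>n\<close> in \<open>count_drift\<close> compensates it.\<close>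

lemma count_drift_switch_diff:
  assumes E: "E \<in> simple_graphs n" and q: "q \<in> switches E" and M: "\<And>v. deg E v \<le> M"
  shows "\<bar>count_drift n X d x C E - count_drift n X d x C (switch E q)\<bar>
    \<le> real M * (2 * real (size C) + real d + 1) * (4 * 2 ^ d)"
proof (cases "n = 0")
  case False
  let ?E = "switch E q"
  let ?c = "4 * 2 ^ d :: real"
  let ?D = "real (card (arcs E))"
  define b where "b z E = (if X z \<in># C
    then (real d - real (size C) + 1) * type_count n X d x (C - {#X z#}) E else 0)" for z E
  have ca: "card (arcs ?E) = card (arcs E)"
    unfolding card_arcs_eq[OF E] card_arcs_eq[OF switch_simple[OF E q]] card_nbrs_switch[OF E q] ..
  have b: "\<bar>b z E - b z ?E\<bar> \<le> (real (size C) + real d + 1) * ?c" for z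
  proof (cases "X z \<in># C")
    case True
    then have "\<bar>b z E - b z ?E\<bar> = \<bar>real d - real (size C) + 1\<bar>
        * \<bar>type_count n X d x (C - {#X z#}) E - type_count n X d x (C - {#X z#}) ?E\<bar>"
      by (simp add: b_def abs_mult flip: right_diff_distrib)
    also have "\<dots> \<le> (real (size C) + real d + 1) * ?c"
      by (intro mult_mono type_count_switch_diff E q) auto
    finally show ?thesis .
  qed (simp add: b_def)
  have "real n * (count_drift n X d x C E - count_drift n X d x C ?E)
      = ?D * real (size C) * (type_count n X d x C E - type_count n X d x C ?E)
        - (\<Sum>z\<in>{1..n}. real (deg E z) * (b z E - b z ?E))"
    using False
    by (simp add: count_drift_def b_def[symmetric] ca card_nbrs_switch[OF E q] sum_subtractf field_simps)
  also have "\<bar>\<dots>\<bar> \<le> ?D * real (size C) * ?c + (\<Sum>z\<in>{1..n}. real (deg E z) * ((real (size C) + real d + 1) * ?c))"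
  proof (rule order_trans[OF abs_triangle_ineq4], rule add_mono)
    show "\<bar>?D * real (size C) * (type_count n X d x C E - type_count n X d x C ?E)\<bar> \<le> ?D * real (size C) * ?c"
      unfolding abs_mult[of "?D * real (size C)"] by (intro mult_mono type_count_switch_diff E q) auto
    show "\<bar>\<Sum>z\<in>{1..n}. real (deg E z) * (b z E - b z ?E)\<bar>
        \<le> (\<Sum>z\<in>{1..n}. real (deg E z) * ((real (size C) + real d + 1) * ?c))"
      by (rule order_trans[OF sum_abs], intro sum_mono) (simp only: abs_mult abs_of_nat, intro mult_left_mono b, simp)
  qed
  also have "\<dots> = ?D * ((2 * real (size C) + real d + 1) * ?c)"
    unfolding card_arcs_eq[OF E] by (simp add: sum_distrib_left sum_distrib_right algebra_simps sum.distrib)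
  also have "\<dots> \<le> (real n * real M) * ((2 * real (size C) + real d + 1) * ?c)"
    using card_arcs_le[OF E M] by (intro mult_right_mono) (simp_all flip: of_nat_mult)
  finally show ?thesis using False by (simp add: abs_mult mult_ac)
qed (simp add: count_drift_def)

text \<open>The weight \<open>w\<close> will be the tilted probability of \<open>(E, X)\<close> for
  fixed \<open>X\<close>, and \<sigma> selects the upper or the lower tail. There are at most
  \<open>(n * M)\<close> squared switches, and one switch changes \<open>G\<close> and the drift by
  bounded amounts; after division by \<open>n\<close> the variance proxy is \<open>n * K\<close>,
  linear in \<open>n\<close>.\<close>

lemma count_drift_mgf:
  fixes w :: "nat set set \<Rightarrow> real" and C :: "'x multiset" and X :: "nat \<Rightarrow> 'x" and x :: 'x and d M n :: nat
  assumes S: "S \<subseteq> simple_graphs n" and M: "\<And>E v. E \<in> S \<Longrightarrow> deg E v \<le> M"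
    and closed: "\<And>E q. E \<in> S \<Longrightarrow> q \<in> switches E \<Longrightarrow> switch E q \<in> S"
    and w0: "\<And>E. E \<in> S \<Longrightarrow> 0 \<le> w E"
    and winv: "\<And>E q. E \<in> S \<Longrightarrow> q \<in> switches E \<Longrightarrow> w (switch E q) = w E"
    and \<sigma>: "\<sigma> \<in> {1, -1}" and n: "n > 0" and \<theta>: "0 \<le> \<theta>"
  defines "K \<equiv> 2 ^ d * (real M * (2 * real (size C) + real d + 1) * (4 * 2 ^ d)) * (real M)\<^sup>2"
    and "e \<equiv> real (M * (2 * M + 2 * M * M)) * 2 ^ d"
  shows "(\<Sum>E\<in>S. w E * exp (\<theta> * (\<sigma> * count_drift n X d x C E)))
    \<le> (\<Sum>E\<in>S. w E) * exp (real n * K * \<theta>\<^sup>2 / 2 + e * \<theta>)"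
proof (rule exchangeable_mgf_bound[where Q = switches and T = switch
      and G = "\<lambda>E. \<sigma> * (type_count n X d x C E / 4)" and n = "real n" and a = "2 ^ d"
      and b = "real M * (2 * real (size C) + real d + 1) * (4 * 2 ^ d)" and m = "(real n * real M)\<^sup>2"])
  have sg: "E \<in> simple_graphs n" if "E \<in> S" for E using S that by auto
  show "finite S" using S finite_simple_graphs by (rule finite_subset)
  show "(\<Sum>x\<in>S. \<Sum>q\<in>switches x. F x (switch x q)) = (\<Sum>x\<in>S. \<Sum>q\<in>switches x. F (switch x q) x)"
    for F :: "nat set set \<Rightarrow> nat set set \<Rightarrow> real"
    by (rule sum_switches_swap[OF S]) (auto intro: finite_switches sg closed)
  have a\<sigma>: "\<bar>\<sigma> * y\<bar> = \<bar>y\<bar>" for y :: real using \<sigma> by auto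
  fix E assume ES: "E \<in> S"
  show "real (card (switches E)) \<le> (real n * real M)\<^sup>2"
  proof -
    have "card (switches E) \<le> (n * M) * (n * M)"
      by (rule order_trans[OF card_switches_le[OF sg[OF ES]]])
        (intro mult_mono card_arcs_le sg ES M, auto)
    then have "real (card (switches E)) \<le> real ((n * M) * (n * M))" by (simp only: of_nat_le_iff)
    then show ?thesis by (simp add: power2_eq_square)
  qed
  have "real n * (\<sigma> * count_drift n X d x C E)
      - (\<Sum>q\<in>switches E. \<sigma> * (type_count n X d x C E / 4) - \<sigma> * (type_count n X d x C (switch E q) / 4))
      = \<sigma> * (real n * count_drift n X d x C E
      - (\<Sum>q\<in>switches E. type_count n X d x C E / 4 - type_count n X d x C (switch E q) / 4))"
    by (simp add: algebra_simps sum_distrib_left)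
  then show "\<bar>real n * (\<sigma> * count_drift n X d x C E)
      - (\<Sum>q\<in>switches E. \<sigma> * (type_count n X d x C E / 4) - \<sigma> * (type_count n X d x C (switch E q) / 4))\<bar>
      \<le> real n * e"
    unfolding e_def using count_drift_approx[OF sg[OF ES] M[OF ES], of X d x C] by (simp only: a\<sigma>)
  fix q assume q: "q \<in> switches E"
  show "\<bar>\<sigma> * (type_count n X d x C E / 4) - \<sigma> * (type_count n X d x C (switch E q) / 4)\<bar> \<le> 2 ^ d"
    using type_count_switch_diff[OF sg[OF ES] q, of X d x C]
    by (simp add: a\<sigma> flip: right_diff_distrib diff_divide_distrib)
  show "\<bar>\<sigma> * count_drift n X d x C E - \<sigma> * count_drift n X d x C (switch E q)\<bar>
      \<le> real M * (2 * real (size C) + real d + 1) * (4 * 2 ^ d)"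
    using count_drift_switch_diff[OF sg[OF ES] q M[OF ES], of X d x C]
    by (simp add: a\<sigma> flip: right_diff_distrib)
  show "w (switch E q) = w E" by (rule winv[OF ES q])
qed (use n \<theta> w0 in \<open>auto simp: K_def power2_eq_square\<close>)

section \<open>Graphs with a given degree sequence\<close>

lemma even_card_arcs:
  assumes E: "E \<in> simple_graphs n"
  shows "even (card (arcs E))"
proof -
  let ?A = "{(u, v) \<in> arcs E. u < v}" and ?B = "{(u, v) \<in> arcs E. v < u}"
  have "arcs E = ?A \<union> ?B"
    using simple_graphs_edge(1)[OF E] by (force simp: arcs_def)
  then have "card (arcs E) = card (?A \<union> ?B)" by (rule arg_cong)
  also have "\<dots> = card ?A + card ?B"
    by (rule card_Un_disjoint; (rule finite_subset[OF _ finite_arcs[OF E]])?) auto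
  also have "card ?B = card ?A"
    by (rule bij_betw_same_card[of "\<lambda>(u, v). (v, u)"], rule bij_betw_byWitness[of _ "\<lambda>(u, v). (v, u)"])
      (auto simp: arcs_def insert_commute)
  finally have "card (arcs E) = card ?A + card ?A" .
  then show ?thesis by simp
qed

text \<open>In a graph with the largest number of
  edges among those with degrees at most \<open>d\<close>, the vertices of deficient degree are pairwise
  adjacent, hence few; removing an edge \<open>xy\<close> far from two of them, \<open>u\<close> and \<open>w\<close>, and adding \<open>ux\<close>
  and \<open>wy\<close> would give more edges. If only \<open>u\<close> is deficient then it lacks two edges by parity, and
  \<open>w = u\<close> works.\<close>

lemma degree_sequence_realizable:
  fixes d :: "nat \<Rightarrow> nat"
  assumes d: "\<And>v. v \<in> {1..n} \<Longrightarrow> d v \<le> M" and ev: "even (\<Sum>v\<in>{1..n}. d v)"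
    and large: "M * (M + 1) + 2 * ((2 + 2 * M) * M) < (\<Sum>v\<in>{1..n}. d v)"
  shows "\<exists>E\<in>simple_graphs n. \<forall>v\<in>{1..n}. deg E v = d v"
proof -
  define S where "S = {E \<in> simple_graphs n. \<forall>v\<in>{1..n}. deg E v \<le> d v}"
  have fS: "finite S" unfolding S_def using finite_simple_graphs by simp
  have "{} \<in> S" by (auto simp: S_def simple_graphs_def nbrs_def)
  then have "Max ((\<lambda>E. card (arcs E)) ` S) \<in> (\<lambda>E. card (arcs E)) ` S" using fS by (intro Max_in) auto
  then obtain E where ES: "E \<in> S" and Emax': "card (arcs E) = Max ((\<lambda>E. card (arcs E)) ` S)" by auto
  have Emax: "card (arcs E') \<le> card (arcs E)" if "E' \<in> S" for E'
    unfolding Emax' using fS that by simp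
  have E: "E \<in> simple_graphs n" and Ed: "\<And>v. v \<in> {1..n} \<Longrightarrow> deg E v \<le> d v"
    using ES by (auto simp: S_def)
  have fin: "finite (nbrs E v)" for v by (rule finite_nbrs[OF E])
  have no_inc: False if "E' \<in> simple_graphs n"
      "\<And>v. v \<in> {1..n} \<Longrightarrow> deg E v \<le> deg E' v \<and> deg E' v \<le> d v"
      "u \<in> {1..n}" "deg E u < deg E' u" for E' u
  proof -
    have "E' \<in> S" using that by (simp add: S_def)
    moreover have "card (arcs E) < card (arcs E')"
      unfolding card_arcs_eq[OF E] card_arcs_eq[OF that(1)]
      by (rule sum_strict_mono_ex1) (use that in auto)
    ultimately show False using Emax by fastforce
  qed
  define D where "D = {v \<in> {1..n}. deg E v < d v}"
  have "D = {}"
  proof (rule ccontr)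
    assume "D \<noteq> {}"
    then obtain u where u: "u \<in> D" by blast
    have adj: "{a, b} \<in> E" if "a \<in> D" "b \<in> D" "a \<noteq> b" for a b
    proof (rule ccontr)
      assume ab: "{a, b} \<notin> E"
      let ?E = "insert {a, b} E"
      have na: "nbrs ?E a = insert b (nbrs E a)" "nbrs ?E b = insert a (nbrs E b)"
        using that by (auto simp: nbrs_def doubleton_eq_iff)
      have no: "nbrs ?E v = nbrs E v" if "v \<noteq> a" "v \<noteq> b" for v
        using that by (auto simp: nbrs_def doubleton_eq_iff)
      have nin: "b \<notin> nbrs E a" "a \<notin> nbrs E b" using ab by (auto simp: nbrs_def insert_commute)
      show False
      proof (rule no_inc[of ?E a])
        show "?E \<in> simple_graphs n" using E that by (auto simp: simple_graphs_def D_def)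
        show "deg E v \<le> deg ?E v \<and> deg ?E v \<le> d v" if "v \<in> {1..n}" for v
          using \<open>a \<in> D\<close> \<open>b \<in> D\<close> \<open>a \<noteq> b\<close> that Ed[OF that]
          by (cases "v = a"; cases "v = b") (auto simp: na no nin fin D_def)
        show "a \<in> {1..n}" using that by (auto simp: D_def)
        show "deg E a < deg ?E a" by (simp add: na nin fin)
      qed
    qed
    have "D \<subseteq> insert u (nbrs E u)" using adj[OF u] by (auto simp: nbrs_def)
    then have "card D \<le> card (insert u (nbrs E u))" by (rule card_mono[rotated]) (simp add: fin)
    also have "\<dots> \<le> M + 1"
      using card_insert_le_m1[of "M + 1" "nbrs E u" u] Ed[of u] d[of u] u by (auto simp: D_def)
    finally have cD: "card D \<le> M + 1" .
    define def where "def v = d v - deg E v" for v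
    have dd: "d v = deg E v + def v" if "v \<in> {1..n}" for v using Ed[OF that] by (simp add: def_def)
    have sd: "(\<Sum>v\<in>{1..n}. d v) = card (arcs E) + (\<Sum>v\<in>{1..n}. def v)"
      unfolding card_arcs_eq[OF E] by (simp add: dd flip: sum.distrib)
    have sD: "(\<Sum>v\<in>{1..n}. def v) = (\<Sum>v\<in>D. def v)"
      by (rule sum.mono_neutral_right) (auto simp: D_def def_def)
    also have "\<dots> \<le> (\<Sum>v\<in>D. M)" by (rule sum_mono) (use d in \<open>fastforce simp: D_def def_def\<close>)
    also have "\<dots> \<le> M * (M + 1)" using mult_le_mono1[OF cD, of M] by (simp add: mult.commute)
    finally have arcs_large: "2 * ((2 + 2 * M) * M) < card (arcs E)" using large sd by linarith
    have evd: "even (\<Sum>v\<in>D. def v)" using ev even_card_arcs[OF E] unfolding sd sD by simp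
    obtain w where w: "w \<in> D" and uw: "u = w \<Longrightarrow> 2 \<le> def u"
    proof (cases "D = {u}")
      case True
      then have "even (def u)" using evd by simp
      moreover have "def u \<noteq> 0" using u by (simp add: D_def def_def)
      ultimately have "2 \<le> def u" by presburger
      then show ?thesis using that[OF u] by blast
    next
      case False
      then obtain w where "w \<in> D" "w \<noteq> u" using u by blast
      then show ?thesis using that by blast
    qed
    \<comment> \<open>Avoiding \<open>B\<close> makes \<open>ux\<close> and \<open>wy\<close> new
      edges. At most \<open>2 * ((2 + 2 * M) * M)\<close> arcs meet \<open>B\<close>, the second
      term of \<open>large\<close>; the first, \<open>M * (M + 1)\<close>, pays for the total
      deficiency, so that some arc is left.\<close>
    define B where "B = {u, w} \<union> nbrs E u \<union> nbrs E w"
    have degM: "deg E v \<le> M" for v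
    proof (cases "v \<in> {1..n}")
      case True then show ?thesis using Ed d order_trans by blast
    next
      case False then have "nbrs E v = {}" using simple_graphs_edge[OF E] by (auto simp: nbrs_def)
      then show ?thesis by simp
    qed
    have "card B \<le> card {u, w} + deg E u + deg E w"
      unfolding B_def by (metis (no_types, lifting) add_le_mono1 card_Un_le order_trans)
    also have "\<dots> \<le> 2 + 2 * M" using degM[of u] degM[of w] card_insert_le_m1[of 2 "{w}" u] by simp
    finally have cB: "card B \<le> 2 + 2 * M" .
    have fB: "finite B" by (simp add: B_def fin)
    have "\<exists>x y. {x, y} \<in> E \<and> x \<notin> B \<and> y \<notin> B"
    proof (rule ccontr)
      assume *: "\<not> ?thesis"
      have "arcs E \<subseteq> (SIGMA x:B. nbrs E x) \<union> prod.swap ` (SIGMA x:B. nbrs E x)"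
      proof (rule subrelI)
        fix x y assume "(x, y) \<in> arcs E"
        then have xy: "{x, y} \<in> E" "y \<in> nbrs E x" "x \<in> nbrs E y"
          by (auto simp: arcs_def nbrs_def insert_commute)
        then have "x \<in> B \<or> y \<in> B" using * by blast
        then show "(x, y) \<in> (SIGMA x:B. nbrs E x) \<union> prod.swap ` (SIGMA x:B. nbrs E x)"
          using xy(2,3) by (auto intro: image_eqI[of _ _ "(y, x)"])
      qed
      then have "card (arcs E) \<le> card ((SIGMA x:B. nbrs E x) \<union> prod.swap ` (SIGMA x:B. nbrs E x))"
        by (rule card_mono[rotated]) (simp add: fB fin)
      also have "\<dots> \<le> card (SIGMA x:B. nbrs E x) + card (SIGMA x:B. nbrs E x)"
        by (rule order_trans[OF card_Un_le add_left_mono], rule card_image_le) (simp add: fB fin)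
      also have "card (SIGMA x:B. nbrs E x) \<le> (\<Sum>x\<in>B. M)"
        using sum_mono[of B "\<lambda>x. deg E x" "\<lambda>_. M"] degM by (simp add: fB fin)
      also have "\<dots> \<le> (2 + 2 * M) * M" using mult_le_mono1[OF cB, of M] by simp
      finally show False using arcs_large by simp
    qed
    then obtain x y where xy: "{x, y} \<in> E" "x \<notin> B" "y \<notin> B" by blast
    note xyr = simple_graphs_edge[OF E xy(1)]
    have ur: "u \<in> {1..n}" "w \<in> {1..n}" using u w by (auto simp: D_def)
    let ?E = "insert {u, x} (insert {w, y} (E - {{x, y}}))"
    have neq: "x \<noteq> u" "x \<noteq> w" "y \<noteq> u" "y \<noteq> w" using xy by (auto simp: B_def)
    have nn: "x \<notin> nbrs E u" "y \<notin> nbrs E u" "x \<notin> nbrs E w" "y \<notin> nbrs E w"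
      "u \<notin> nbrs E x" "w \<notin> nbrs E y" using xy by (auto simp: B_def nbrs_def insert_commute)
    have yx: "y \<in> nbrs E x" "x \<in> nbrs E y" using xy by (auto simp: nbrs_def insert_commute)
    have nx: "nbrs ?E x = insert u (nbrs E x - {y})" "nbrs ?E y = insert w (nbrs E y - {x})"
      using neq xyr by (auto simp: nbrs_def doubleton_eq_iff)
    have nu: "nbrs ?E u = (if u = w then insert x (insert y (nbrs E u)) else insert x (nbrs E u))"
      "nbrs ?E w = (if u = w then insert x (insert y (nbrs E u)) else insert y (nbrs E w))"
      using neq xyr by (auto simp: nbrs_def doubleton_eq_iff)
    have no: "nbrs ?E v = nbrs E v" if "v \<notin> {u, w, x, y}" for v
      using that by (auto simp: nbrs_def doubleton_eq_iff)
    have cx: "deg ?E x = deg E x" "deg ?E y = deg E y"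
      unfolding nx using card_Suc_Diff1[OF fin yx(1)] card_Suc_Diff1[OF fin yx(2)] nn fin by simp_all
    have cu: "deg ?E u = deg E u + (if u = w then 2 else 1)"
      "deg ?E w = deg E w + (if u = w then 2 else 1)"
      unfolding nu using nn fin xyr by auto
    show False
    proof (rule no_inc[of ?E u])
      show "?E \<in> simple_graphs n" using E neq xyr ur by (auto simp: simple_graphs_def)
      show "u \<in> {1..n}" by (rule ur)
      show "deg E u < deg ?E u" by (simp add: cu(1))
      fix v assume v: "v \<in> {1..n}"
      consider "v \<notin> {u, w, x, y}" | "v = x" | "v = y" | "v = u" | "v = w" by blast
      then show "deg E v \<le> deg ?E v \<and> deg ?E v \<le> d v"
      proof cases
        case 1 then show ?thesis using Ed[OF v] no[OF 1] by simp
      next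
        case 2 then show ?thesis using Ed[OF v] cx by simp
      next
        case 3 then show ?thesis using Ed[OF v] cx by simp
      next
        case 4 then show ?thesis using cu(1) u uw by (auto simp: D_def def_def)
      next
        case 5 then show ?thesis using cu(2) w uw by (auto simp: D_def def_def)
      qed
    qed
  qed
  then have "deg E v = d v" if "v \<in> {1..n}" for v
    using Ed[OF that] that by (fastforce simp: D_def)
  then show ?thesis using E by blast
qed

text \<open>The vertices are matched with a disjoint union of blocks of sizes \<open>k i\<close>,
  and \<open>d v\<close> is the index of the block of \<open>v\<close>.\<close>

lemma ex_function_with_fiber_cards:
  fixes k :: "nat \<Rightarrow> nat"
  assumes "(\<Sum>i=0..M. k i) = n"
  shows "\<exists>d. (\<forall>v\<in>{1..n}. d v \<le> M) \<and> (\<forall>i\<le>M. card {v \<in> {1..n}. d v = i} = k i)"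
proof -
  define P where "P = (SIGMA i:{0..M}. {..<k i})"
  have "finite P" "card P = n" using assms by (simp_all add: P_def)
  then obtain \<beta> where \<beta>: "bij_betw \<beta> {1..n} P"
    using finite_same_card_bij[of "{1..n}" P] by auto
  have "card {v \<in> {1..n}. fst (\<beta> v) = i} = k i" if "i \<le> M" for i
  proof -
    have "bij_betw \<beta> {v \<in> {1..n}. fst (\<beta> v) = i} (Pair i ` {..<k i})"
    proof (rule bij_betw_imageI)
      show "inj_on \<beta> {v \<in> {1..n}. fst (\<beta> v) = i}"
        by (rule inj_on_subset[OF bij_betw_imp_inj_on[OF \<beta>]]) auto
      show "\<beta> ` {v \<in> {1..n}. fst (\<beta> v) = i} = Pair i ` {..<k i}"
      proof (intro equalityI subsetI)
        fix p assume "p \<in> Pair i ` {..<k i}"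
        then have "p \<in> P" "fst p = i" using that by (auto simp: P_def)
        then obtain v where "v \<in> {1..n}" "\<beta> v = p"
          using bij_betw_imp_surj_on[OF \<beta>] by blast
        then show "p \<in> \<beta> ` {v \<in> {1..n}. fst (\<beta> v) = i}" using \<open>fst p = i\<close> by auto
      next
        fix p assume "p \<in> \<beta> ` {v \<in> {1..n}. fst (\<beta> v) = i}"
        then have "p \<in> P" "fst p = i" using bij_betw_apply[OF \<beta>] by auto
        then show "p \<in> Pair i ` {..<k i}" by (auto simp: P_def)
      qed
    qed
    then have "card {v \<in> {1..n}. fst (\<beta> v) = i} = card (Pair i ` {..<k i})" by (rule bij_betw_same_card)
    also have "\<dots> = k i" by (subst card_image) (auto simp: inj_on_def)
    finally show ?thesis .
  qed
  moreover have "fst (\<beta> v) \<le> M" if "v \<in> {1..n}" for v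
    using bij_betw_apply[OF \<beta> that] by (auto simp: P_def)
  ultimately show ?thesis by (intro exI[of _ "fst \<circ> \<beta>"]) auto
qed

text \<open>\<open>pmf_of_set\<close> is the uniform law on nonempty sets only. In a
  \<open>CM_sequence\<close> the condition \<open>large\<close> holds for all large
  \<open>n\<close>: its left side does not involve \<open>n\<close>, and the means on the right tend
  to \<kappa> > 0.\<close>

lemma cm_graphs_nonempty:
  fixes a :: "nat pmf"
  assumes n: "n \<ge> 1" and a: "set_pmf a \<subseteq> {0..M}" and k: "\<And>i. \<exists>k\<le>n. pmf a i = real k / real n"
    and ev: "\<exists>k::nat. real n * (\<Sum>i=0..M. real i * pmf a i) = real (2 * k)"
    and large: "real (M * (M + 1) + 2 * ((2 + 2 * M) * M)) < real n * (\<Sum>i=0..M. real i * pmf a i)"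
  shows "cm_graphs n a \<noteq> {}"
proof -
  from k obtain k where k: "\<And>i. pmf a i = real (k i) / real n" by metis
  have "(\<Sum>i=0..M. pmf a i) = 1" using a by (intro sum_pmf_eq_1) auto
  then have "real (\<Sum>i=0..M. k i) = real n" using n by (simp add: k flip: sum_divide_distrib)
  then have sk: "(\<Sum>i=0..M. k i) = n" by (simp only: of_nat_eq_iff)
  from ex_function_with_fiber_cards[OF this] obtain d where
    dM: "\<And>v. v \<in> {1..n} \<Longrightarrow> d v \<le> M" and dk: "\<And>i. i \<le> M \<Longrightarrow> card {v \<in> {1..n}. d v = i} = k i"
    by blast
  have "(\<Sum>v\<in>{1..n}. d v) = (\<Sum>i\<in>{0..M}. \<Sum>v\<in>{v \<in> {1..n}. d v = i}. d v)"
    by (rule sum.group[symmetric]) (use dM in auto)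
  also have "\<dots> = (\<Sum>i\<in>{0..M}. i * k i)"
  proof (rule sum.cong[OF refl])
    fix i assume "i \<in> {0..M}"
    then have "card {v \<in> {1..n}. d v = i} = k i" by (intro dk) simp
    then show "(\<Sum>v\<in>{v \<in> {1..n}. d v = i}. d v) = i * k i" by (simp del: atLeastAtMost_iff)
  qed
  finally have sd: "real (\<Sum>v\<in>{1..n}. d v) = real n * (\<Sum>i=0..M. real i * pmf a i)"
    using n by (simp add: k sum_distrib_left)
  have "\<exists>E\<in>simple_graphs n. \<forall>v\<in>{1..n}. deg E v = d v"
  proof (rule degree_sequence_realizable[OF dM])
    show "even (\<Sum>v\<in>{1..n}. d v)" using ev unfolding sd[symmetric] by (auto simp only: of_nat_eq_iff dvd_triv_left)
    show "M * (M + 1) + 2 * ((2 + 2 * M) * M) < (\<Sum>v\<in>{1..n}. d v)"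
      using large unfolding sd[symmetric] by (simp only: of_nat_less_iff)
  qed auto
  then obtain E where E: "E \<in> simple_graphs n" "\<And>v. v \<in> {1..n} \<Longrightarrow> deg E v = d v" by blast
  have "real (card {v \<in> {1..n}. deg E v = i}) / real n = pmf a i" for i
  proof -
    have eq: "{v \<in> {1..n}. deg E v = i} = {v \<in> {1..n}. d v = i}" using E by auto
    show ?thesis
    proof (cases "i \<le> M")
      case True then show ?thesis unfolding eq by (simp only: dk k)
    next
      case False
      then have "{v \<in> {1..n}. d v = i} = {}" using dM by fastforce
      moreover have "pmf a i = 0" using False a by (auto simp: pmf_eq_0_set_pmf)
      ultimately show ?thesis unfolding eq by (simp only: card.empty of_nat_0 div_0)
    qed
  qed
  then show ?thesis using E(1) by (auto simp: cm_graphs_def)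
qed

section \<open>The weak topology\<close>

text \<open>On laws carried by the finite set \<open>S\<close> every test function has a finite sum
  as expectation, so a subbasic set contains a box in the point probabilities; finite intersections
  and unions preserve this.\<close>

lemma openin_weak_topology_nbhd:
  fixes \<mu> :: "'a pmf"
  assumes A: "openin weak_topology A" and \<mu>: "\<mu> \<in> A" and S: "finite S" "set_pmf \<mu> \<subseteq> S"
  shows "\<exists>\<epsilon>>0. \<forall>p. set_pmf p \<subseteq> S \<longrightarrow> (\<forall>s\<in>S. \<bar>pmf p s - pmf \<mu> s\<bar> < \<epsilon>) \<longrightarrow> p \<in> A"
proof -
  have "generate_topology_on {{p. measure_pmf.expectation p g \<in> U} | (g :: 'a \<Rightarrow> real) U. bounded (range g) \<and> open U} A"
    using A unfolding weak_topology_def openin_topology_generated_by_iff .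
  then show ?thesis using \<mu>
  proof (induction A)
    case Empty
    then show ?case by simp
  next
    case (Int a b)
    then obtain e1 e2 where "e1 > 0" "e2 > 0"
      and e: "\<forall>p. set_pmf p \<subseteq> S \<longrightarrow> (\<forall>s\<in>S. \<bar>pmf p s - pmf \<mu> s\<bar> < e1) \<longrightarrow> p \<in> a"
        "\<forall>p. set_pmf p \<subseteq> S \<longrightarrow> (\<forall>s\<in>S. \<bar>pmf p s - pmf \<mu> s\<bar> < e2) \<longrightarrow> p \<in> b" by auto
    then show ?case by (intro exI[of _ "min e1 e2"]) auto
  next
    case (UN K)
    then obtain k where k: "k \<in> K" "\<mu> \<in> k" by blast
    from UN.IH[OF this] obtain e where
      "e > 0" "\<forall>p. set_pmf p \<subseteq> S \<longrightarrow> (\<forall>s\<in>S. \<bar>pmf p s - pmf \<mu> s\<bar> < e) \<longrightarrow> p \<in> k" by blast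
    with k(1) show ?case by (intro exI[of _ e]) blast
  next
    case (Basis s)
    then obtain g :: "'a \<Rightarrow> real" and U where s: "s = {p. measure_pmf.expectation p g \<in> U}" "open U" by blast
    with Basis have "measure_pmf.expectation \<mu> g \<in> U" by simp
    then obtain e where e: "e > 0" "\<And>y. dist y (measure_pmf.expectation \<mu> g) < e \<Longrightarrow> y \<in> U"
      using s(2) unfolding open_dist by blast
    \<comment> \<open>The summand 1 keeps \<open>B\<close> positive and makes the last estimate
      strict even if \<open>g\<close> vanishes on \<open>S\<close>.\<close>
    define B where "B = 1 + (\<Sum>s\<in>S. \<bar>g s\<bar>)"
    have B: "B > 0" unfolding B_def by (intro add_pos_nonneg sum_nonneg) auto
    have ex: "measure_pmf.expectation p g = (\<Sum>s\<in>S. g s * pmf p s)" if "set_pmf p \<subseteq> S" for p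
      by (rule integral_measure_pmf_real[OF S(1)]) (use that in auto)
    show ?case
    proof (intro exI[of _ "e / B"] conjI allI impI)
      show "0 < e / B" using e B by simp
      fix p assume p: "set_pmf p \<subseteq> S" "\<forall>s\<in>S. \<bar>pmf p s - pmf \<mu> s\<bar> < e / B"
      have "\<bar>measure_pmf.expectation p g - measure_pmf.expectation \<mu> g\<bar> = \<bar>\<Sum>s\<in>S. g s * (pmf p s - pmf \<mu> s)\<bar>"
        by (simp add: ex[OF p(1)] ex[OF S(2)] algebra_simps sum_subtractf)
      also have "\<dots> \<le> (\<Sum>s\<in>S. \<bar>g s\<bar> * (e / B))"
        using p(2) by (intro order_trans[OF sum_abs] sum_mono)
          (simp only: abs_mult, rule mult_left_mono, auto intro: less_imp_le)
      also have "\<dots> = (B - 1) * (e / B)" unfolding B_def sum_distrib_right[symmetric] by simp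
      also have "\<dots> < B * (e / B)" using B e by (intro mult_strict_right_mono) auto
      also have "\<dots> = e" using B by simp
      finally show "p \<in> s" unfolding s using e(2) by (simp add: dist_real_def)
    qed
  qed
qed

lemma weak_topology_pmf_tendsto:
  assumes "limitin weak_topology f p F"
  shows "((\<lambda>n. pmf (f n) i) \<longlongrightarrow> pmf p i) F"
proof (rule topological_tendstoI)
  fix U :: "real set" assume U: "open U" "pmf p i \<in> U"
  have ex: "measure_pmf.expectation q (indicat_real {i}) = pmf q i" for q
    by (simp add: measure_pmf_single)
  have "openin weak_topology {q. measure_pmf.expectation q (indicat_real {i}) \<in> U}"
    unfolding weak_topology_def
  proof (rule topology_generated_by_Basis, intro CollectI exI conjI)
    show "bounded (range (indicat_real {i}))"
      by (rule boundedI[of _ 1]) (auto simp: indicator_def)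
  qed (use U in auto)
  with assms U have "\<forall>\<^sub>F n in F. f n \<in> {q. measure_pmf.expectation q (indicat_real {i}) \<in> U}"
    unfolding limitin_def ex by auto
  then show "\<forall>\<^sub>F n in F. pmf (f n) i \<in> U" by (simp add: measure_pmf_single)
qed

text \<open>By \<open>openin_weak_topology_nbhd\<close>, a weakly continuous functional on laws
  carried by \<open>S\<close> follows the finitely many point probabilities. The general filter
  serves the limit in \<delta>.\<close>

lemma weak_continuous_tendsto:
  fixes g :: "'a pmf \<Rightarrow> real"
  assumes g: "continuous_map weak_topology euclideanreal g" and S: "finite S"
    and f: "\<And>n. set_pmf (f n) \<subseteq> S" and p: "set_pmf p \<subseteq> S"
    and lim: "\<And>s. s \<in> S \<Longrightarrow> ((\<lambda>n. pmf (f n) s) \<longlongrightarrow> pmf p s) F"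
  shows "((\<lambda>n. g (f n)) \<longlongrightarrow> g p) F"
proof (rule topological_tendstoI)
  fix U :: "real set" assume U: "open U" "g p \<in> U"
  have "openin weak_topology {q \<in> topspace weak_topology. g q \<in> U}"
    using g U(1) by (intro openin_continuous_map_preimage) auto
  then have "openin weak_topology {q. g q \<in> U}" by simp
  from openin_weak_topology_nbhd[OF this _ S p] U(2) obtain e where
    e: "e > 0" "\<And>q. set_pmf q \<subseteq> S \<Longrightarrow> \<forall>s\<in>S. \<bar>pmf q s - pmf p s\<bar> < e \<Longrightarrow> g q \<in> U" by auto
  have "\<forall>\<^sub>F n in F. \<forall>s\<in>S. dist (pmf (f n) s) (pmf p s) < e"
    using S lim e(1) by (intro eventually_ball_finite) (auto dest: tendstoD)
  then show "\<forall>\<^sub>F n in F. g (f n) \<in> U"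
    by eventually_elim (rule e(2)[OF f], simp add: dist_real_def)
qed

lemma space_borel_of [simp]: "space (borel_of T) = topspace T"
  unfolding borel_of_def by (rule space_measure_of) (auto dest: openin_subset)

lemma sets_borel_of: "sets (borel_of T) = sigma_sets (topspace T) {U. openin T U}"
  unfolding borel_of_def by (rule sets_measure_of) (auto dest: openin_subset)

lemma continuous_map_measurable_borel_of:
  assumes "continuous_map T euclideanreal g"
  shows "g \<in> borel_measurable (borel_of T)"
proof (rule borel_measurableI)
  fix U :: "real set" assume "open U"
  then have "openin T {q \<in> topspace T. g q \<in> U}"
    using assms by (intro openin_continuous_map_preimage) auto
  moreover have "g -` U \<inter> space (borel_of T) = {q \<in> topspace T. g q \<in> U}" by auto
  ultimately show "g -` U \<inter> space (borel_of T) \<in> sets (borel_of T)"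
    unfolding sets_borel_of by (auto intro: sigma_sets.Basic)
qed

section \<open>Exponential tilting\<close>

text \<open>The moment generating function of \<open>h\<close> under \<nu>;
  \<open>tilted_mean\<close> is its logarithmic derivative. A vertex of degree \<open>d\<close> will
  use the parameter \<open>s * d\<close>.\<close>

definition partition_sum :: "'x::finite pmf \<Rightarrow> ('x \<Rightarrow> real) \<Rightarrow> real \<Rightarrow> real" where
  "partition_sum \<nu> h s = (\<Sum>y\<in>UNIV. pmf \<nu> y * exp (s * h y))"

definition tilt :: "'x::finite pmf \<Rightarrow> ('x \<Rightarrow> real) \<Rightarrow> real \<Rightarrow> 'x pmf" where
  "tilt \<nu> h s = embed_pmf (\<lambda>x. pmf \<nu> x * exp (s * h x) / partition_sum \<nu> h s)"

definition tilted_mean :: "'x::finite pmf \<Rightarrow> ('x \<Rightarrow> real) \<Rightarrow> real \<Rightarrow> real" where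
  "tilted_mean \<nu> h s = (\<Sum>x\<in>UNIV. h x * (pmf \<nu> x * exp (s * h x))) / partition_sum \<nu> h s"

lemma partition_sum_pos: "0 < partition_sum \<nu> h s"
proof -
  obtain x where "x \<in> set_pmf \<nu>" using set_pmf_not_empty[of \<nu>] by blast
  then show ?thesis unfolding partition_sum_def
    by (intro sum_pos2[of _ x]) (auto simp: pmf_positive)
qed

lemma pmf_tilt: "pmf (tilt \<nu> h s) x = pmf \<nu> x * exp (s * h x) / partition_sum \<nu> h s"
  unfolding tilt_def
proof (rule pmf_embed_pmf)
  show nn: "0 \<le> pmf \<nu> x * exp (s * h x) / partition_sum \<nu> h s" for x
    using partition_sum_pos[of \<nu> h s] by simp
  have "(\<Sum>x\<in>UNIV. pmf \<nu> x * exp (s * h x) / partition_sum \<nu> h s) = 1"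
    using partition_sum_pos[of \<nu> h s] by (simp add: partition_sum_def flip: sum_divide_distrib)
  then show "(\<integral>\<^sup>+ x. ennreal (pmf \<nu> x * exp (s * h x) / partition_sum \<nu> h s) \<partial>count_space UNIV) = 1"
    by (simp only: nn_integral_count_space_finite[OF finite_class.finite_UNIV] sum_ennreal[OF nn] ennreal_1)
qed

lemma tilted_mean_eq: "tilted_mean \<nu> h s = (\<Sum>x\<in>UNIV. h x * pmf (tilt \<nu> h s) x)"
  by (simp add: tilted_mean_def pmf_tilt sum_divide_distrib)

lemma continuous_partition_sum [continuous_intros]:
  "continuous_on A f \<Longrightarrow> continuous_on A (\<lambda>s. partition_sum \<nu> h (f s))"
  unfolding partition_sum_def by (intro continuous_intros)

lemma continuous_tilted_mean [continuous_intros]: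
  "continuous_on A f \<Longrightarrow> continuous_on A (\<lambda>s. tilted_mean \<nu> h (f s))"
  unfolding tilted_mean_def
  by (intro continuous_intros) (auto simp: less_imp_neq[OF partition_sum_pos, symmetric])

lemma continuous_pmf_tilt [continuous_intros]:
  "continuous_on A f \<Longrightarrow> continuous_on A (\<lambda>s. pmf (tilt \<nu> h (f s)) x)"
  unfolding pmf_tilt
  by (intro continuous_intros) (auto simp: less_imp_neq[OF partition_sum_pos, symmetric])

text \<open>Symmetrizing over two independent copies turns the difference of tilted means into a sum of
  products of differences of equal sign.\<close>

lemma tilted_mean_diff:
  "2 * (partition_sum \<nu> h s * partition_sum \<nu> h t) * (tilted_mean \<nu> h t - tilted_mean \<nu> h s)
    = (\<Sum>x\<in>UNIV. \<Sum>y\<in>UNIV. pmf \<nu> x * pmf \<nu> y * exp (s * (h x + h y))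
        * ((h x - h y) * (exp ((t - s) * h x) - exp ((t - s) * h y))))"
proof -
  define a b where "a x = pmf \<nu> x * exp (s * h x)" and "b x = pmf \<nu> x * exp (t * h x)" for x
  let ?Zs = "partition_sum \<nu> h s" and ?Zt = "partition_sum \<nu> h t"
  have Z: "?Zs = sum a UNIV" "?Zt = sum b UNIV" by (simp_all add: partition_sum_def a_def b_def)
  have "?Zs * ?Zt * (tilted_mean \<nu> h t - tilted_mean \<nu> h s)
      = (\<Sum>x\<in>UNIV. h x * b x) * sum a UNIV - (\<Sum>x\<in>UNIV. h x * a x) * sum b UNIV"
    using partition_sum_pos[of \<nu> h s] partition_sum_pos[of \<nu> h t]
    by (simp add: tilted_mean_def Z[symmetric] a_def[symmetric] b_def[symmetric] field_simps)
  also have "\<dots> = (\<Sum>x\<in>UNIV. \<Sum>y\<in>UNIV. h x * (b x * a y - a x * b y))"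
    unfolding sum_product by (simp add: right_diff_distrib sum_subtractf mult.assoc)
  finally have 1: "?Zs * ?Zt * (tilted_mean \<nu> h t - tilted_mean \<nu> h s)
      = (\<Sum>x\<in>UNIV. \<Sum>y\<in>UNIV. h x * (b x * a y - a x * b y))" .
  have 2: "(\<Sum>x\<in>UNIV. \<Sum>y\<in>UNIV. h x * (b x * a y - a x * b y))
      = (\<Sum>x\<in>UNIV. \<Sum>y\<in>UNIV. h y * (b y * a x - a y * b x))" by (rule sum.swap)
  have "(\<Sum>x\<in>UNIV. \<Sum>y\<in>UNIV. h x * (b x * a y - a x * b y))
      + (\<Sum>x\<in>UNIV. \<Sum>y\<in>UNIV. h y * (b y * a x - a y * b x))
      = (\<Sum>x\<in>UNIV. \<Sum>y\<in>UNIV. pmf \<nu> x * pmf \<nu> y * exp (s * (h x + h y))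
        * ((h x - h y) * (exp ((t - s) * h x) - exp ((t - s) * h y))))"
    unfolding sum.distrib[symmetric]
  proof (intro sum.cong refl)
    fix x y
    have bx: "b x = a x * exp ((t - s) * h x)" for x
      by (simp add: a_def b_def left_diff_distrib flip: exp_add)
    show "h x * (b x * a y - a x * b y) + h y * (b y * a x - a y * b x)
      = pmf \<nu> x * pmf \<nu> y * exp (s * (h x + h y))
        * ((h x - h y) * (exp ((t - s) * h x) - exp ((t - s) * h y)))"
      unfolding bx by (simp add: a_def distrib_left exp_add algebra_simps)
  qed
  then show ?thesis using 1 2 by simp
qed

lemma diff_mult_exp_diff:
  fixes a b \<delta> :: real
  assumes "0 < \<delta>"
  shows "0 \<le> (a - b) * (exp (\<delta> * a) - exp (\<delta> * b))"
    and "a \<noteq> b \<Longrightarrow> 0 < (a - b) * (exp (\<delta> * a) - exp (\<delta> * b))"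
  using assms by (auto simp: zero_le_mult_iff zero_less_mult_iff)

lemma tilted_mean_mono:
  assumes "s \<le> t"
  shows "tilted_mean \<nu> h s \<le> tilted_mean \<nu> h t"
proof (cases "s = t")
  case False
  then have "0 \<le> 2 * (partition_sum \<nu> h s * partition_sum \<nu> h t) * (tilted_mean \<nu> h t - tilted_mean \<nu> h s)"
    unfolding tilted_mean_diff using assms by (intro sum_nonneg mult_nonneg_nonneg[OF _ diff_mult_exp_diff(1)]) auto
  moreover have "0 < 2 * (partition_sum \<nu> h s * partition_sum \<nu> h t)" by (simp add: partition_sum_pos)
  ultimately show ?thesis by (meson diff_ge_0_iff_ge mult_pos_neg not_less)
qed simp

text \<open>In the double sum of \<open>tilted_mean_diff\<close> one positive term suffices; it
  comes from two points of the support that \<open>h\<close> separates.\<close>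

lemma tilted_mean_strict_mono:
  assumes "s < t" and xy: "x \<in> set_pmf \<nu>" "y \<in> set_pmf \<nu>" "h x \<noteq> h y"
  shows "tilted_mean \<nu> h s < tilted_mean \<nu> h t"
proof -
  define f where "f x y = pmf \<nu> x * pmf \<nu> y * exp (s * (h x + h y))
      * ((h x - h y) * (exp ((t - s) * h x) - exp ((t - s) * h y)))" for x y
  have nn: "0 \<le> f x y" for x y
    unfolding f_def using assms by (intro mult_nonneg_nonneg[OF _ diff_mult_exp_diff(1)]) auto
  have "0 < f x y" unfolding f_def
    using assms by (intro mult_pos_pos[OF _ diff_mult_exp_diff(2)]) (auto intro!: mult_pos_pos pmf_positive)
  then have "0 < (\<Sum>y\<in>UNIV. f x y)" by (rule sum_pos2[rotated 2]) (auto simp: nn)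
  then have "0 < (\<Sum>x\<in>UNIV. \<Sum>y\<in>UNIV. f x y)" by (rule sum_pos2[rotated 2]) (auto simp: nn intro: sum_nonneg)
  then have "0 < 2 * (partition_sum \<nu> h s * partition_sum \<nu> h t) * (tilted_mean \<nu> h t - tilted_mean \<nu> h s)"
    unfolding tilted_mean_diff f_def .
  moreover have "0 < 2 * (partition_sum \<nu> h s * partition_sum \<nu> h t)" by (simp add: partition_sum_pos)
  ultimately have "0 < tilted_mean \<nu> h t - tilted_mean \<nu> h s" by (rule zero_less_mult_pos)
  then show ?thesis by simp
qed

text \<open>Laplace's principle: once \<open>exp (s * m)\<close> is divided out of numerator and
  denominator, only the maximizers of \<open>h\<close> on the support of \<nu> keep their
  weight.\<close>

lemma tilted_mean_at_top: "(tilted_mean \<nu> h \<longlongrightarrow> Max (h ` set_pmf \<nu>)) at_top"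
proof -
  define m where "m = Max (h ` set_pmf \<nu>)"
  have le: "h x \<le> m" if "x \<in> set_pmf \<nu>" for x unfolding m_def using that by (intro Max_ge) auto
  have "m \<in> h ` set_pmf \<nu>" unfolding m_def by (intro Max_in) (auto simp: set_pmf_not_empty)
  then obtain x0 where x0: "x0 \<in> set_pmf \<nu>" "h x0 = m" by auto
  define L where "L x = (if h x = m then 1 else 0 :: real)" for x
  have e: "((\<lambda>s. pmf \<nu> x * exp (s * (h x - m))) \<longlongrightarrow> pmf \<nu> x * L x) at_top" for x
  proof (cases "x \<in> set_pmf \<nu> \<and> h x \<noteq> m")
    case True
    then have "h x - m < 0" using le[of x] by auto
    then have "filterlim (\<lambda>s. s * (h x - m)) at_bot at_top"
      by (subst mult.commute) (rule filterlim_tendsto_neg_mult_at_bot[OF tendsto_const _ filterlim_ident])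
    then have "((\<lambda>s. exp (s * (h x - m))) \<longlongrightarrow> 0) at_top" by (rule filterlim_compose[OF exp_at_bot])
    then show ?thesis using True by (auto simp: L_def intro: tendsto_mult_right_zero)
  next
    case False
    then show ?thesis by (cases "h x = m") (auto simp: L_def set_pmf_iff)
  qed
  have eq: "tilted_mean \<nu> h s = (\<Sum>x\<in>UNIV. h x * (pmf \<nu> x * exp (s * (h x - m)))) / (\<Sum>x\<in>UNIV. pmf \<nu> x * exp (s * (h x - m)))" for s
  proof -
    have "exp (s * (h x - m)) = exp (s * h x) * exp (- (s * m))" for x
      by (simp add: right_diff_distrib exp_diff exp_minus divide_inverse)
    then show ?thesis
      by (simp add: tilted_mean_def partition_sum_def mult.assoc[symmetric] flip: sum_distrib_right)
  qed
  have pos: "0 < (\<Sum>x\<in>UNIV. pmf \<nu> x * L x)"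
    by (rule sum_pos2[of _ x0]) (use x0 in \<open>auto simp: L_def pmf_positive\<close>)
  have "(tilted_mean \<nu> h \<longlongrightarrow> (\<Sum>x\<in>UNIV. h x * (pmf \<nu> x * L x)) / (\<Sum>x\<in>UNIV. pmf \<nu> x * L x)) at_top"
    unfolding eq using pos by (intro tendsto_intros e) auto
  also have "(\<Sum>x\<in>UNIV. h x * (pmf \<nu> x * L x)) = m * (\<Sum>x\<in>UNIV. pmf \<nu> x * L x)"
    unfolding sum_distrib_left by (intro sum.cong) (auto simp: L_def)
  also have "\<dots> / (\<Sum>x\<in>UNIV. pmf \<nu> x * L x) = m" using pos by simp
  finally show ?thesis by (simp add: m_def)
qed

section \<open>Exponential concentration under the tilted law\<close>

abbreviation pr :: "'a pmf \<Rightarrow> 'a set \<Rightarrow> real" where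
  "pr p A \<equiv> measure_pmf.prob p A"

text \<open>Convergence in probability at exponential speed, with a rate that may depend on
  \<epsilon>. Stability under continuous operations carries it through the recursion on
  \<open>C\<close>.\<close>

definition exp_conv :: "(nat \<Rightarrow> 'w pmf) \<Rightarrow> (nat \<Rightarrow> 'w \<Rightarrow> real) \<Rightarrow> real \<Rightarrow> bool" where
  "exp_conv P Y y \<longleftrightarrow> (\<forall>\<epsilon>>0. \<exists>r>0. \<forall>\<^sub>F n in sequentially.
     pr (P n) {\<omega>. \<epsilon> \<le> \<bar>Y n \<omega> - y\<bar>} \<le> exp (- r * real n))"

text \<open>Half of the smaller rate is given up to absorb the factor 2.\<close>

lemma exp_rate_add:
  fixes r1 r2 :: real
  assumes "0 < r1" "0 < r2"
  shows "\<exists>r>0. \<forall>\<^sub>F n in sequentially. exp (- r1 * real n) + exp (- r2 * real n) \<le> exp (- r * real n)"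
proof (intro exI[of _ "min r1 r2 / 2"] conjI)
  define r where "r = min r1 r2 / 2"
  show "0 < min r1 r2 / 2" using assms by simp
  have "filterlim (\<lambda>n. r * real n) at_top sequentially"
    using assms by (intro filterlim_tendsto_pos_mult_at_top[OF tendsto_const _ filterlim_real_sequentially]) (simp add: r_def)
  then have "\<forall>\<^sub>F n in sequentially. ln 2 \<le> r * real n" by (simp add: filterlim_at_top)
  then show "\<forall>\<^sub>F n in sequentially. exp (- r1 * real n) + exp (- r2 * real n) \<le> exp (- (min r1 r2 / 2) * real n)"
  proof eventually_elim
    case (elim n)
    have "exp (- r1 * real n) \<le> exp (- r * real n - r * real n)" "exp (- r2 * real n) \<le> exp (- r * real n - r * real n)"
    proof -
      have "2 * r \<le> r1" "2 * r \<le> r2" by (auto simp: r_def)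
      then have "2 * r * real n \<le> r1 * real n" "2 * r * real n \<le> r2 * real n"
        by (auto intro: mult_right_mono)
      then show "exp (- r1 * real n) \<le> exp (- r * real n - r * real n)"
        "exp (- r2 * real n) \<le> exp (- r * real n - r * real n)" by simp_all
    qed
    then have "exp (- r1 * real n) + exp (- r2 * real n) \<le> 2 * exp (- r * real n - r * real n)" by linarith
    also have "\<dots> = 2 * exp (- r * real n) * exp (- (r * real n))" by (simp add: mult.assoc flip: exp_add)
    finally have "exp (- r1 * real n) + exp (- r2 * real n) \<le> 2 * exp (- r * real n) * exp (- (r * real n))" .
    also have "\<dots> \<le> 2 * exp (- r * real n) * exp (- ln 2)" using elim by (intro mult_left_mono) auto
    also have "\<dots> = exp (- r * real n)" by (simp add: exp_minus)
    finally show ?case by (simp add: r_def)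
  qed
qed

lemma exp_rate_shrink:
  fixes A :: "nat \<Rightarrow> 'w set"
  assumes sub: "\<forall>\<^sub>F n in sequentially. A n \<inter> set_pmf (P n) \<subseteq> B n \<union> C n"
    and B: "0 < r1" "\<forall>\<^sub>F n in sequentially. pr (P n) (B n) \<le> exp (- r1 * real n)"
    and C: "0 < r2" "\<forall>\<^sub>F n in sequentially. pr (P n) (C n) \<le> exp (- r2 * real n)"
  shows "\<exists>r>0. \<forall>\<^sub>F n in sequentially. pr (P n) (A n) \<le> exp (- r * real n)"
proof -
  obtain r where r: "r > 0"
    "\<forall>\<^sub>F n in sequentially. exp (- r1 * real n) + exp (- r2 * real n) \<le> exp (- r * real n)"
    using exp_rate_add[OF B(1) C(1)] by blast
  have "\<forall>\<^sub>F n in sequentially. pr (P n) (A n) \<le> exp (- r * real n)"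
    using sub B(2) C(2) r(2)
  proof eventually_elim
    case (elim n)
    have "pr (P n) (A n) = pr (P n) (A n \<inter> set_pmf (P n))"
      by (rule measure_Int_set_pmf[symmetric])
    also have "\<dots> \<le> pr (P n) (B n \<union> C n)"
      by (rule measure_pmf.finite_measure_mono) (use elim in auto)
    also have "\<dots> \<le> pr (P n) (B n) + pr (P n) (C n)"
      by (rule measure_Un_le) auto
    finally show ?case using elim by linarith
  qed
  with r(1) show ?thesis by blast
qed

text \<open>The continuous mapping principle for two sequences. The identity \<open>eq\<close> is
  asked on the support only, because the relations between the counts hold only for graphs of the
  model.\<close>

lemma exp_conv_combine:
  assumes Y: "exp_conv P Y y" and Z: "exp_conv P Z z"
    and f: "isCont (\<lambda>p. f (fst p) (snd p)) (y, z)"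
    and eq: "\<forall>\<^sub>F n in sequentially. \<forall>\<omega>\<in>set_pmf (P n). W n \<omega> = f (Y n \<omega>) (Z n \<omega>)"
  shows "exp_conv P W (f y z)"
  unfolding exp_conv_def
proof (intro allI impI)
  fix \<epsilon> :: real assume \<epsilon>: "\<epsilon> > 0"
  then obtain d where d: "d > 0" "\<And>p. dist p (y, z) < d \<Longrightarrow> dist (f (fst p) (snd p)) (f y z) < \<epsilon>"
    using f unfolding continuous_at_eps_delta by fastforce
  have near: "\<bar>f a b - f y z\<bar> < \<epsilon>" if "\<bar>a - y\<bar> < d / 2" "\<bar>b - z\<bar> < d / 2" for a b
  proof -
    have "dist (a, b) (y, z) \<le> \<bar>a - y\<bar> + \<bar>b - z\<bar>"
      unfolding dist_prod_def dist_real_def by (simp add: sqrt_sum_squares_le_sum_abs)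
    then show ?thesis using d(2)[of "(a, b)"] that by (simp add: dist_real_def)
  qed
  obtain r1 where r1: "0 < r1"
      "\<forall>\<^sub>F n in sequentially. pr (P n) {\<omega>. d / 2 \<le> \<bar>Y n \<omega> - y\<bar>} \<le> exp (- r1 * real n)"
    using Y[unfolded exp_conv_def, rule_format, OF half_gt_zero[OF d(1)]] by blast
  obtain r2 where r2: "0 < r2"
      "\<forall>\<^sub>F n in sequentially. pr (P n) {\<omega>. d / 2 \<le> \<bar>Z n \<omega> - z\<bar>} \<le> exp (- r2 * real n)"
    using Z[unfolded exp_conv_def, rule_format, OF half_gt_zero[OF d(1)]] by blast
  show "\<exists>r>0. \<forall>\<^sub>F n in sequentially. pr (P n) {\<omega>. \<epsilon> \<le> \<bar>W n \<omega> - f y z\<bar>} \<le> exp (- r * real n)"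
  proof (rule exp_rate_shrink[OF _ r1 r2])
    show "\<forall>\<^sub>F n in sequentially. {\<omega>. \<epsilon> \<le> \<bar>W n \<omega> - f y z\<bar>} \<inter> set_pmf (P n)
        \<subseteq> {\<omega>. d / 2 \<le> \<bar>Y n \<omega> - y\<bar>} \<union> {\<omega>. d / 2 \<le> \<bar>Z n \<omega> - z\<bar>}"
      using eq
    proof eventually_elim
      case (elim n)
      show ?case
      proof
        fix \<omega> assume \<omega>: "\<omega> \<in> {\<omega>. \<epsilon> \<le> \<bar>W n \<omega> - f y z\<bar>} \<inter> set_pmf (P n)"
        then have "\<epsilon> \<le> \<bar>f (Y n \<omega>) (Z n \<omega>) - f y z\<bar>" using elim by auto
        then show "\<omega> \<in> {\<omega>. d / 2 \<le> \<bar>Y n \<omega> - y\<bar>} \<union> {\<omega>. d / 2 \<le> \<bar>Z n \<omega> - z\<bar>}"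
          using near[of "Y n \<omega>" "Z n \<omega>"] by (simp only: Un_iff mem_Collect_eq) linarith
      qed
    qed
  qed
qed

lemma exp_conv_cong:
  assumes "exp_conv P Y y" "\<forall>\<^sub>F n in sequentially. \<forall>\<omega>\<in>set_pmf (P n). W n \<omega> = Y n \<omega>"
  shows "exp_conv P W y"
  by (rule exp_conv_combine[OF assms(1) assms(1), where f = "\<lambda>a b. a"]) (auto intro: assms)

lemma exp_conv_add:
  assumes "exp_conv P Y y" "exp_conv P Z z"
  shows "exp_conv P (\<lambda>n \<omega>. Y n \<omega> + Z n \<omega>) (y + z)"
  by (rule exp_conv_combine[OF assms]) (auto intro!: continuous_intros)

lemma exp_conv_mult:
  assumes "exp_conv P Y y" "exp_conv P Z z"
  shows "exp_conv P (\<lambda>n \<omega>. Y n \<omega> * Z n \<omega>) (y * z)"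
  by (rule exp_conv_combine[OF assms]) (auto intro!: continuous_intros)

lemma exp_conv_deterministic:
  assumes c: "c \<longlonglongrightarrow> y" and eq: "\<forall>\<^sub>F n in sequentially. \<forall>\<omega>\<in>set_pmf (P n). Y n \<omega> = c n"
  shows "exp_conv P Y y"
  unfolding exp_conv_def
\<comment> \<open>From some \<open>n\<close> on the event has probability 0, so the rate 1 is an
  arbitrary choice.\<close>
proof (intro allI impI exI[of _ 1] conjI)
  fix \<epsilon> :: real assume \<epsilon>: "0 < \<epsilon>"
  show "\<forall>\<^sub>F n in sequentially. pr (P n) {\<omega>. \<epsilon> \<le> \<bar>Y n \<omega> - y\<bar>} \<le> exp (- 1 * real n)"
    using eq tendstoD[OF c \<epsilon>]
  proof eventually_elim
    case (elim n)
    then have "{\<omega>. \<epsilon> \<le> \<bar>Y n \<omega> - y\<bar>} \<inter> set_pmf (P n) = {}" by (auto simp: dist_real_def)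
    then have "pr (P n) {\<omega>. \<epsilon> \<le> \<bar>Y n \<omega> - y\<bar>} = 0"
      using measure_Int_set_pmf[of "P n" "{\<omega>. \<epsilon> \<le> \<bar>Y n \<omega> - y\<bar>}"] by (simp only: measure_empty)
    then show ?case by simp
  qed
qed simp

lemma exp_conv_const: "exp_conv P (\<lambda>n \<omega>. c) c"
  by (rule exp_conv_deterministic[of "\<lambda>_. c"]) auto

lemma exp_conv_sum:
  assumes "finite I" "\<And>i. i \<in> I \<Longrightarrow> exp_conv P (Y i) (y i)"
  shows "exp_conv P (\<lambda>n \<omega>. \<Sum>i\<in>I. Y i n \<omega>) (\<Sum>i\<in>I. y i)"
  using assms by (induction I rule: finite_induct) (auto intro: exp_conv_const exp_conv_add)

lemma exp_conv_eventually_in_interval: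
  assumes Y: "exp_conv P Y y" and ab: "a < y" "y < b"
  shows "(\<lambda>n. pr (P n) {\<omega>. a \<le> Y n \<omega> \<and> Y n \<omega> \<le> b}) \<longlonglongrightarrow> 1"
proof -
  define e where "e = min (y - a) (b - y)"
  have "e > 0" using ab by (simp add: e_def)
  then obtain r where r: "r > 0"
    "\<forall>\<^sub>F n in sequentially. pr (P n) {\<omega>. e \<le> \<bar>Y n \<omega> - y\<bar>} \<le> exp (- r * real n)"
    using Y unfolding exp_conv_def by blast
  have lim: "(\<lambda>n. 1 - exp (- r * real n)) \<longlonglongrightarrow> 1 - 0"
    by (intro tendsto_intros filterlim_compose[OF exp_at_bot]
        filterlim_tendsto_neg_mult_at_bot[OF tendsto_const _ filterlim_real_sequentially]) (use r in auto)
  show ?thesis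
  proof (rule tendsto_sandwich[of "\<lambda>n. 1 - exp (- r * real n)" _ _ "\<lambda>_. 1"])
    show "\<forall>\<^sub>F n in sequentially. 1 - exp (- r * real n) \<le> pr (P n) {\<omega>. a \<le> Y n \<omega> \<and> Y n \<omega> \<le> b}"
      using r(2)
    proof eventually_elim
      case (elim n)
      have "1 - pr (P n) {\<omega>. e \<le> \<bar>Y n \<omega> - y\<bar>} = pr (P n) (UNIV - {\<omega>. e \<le> \<bar>Y n \<omega> - y\<bar>})"
        using measure_pmf.prob_compl[of "{\<omega>. e \<le> \<bar>Y n \<omega> - y\<bar>}" "P n"] by simp
      also have "\<dots> \<le> pr (P n) {\<omega>. a \<le> Y n \<omega> \<and> Y n \<omega> \<le> b}"
        by (rule measure_pmf.finite_measure_mono) (auto simp: e_def abs_less_iff)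
      finally show ?case using elim by linarith
    qed
  qed (use lim in auto)
qed

section \<open>The tilted law of the marked graph\<close>

definition tilted_CM ::
  "nat \<Rightarrow> nat pmf \<Rightarrow> 'x::finite pmf \<Rightarrow> ('x \<Rightarrow> real) \<Rightarrow> real \<Rightarrow> (nat set set \<times> (nat \<Rightarrow> 'x)) pmf" where
  "tilted_CM n a \<nu> h s = bind_pmf (pmf_of_set (cm_graphs n a)) (\<lambda>E.
     map_pmf (Pair E) (Pi_pmf {1..n} undefined (\<lambda>v. tilt \<nu> h (s * real (deg E v)))))"

text \<open>The value \<open>undefined\<close> outside \<open>{1..n}\<close> is the one that
  \<open>Pi_pmf\<close> assigns; this makes the set of possible markings finite, and probabilities
  become finite sums.\<close>

definition markings :: "nat \<Rightarrow> (nat \<Rightarrow> 'x) set" where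
  "markings n = PiE_dflt {1..n} undefined (\<lambda>_. UNIV)"

lemma finite_markings: "finite (markings n :: (nat \<Rightarrow> 'x::finite) set)"
  unfolding markings_def by (rule finite_PiE_dflt) auto

lemma cm_graphs_subset: "cm_graphs n a \<subseteq> simple_graphs n"
  by (auto simp: cm_graphs_def)

lemma finite_cm_graphs: "finite (cm_graphs n a)"
  using cm_graphs_subset finite_simple_graphs by (rule finite_subset)

lemma cm_graphs_count:
  "E \<in> cm_graphs n a \<Longrightarrow> n > 0 \<Longrightarrow> real (card {v\<in>{1..n}. deg E v = i}) = real n * pmf a i"
  by (auto simp: cm_graphs_def field_simps)

lemma cm_graphs_degree_le:
  assumes E: "E \<in> cm_graphs n a" and a: "set_pmf a \<subseteq> {0..M}"
  shows "deg E v \<le> M"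
proof (cases "v \<in> {1..n}")
  case True
  then have n: "n > 0" by simp
  have "{v} \<subseteq> {u\<in>{1..n}. deg E u = deg E v}" using True by auto
  then have "card {v} \<le> card {u\<in>{1..n}. deg E u = deg E v}" by (rule card_mono[rotated]) simp
  then have "0 < real n * pmf a (deg E v)" using cm_graphs_count[OF E n, of "deg E v"] by simp
  then have "deg E v \<in> set_pmf a" by (auto simp: set_pmf_iff)
  then show ?thesis using a by auto
next
  case False
  then have "nbrs E v = {}" using simple_graphs_edge[of E n] E cm_graphs_subset by (fastforce simp: nbrs_def)
  then show ?thesis by simp
qed

text \<open>All graphs of the model have the same degree distribution, so sums of this kind are
  deterministic. It gives the number of arcs and, later, the normalizing constant of the
  tilt.\<close>

lemma sum_degree_function:
  fixes f :: "nat \<Rightarrow> real"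
  assumes E: "E \<in> cm_graphs n a" and a: "set_pmf a \<subseteq> {0..M}" and n: "n > 0"
  shows "(\<Sum>v\<in>{1..n}. f (deg E v)) = real n * (\<Sum>i=0..M. pmf a i * f i)"
proof -
  have "(\<Sum>v\<in>{1..n}. f (deg E v)) = (\<Sum>i\<in>{0..M}. \<Sum>v\<in>{v\<in>{1..n}. deg E v = i}. f (deg E v))"
    by (rule sum.group[symmetric]) (use cm_graphs_degree_le[OF E a] in auto)
  also have "\<dots> = (\<Sum>i\<in>{0..M}. real (card {v\<in>{1..n}. deg E v = i}) * f i)" by (intro sum.cong refl) simp
  also have "\<dots> = real n * (\<Sum>i=0..M. pmf a i * f i)"
    by (simp only: cm_graphs_count[OF E n] sum_distrib_left mult.assoc)
  finally show ?thesis .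
qed

lemma cm_graphs_switch:
  assumes E: "E \<in> cm_graphs n a" and q: "q \<in> switches E"
  shows "switch E q \<in> cm_graphs n a"
  using assms switch_simple[of E n q] card_nbrs_switch[of E n q] by (auto simp: cm_graphs_def)

lemma pmf_tilted_CM:
  assumes ne: "cm_graphs n a \<noteq> {}"
  shows "pmf (tilted_CM n a \<nu> h s) (E, X) = (if E \<in> cm_graphs n a \<and> X \<in> markings n
    then (\<Prod>v\<in>{1..n}. pmf (tilt \<nu> h (s * real (deg E v))) (X v)) / real (card (cm_graphs n a)) else 0)"
proof -
  let ?p = "\<lambda>E. Pi_pmf {1..n} undefined (\<lambda>v. tilt \<nu> h (s * real (deg E v)))"
  have m: "pmf (map_pmf (Pair E') (?p E')) (E, X) = (if E' = E then pmf (?p E) X else 0)" for E'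
  proof (cases "E' = E")
    case True
    then show ?thesis using pmf_map_inj'[of "Pair E" "?p E" X] by (auto simp: inj_on_def)
  next
    case False
    then show ?thesis by (auto simp: pmf_eq_0_set_pmf)
  qed
  have "pmf (tilted_CM n a \<nu> h s) (E, X)
      = (\<Sum>E'\<in>cm_graphs n a. if E' = E then pmf (?p E) X else 0) / real (card (cm_graphs n a))"
    unfolding tilted_CM_def by (simp only: pmf_bind_pmf_of_set[OF ne finite_cm_graphs] m)
  also have "\<dots> = (if E \<in> cm_graphs n a then pmf (?p E) X else 0) / real (card (cm_graphs n a))"
    by (simp add: sum.delta[OF finite_cm_graphs] cong: if_cong)
  also have "pmf (?p E) X = (if X \<in> markings n
      then (\<Prod>v\<in>{1..n}. pmf (tilt \<nu> h (s * real (deg E v))) (X v)) else 0)"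
    by (subst pmf_Pi) (auto simp: PiE_dflt_def markings_def)
  finally show ?thesis by auto
qed

lemma set_tilted_CM:
  assumes "cm_graphs n a \<noteq> {}"
  shows "set_pmf (tilted_CM n a \<nu> h s) \<subseteq> cm_graphs n a \<times> markings n"
  by (auto simp: set_pmf_iff pmf_tilted_CM[OF assms] split: if_splits)

lemma prob_tilted_CM:
  assumes ne: "cm_graphs n a \<noteq> {}"
  shows "pr (tilted_CM n a \<nu> h s) B
    = (\<Sum>\<omega>\<in>B \<inter> (cm_graphs n a \<times> markings n). pmf (tilted_CM n a \<nu> h s) \<omega>)"
proof -
  have "pr (tilted_CM n a \<nu> h s) B
      = pr (tilted_CM n a \<nu> h s) (B \<inter> (cm_graphs n a \<times> markings n))"
    by (rule measure_prob_cong_0) (use set_tilted_CM[OF ne, of \<nu> h s] in \<open>auto simp: pmf_eq_0_set_pmf\<close>)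
  also have "\<dots> = (\<Sum>\<omega>\<in>B \<inter> (cm_graphs n a \<times> markings n). pmf (tilted_CM n a \<nu> h s) \<omega>)"
    by (rule measure_measure_pmf_finite) (simp add: finite_cm_graphs finite_markings)
  finally show ?thesis .
qed

lemma sum_pmf_tilted_CM:
  fixes \<nu> :: "'x::finite pmf"
  assumes ne: "cm_graphs n a \<noteq> {}"
  shows "(\<Sum>X\<in>markings n. \<Sum>E\<in>cm_graphs n a. pmf (tilted_CM n a \<nu> h s) (E, X)) = 1"
proof -
  have "(\<Sum>X\<in>markings n. \<Sum>E\<in>cm_graphs n a. pmf (tilted_CM n a \<nu> h s) (E, X))
      = (\<Sum>E\<in>cm_graphs n a. \<Sum>X\<in>markings n. pmf (tilted_CM n a \<nu> h s) (E, X))" by (rule sum.swap)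
  also have "\<dots> = (\<Sum>\<omega>\<in>cm_graphs n a \<times> markings n. pmf (tilted_CM n a \<nu> h s) \<omega>)"
    by (simp add: sum.cartesian_product)
  also have "\<dots> = 1"
    by (rule sum_pmf_eq_1) (auto simp: finite_cm_graphs finite_markings set_tilted_CM[OF ne])
  finally show ?thesis .
qed

text \<open>The tilted law is a mixture over the graph, so a bound that is uniform in the graph
  passes to it.\<close>

lemma prob_tilted_CM_le:
  fixes \<nu> :: "'x::finite pmf"
  assumes ne: "cm_graphs n a \<noteq> {}"
    and b: "\<And>E. E \<in> cm_graphs n a \<Longrightarrow>
      pr (Pi_pmf {1..n} undefined (\<lambda>v. tilt \<nu> h (s * real (deg E v)))) {X. (E, X) \<in> B} \<le> b"
  shows "pr (tilted_CM n a \<nu> h s) B \<le> b"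
proof -
  let ?p = "\<lambda>E. Pi_pmf {1..n} undefined (\<lambda>v. tilt \<nu> h (s * real (deg E v)))"
  have "pr (tilted_CM n a \<nu> h s) B = measure_pmf.expectation (tilted_CM n a \<nu> h s) (indicat_real B)"
    by simp
  also have "\<dots> = (\<Sum>E\<in>cm_graphs n a. measure_pmf.expectation (map_pmf (Pair E) (?p E)) (indicat_real B) /\<^sub>R real (card (cm_graphs n a)))"
    unfolding tilted_CM_def
  proof (rule pmf_expectation_bind_pmf_of_set[OF ne finite_cm_graphs])
    fix E
    show "finite (set_pmf (map_pmf (Pair E) (?p E)))"
      by (simp add: set_Pi_pmf finite_PiE_dflt)
  qed
  also have "\<dots> = (\<Sum>E\<in>cm_graphs n a. pr (?p E) {X. (E, X) \<in> B} / real (card (cm_graphs n a)))"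
    by (intro sum.cong refl) (simp add: vimage_def divide_inverse mult.commute)
  also have "\<dots> \<le> (\<Sum>E\<in>cm_graphs n a. b / real (card (cm_graphs n a)))"
    by (intro sum_mono divide_right_mono b) auto
  also have "\<dots> = b" using ne finite_cm_graphs[of n a] by (simp add: card_gt_0_iff)
  finally show ?thesis .
qed

text \<open>Chernoff's bound. The law draws the graph before the marks, but the finite double sum is
  exchanged so that \<open>count_drift_mgf\<close> can be applied for each fixed marking.\<close>

lemma prob_count_drift:
  fixes \<nu> :: "'x::finite pmf" and C :: "'x multiset" and d :: nat
  assumes ne: "cm_graphs n a \<noteq> {}" and a: "set_pmf a \<subseteq> {0..M}"
    and \<sigma>: "\<sigma> \<in> {1, -1}" and n: "n > 0" and \<theta>: "0 \<le> \<theta>"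
  defines "K \<equiv> 2 ^ d * (real M * (2 * real (size C) + real d + 1) * (4 * 2 ^ d)) * (real M)\<^sup>2"
    and "e \<equiv> real (M * (2 * M + 2 * M * M)) * 2 ^ d"
  shows "pr (tilted_CM n a \<nu> h s) {\<omega>. \<epsilon> * real n \<le> \<sigma> * count_drift n (snd \<omega>) d x C (fst \<omega>)}
    \<le> exp (real n * K * \<theta>\<^sup>2 / 2 + e * \<theta> - \<theta> * (\<epsilon> * real n))"
proof -
  let ?p = "pmf (tilted_CM n a \<nu> h s)"
  let ?W = "\<lambda>E X. \<sigma> * count_drift n X d x C E"
  let ?B = "{\<omega>. \<epsilon> * real n \<le> ?W (fst \<omega>) (snd \<omega>)}"
  have "pr (tilted_CM n a \<nu> h s) ?B = (\<Sum>\<omega>\<in>?B \<inter> (cm_graphs n a \<times> markings n). ?p \<omega>)"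
    by (rule prob_tilted_CM[OF ne])
  also have "\<dots> \<le> (\<Sum>\<omega>\<in>?B \<inter> (cm_graphs n a \<times> markings n). ?p \<omega> * exp (\<theta> * ?W (fst \<omega>) (snd \<omega>) - \<theta> * (\<epsilon> * real n)))"
  proof (rule sum_mono)
    fix \<omega> assume "\<omega> \<in> ?B \<inter> (cm_graphs n a \<times> markings n)"
    then have "0 \<le> \<theta> * ?W (fst \<omega>) (snd \<omega>) - \<theta> * (\<epsilon> * real n)"
      using \<theta> by (simp add: mult_left_mono)
    then have "1 \<le> exp (\<theta> * ?W (fst \<omega>) (snd \<omega>) - \<theta> * (\<epsilon> * real n))" by simp
    from mult_left_mono[OF this, of "?p \<omega>"]
    show "?p \<omega> \<le> ?p \<omega> * exp (\<theta> * ?W (fst \<omega>) (snd \<omega>) - \<theta> * (\<epsilon> * real n))" by simp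
  qed
  also have "\<dots> \<le> (\<Sum>\<omega>\<in>cm_graphs n a \<times> markings n. ?p \<omega> * exp (\<theta> * ?W (fst \<omega>) (snd \<omega>) - \<theta> * (\<epsilon> * real n)))"
    by (intro sum_mono2) (auto simp: finite_cm_graphs finite_markings)
  also have "\<dots> = (\<Sum>E\<in>cm_graphs n a. \<Sum>X\<in>markings n. ?p (E, X) * exp (\<theta> * ?W E X - \<theta> * (\<epsilon> * real n)))"
    by (subst sum.cartesian_product) (simp add: case_prod_beta)
  also have "\<dots> = (\<Sum>X\<in>markings n. \<Sum>E\<in>cm_graphs n a. ?p (E, X) * exp (\<theta> * ?W E X - \<theta> * (\<epsilon> * real n)))"
    by (rule sum.swap)
  also have "\<dots> = (\<Sum>X\<in>markings n. \<Sum>E\<in>cm_graphs n a. ?p (E, X) * exp (\<theta> * ?W E X)) * exp (- (\<theta> * (\<epsilon> * real n)))"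
    by (simp add: sum_distrib_right exp_diff exp_minus divide_inverse mult.assoc)
  also have "\<dots> \<le> (\<Sum>X\<in>markings n. (\<Sum>E\<in>cm_graphs n a. ?p (E, X)) * exp (real n * K * \<theta>\<^sup>2 / 2 + e * \<theta>)) * exp (- (\<theta> * (\<epsilon> * real n)))"
  proof (intro mult_right_mono sum_mono)
    fix X :: "nat \<Rightarrow> 'x" assume X: "X \<in> markings n"
    show "(\<Sum>E\<in>cm_graphs n a. ?p (E, X) * exp (\<theta> * ?W E X)) \<le> (\<Sum>E\<in>cm_graphs n a. ?p (E, X)) * exp (real n * K * \<theta>\<^sup>2 / 2 + e * \<theta>)"
      unfolding K_def e_def
    proof (rule count_drift_mgf[OF cm_graphs_subset _ _ _ _ \<sigma> n \<theta>])
      fix E assume E: "E \<in> cm_graphs n a"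
      show "deg E v \<le> M" for v by (rule cm_graphs_degree_le[OF E a])
      fix q assume q: "q \<in> switches E"
      have sg: "E \<in> simple_graphs n" using E cm_graphs_subset by blast
      show sw: "switch E q \<in> cm_graphs n a" by (rule cm_graphs_switch[OF E q])
      show "?p (switch E q, X) = ?p (E, X)"
        using E sw by (simp add: pmf_tilted_CM[OF ne] card_nbrs_switch[OF sg q])
    qed auto
  qed auto
  also have "\<dots> = exp (real n * K * \<theta>\<^sup>2 / 2 + e * \<theta>) * exp (- (\<theta> * (\<epsilon> * real n)))"
    by (simp add: sum_pmf_tilted_CM[OF ne] flip: sum_distrib_right)
  also have "\<dots> = exp (real n * K * \<theta>\<^sup>2 / 2 + e * \<theta> - \<theta> * (\<epsilon> * real n))" by (simp flip: exp_add)
  finally show ?thesis .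
qed

lemma type_count_empty:
  assumes E: "E \<in> simple_graphs n"
  shows "type_count n X d x {#} E = (\<Sum>v\<in>{1..n}. if deg E v = d \<and> X v = x then 1 else 0)"
  unfolding type_count_def by (intro sum.cong refl) (simp add: sub_count_empty finite_nbrs[OF E])

text \<open>Given the graph the marks are independent, and Hoeffding's inequality applies to the
  indicators. The centering is the same for all graphs, since each has \<open>n * pmf a d\<close>
  vertices of degree \<open>d\<close>.\<close>

lemma prob_type_count:
  fixes \<nu> :: "'x::finite pmf"
  assumes ne: "cm_graphs n a \<noteq> {}" and n: "n > 0" and \<epsilon>: "\<epsilon> \<ge> 0"
  shows "pr (tilted_CM n a \<nu> h s)
      {\<omega>. \<epsilon> * real n \<le> \<bar>type_count n (snd \<omega>) d x {#} (fst \<omega>) - real n * (pmf a d * pmf (tilt \<nu> h (s * real d)) x)\<bar>}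
    \<le> 2 * exp (- 2 * \<epsilon>\<^sup>2 * real n)"
proof (rule prob_tilted_CM_le[OF ne])
  fix E assume E: "E \<in> cm_graphs n a"
  then have sg: "E \<in> simple_graphs n" using cm_graphs_subset by blast
  define p where "p = Pi_pmf {1..n} undefined (\<lambda>v. tilt \<nu> h (s * real (deg E v)))"
  define Y where "Y v X = (if deg E v = d \<and> X v = x then 1 else 0 :: real)" for v and X :: "nat \<Rightarrow> 'x"
  define \<mu> where "\<mu> = (\<Sum>v\<in>{1..n}. measure_pmf.expectation p (Y v))"
  interpret Hoeffding_ineq "measure_pmf p" "{1..n}" Y "\<lambda>_. 0" "\<lambda>_. 1" \<mu>
  proof unfold_locales
    show "prob_space.indep_vars (measure_pmf p) (\<lambda>_. borel) Y {1..n}"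
      unfolding p_def Y_def
      by (intro prob_space.indep_vars_compose2[OF _ indep_vars_Pi_pmf])
        (auto simp: measure_pmf.prob_space_axioms)
  qed (auto simp: Y_def \<mu>_def)
  have "measure_pmf.expectation p (Y v) = (if deg E v = d then pmf (tilt \<nu> h (s * real d)) x else 0)"
    if v: "v \<in> {1..n}" for v
  proof -
    have "measure_pmf.expectation p (Y v) = measure_pmf.expectation (map_pmf (\<lambda>X. X v) p)
        (\<lambda>y. if deg E v = d \<and> y = x then 1 else 0)" by (simp add: Y_def[abs_def])
    also have "map_pmf (\<lambda>X. X v) p = tilt \<nu> h (s * real (deg E v))"
      unfolding p_def using v by (subst Pi_pmf_component) auto
    also have "measure_pmf.expectation \<dots> (\<lambda>y. if deg E v = d \<and> y = x then 1 else 0)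
        = (if deg E v = d then pmf (tilt \<nu> h (s * real d)) x else 0)"
      by (subst integral_measure_pmf_real[of "{x}"]) (auto split: if_splits)
    finally show ?thesis .
  qed
  then have "\<mu> = (\<Sum>v\<in>{1..n}. if deg E v = d then pmf (tilt \<nu> h (s * real d)) x else 0)"
    unfolding \<mu>_def by (intro sum.cong refl) blast
  also have "\<dots> = (\<Sum>v\<in>{v\<in>{1..n}. deg E v = d}. pmf (tilt \<nu> h (s * real d)) x)"
    by (rule sum.inter_filter[symmetric]) simp
  also have "\<dots> = real n * (pmf a d * pmf (tilt \<nu> h (s * real d)) x)"
    by (simp only: sum_constant cm_graphs_count[OF E n] mult.assoc)
  finally have \<mu>: "\<mu> = real n * (pmf a d * pmf (tilt \<nu> h (s * real d)) x)" .
  have "pr p {X \<in> space (measure_pmf p). \<epsilon> * real n \<le> \<bar>(\<Sum>v\<in>{1..n}. Y v X) - \<mu>\<bar>}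
      \<le> 2 * exp (- 2 * (\<epsilon> * real n)\<^sup>2 / (\<Sum>i\<in>{1..n}. (1 - 0)\<^sup>2))"
    by (rule Hoeffding_ineq_abs_ge) (use n \<epsilon> in auto)
  also have "- 2 * (\<epsilon> * real n)\<^sup>2 / (\<Sum>i\<in>{1..n}. (1 - 0)\<^sup>2) = - 2 * \<epsilon>\<^sup>2 * real n"
    using n by (simp add: power2_eq_square)
  finally show "pr (Pi_pmf {1..n} undefined (\<lambda>v. tilt \<nu> h (s * real (deg E v))))
      {X. (E, X) \<in> {\<omega>. \<epsilon> * real n \<le> \<bar>type_count n (snd \<omega>) d x {#} (fst \<omega>)
        - real n * (pmf a d * pmf (tilt \<nu> h (s * real d)) x)\<bar>}} \<le> 2 * exp (- 2 * \<epsilon>\<^sup>2 * real n)"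
    unfolding \<mu> p_def[symmetric] Y_def by (simp add: type_count_empty[OF sg])
qed

text \<open>The half-edges at vertices of mark \<open>y\<close> are the weights in the drift.
  Expressed by counts with the empty multiset, they have a limit that is available before the
  recursion starts.\<close>

lemma sum_degree_of_mark:
  assumes E: "E \<in> simple_graphs n" and M: "\<And>v. deg E v \<le> M"
  shows "(\<Sum>z\<in>{1..n}. if X z = y then real (deg E z) else 0)
    = (\<Sum>i=0..M. real i * type_count n X i y {#} E)"
proof -
  have "(\<Sum>i=0..M. real i * type_count n X i y {#} E)
      = (\<Sum>i=0..M. \<Sum>z\<in>{1..n}. if deg E z = i \<and> X z = y then real i else 0)"
    unfolding type_count_empty[OF E] sum_distrib_left by (intro sum.cong refl) auto
  also have "\<dots> = (\<Sum>z\<in>{1..n}. \<Sum>i=0..M. if deg E z = i \<and> X z = y then real i else 0)"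
    by (rule sum.swap)
  also have "\<dots> = (\<Sum>z\<in>{1..n}. if X z = y then real (deg E z) else 0)"
  proof (rule sum.cong[OF refl])
    fix z
    have "(\<Sum>i=0..M. if deg E z = i \<and> X z = y then real i else 0)
        = (\<Sum>i=0..M. if i = deg E z then (if X z = y then real i else 0) else 0)"
      by (intro sum.cong) auto
    then show "(\<Sum>i=0..M. if deg E z = i \<and> X z = y then real i else 0)
        = (if X z = y then real (deg E z) else 0)" using M[of z] by simp
  qed
  finally show ?thesis ..
qed

text \<open>The drift in densities per vertex. If the left side tends to 0 and \<open>C\<close> is
  not empty, the density for \<open>C\<close> is determined in the limit by those for
  \<open>C - {#y#}\<close>.\<close>

lemma count_drift_eq:
  assumes E: "E \<in> cm_graphs n a" and a: "set_pmf a \<subseteq> {0..M}" and n: "n > 0"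
  shows "count_drift n X d x C E / real n
    = (\<Sum>i=0..M. pmf a i * real i) * real (size C) * (type_count n X d x C E / real n)
      - (real d - real (size C) + 1) * (\<Sum>y\<in>set_mset C.
          (\<Sum>i=0..M. real i * (type_count n X i y {#} E / real n)) * (type_count n X d x (C - {#y#}) E / real n))"
proof -
  have sg: "E \<in> simple_graphs n" using E cm_graphs_subset by blast
  have M: "deg E v \<le> M" for v by (rule cm_graphs_degree_le[OF E a])
  let ?b = "\<lambda>y. type_count n X d x (C - {#y#}) E" and ?c = "real d - real (size C) + 1"
  have D: "real (card (arcs E)) = real n * (\<Sum>i=0..M. pmf a i * real i)"
    using sum_degree_function[OF E a n, of real] by (simp add: card_arcs_eq[OF sg])
  have "(\<Sum>z\<in>{1..n}. real (deg E z) * (if X z \<in># C then ?c * ?b (X z) else 0))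
      = (\<Sum>z\<in>{1..n}. \<Sum>y\<in>set_mset C. if X z = y then real (deg E z) * (?c * ?b y) else 0)"
  proof (rule sum.cong[OF refl])
    fix z
    have "(\<Sum>y\<in>set_mset C. if X z = y then real (deg E z) * (?c * ?b y) else 0)
        = (if X z \<in># C then real (deg E z) * (?c * ?b (X z)) else 0)"
      by (subst sum.delta') auto
    then show "real (deg E z) * (if X z \<in># C then ?c * ?b (X z) else 0)
        = (\<Sum>y\<in>set_mset C. if X z = y then real (deg E z) * (?c * ?b y) else 0)" by simp
  qed
  also have "\<dots> = (\<Sum>y\<in>set_mset C. \<Sum>z\<in>{1..n}. if X z = y then real (deg E z) * (?c * ?b y) else 0)"
    by (rule sum.swap)
  also have "\<dots> = (\<Sum>y\<in>set_mset C. (\<Sum>i=0..M. real i * type_count n X i y {#} E) * (?c * ?b y))"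
    unfolding sum_degree_of_mark[OF sg M, symmetric] sum_distrib_right
    by (intro sum.cong refl) auto
  also have "\<dots> = real n * real n * (?c * (\<Sum>y\<in>set_mset C.
      (\<Sum>i=0..M. real i * (type_count n X i y {#} E / real n)) * (?b y / real n)))"
  proof -
    define A where "A y = (\<Sum>i=0..M. real i * type_count n X i y {#} E)" for y
    have "(\<Sum>i=0..M. real i * (type_count n X i y {#} E / real n)) = A y / real n" for y
      by (simp add: A_def sum_divide_distrib)
    then show ?thesis unfolding A_def[symmetric] using n by (simp add: sum_distrib_left mult_ac)
  qed
  finally have S: "(\<Sum>z\<in>{1..n}. real (deg E z) * (if X z \<in># C then ?c * ?b (X z) else 0))
    = real n * real n * (?c * (\<Sum>y\<in>set_mset C.
      (\<Sum>i=0..M. real i * (type_count n X i y {#} E / real n)) * (?b y / real n)))" .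
  have aux: "(m * A * k * T - m * m * R) / m / m = A * k * (T / m) - R" if "m \<noteq> 0" for m A k T R :: real
    using that by (simp add: field_simps)
  show ?thesis
    unfolding count_drift_def D S by (rule aux) (use n in simp)
qed

section \<open>Star laws through multisets of i.i.d. marks\<close>

definition iid_mset :: "'x pmf \<Rightarrow> nat \<Rightarrow> 'x multiset pmf" where
  "iid_mset \<psi> m = map_pmf (\<lambda>Y. image_mset Y (mset_set {..<m})) (Pi_pmf {..<m} undefined (\<lambda>_. \<psi>))"

lemma iid_mset_0: "iid_mset \<psi> 0 = return_pmf {#}"
  by (simp add: iid_mset_def)

lemma iid_mset_Suc: "iid_mset \<psi> (Suc m) = bind_pmf \<psi> (\<lambda>y. map_pmf (add_mset y) (iid_mset \<psi> m))"
proof -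
  have eq: "image_mset (f(m := y)) (mset_set {..<Suc m}) = add_mset y (image_mset f (mset_set {..<m}))"
    for f and y :: 'x
    unfolding lessThan_Suc by (subst mset_set.insert) (auto intro!: image_mset_cong)
  have "Pi_pmf {..<Suc m} undefined (\<lambda>_. \<psi>)
      = map_pmf (\<lambda>(y, f). f(m := y)) (pair_pmf \<psi> (Pi_pmf {..<m} undefined (\<lambda>_. \<psi>)))"
    unfolding lessThan_Suc by (rule Pi_pmf_insert) auto
  then show ?thesis
    unfolding iid_mset_def
    by (simp add: pmf.map_comp o_def case_prod_beta eq pair_pmf_def map_bind_pmf map_pmf_def bind_assoc_pmf
        bind_return_pmf)
qed

lemma set_iid_mset: "C \<in> set_pmf (iid_mset \<psi> m) \<Longrightarrow> size C = m"
  by (auto simp: iid_mset_def)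

text \<open>Conditioning on the mark of one leaf. The sum over the distinct marks of
  \<open>C\<close> has the shape of the recursion in \<open>count_drift_eq\<close>, which is how the
  limits of the counts are recognized.\<close>

lemma pmf_iid_mset_Suc:
  fixes \<psi> :: "'x::finite pmf"
  shows "pmf (iid_mset \<psi> (Suc m)) C = (\<Sum>y\<in>set_mset C. pmf \<psi> y * pmf (iid_mset \<psi> m) (C - {#y#}))"
proof -
  have a: "pmf (map_pmf (add_mset y) (iid_mset \<psi> m)) C = (if y \<in># C then pmf (iid_mset \<psi> m) (C - {#y#}) else 0)" for y
  proof (cases "y \<in># C")
    case True
    then show ?thesis
      using pmf_map_inj'[of "add_mset y" "iid_mset \<psi> m" "C - {#y#}"] by (simp add: inj_on_def)
  next
    case False
    then show ?thesis by (auto simp: pmf_eq_0_set_pmf)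
  qed
  have "pmf (iid_mset \<psi> (Suc m)) C = (\<Sum>y\<in>UNIV. pmf (map_pmf (add_mset y) (iid_mset \<psi> m)) C * pmf \<psi> y)"
    unfolding iid_mset_Suc pmf_bind by (rule integral_measure_pmf_real) auto
  also have "\<dots> = (\<Sum>y\<in>set_mset C. pmf \<psi> y * pmf (iid_mset \<psi> m) (C - {#y#}))"
    by (rule sum.mono_neutral_cong_right) (auto simp: a)
  finally show ?thesis .
qed

lemma pmf_star_law: "pmf (star_law \<gamma> \<psi>) (Star x C) = pmf \<gamma> (size C, x) * pmf (iid_mset \<psi> (size C)) C"
proof -
  have "star_law \<gamma> \<psi> = bind_pmf \<gamma> (\<lambda>(m, x). map_pmf (Star x) (iid_mset \<psi> m))"
    by (simp add: star_law_def iid_mset_def pmf.map_comp o_def)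
  then have "pmf (star_law \<gamma> \<psi>) (Star x C)
      = (\<integral>p. pmf (map_pmf (Star (snd p)) (iid_mset \<psi> (fst p))) (Star x C) \<partial>measure_pmf \<gamma>)"
    by (simp add: pmf_bind case_prod_beta)
  also have "\<dots> = (\<Sum>p\<in>{(size C, x)}. pmf (map_pmf (Star (snd p)) (iid_mset \<psi> (fst p))) (Star x C) * pmf \<gamma> p)"
    by (rule integral_measure_pmf_real) (auto simp: pmf_eq_0_set_pmf dest: set_iid_mset)
  also have "\<dots> = pmf \<gamma> (size C, x) * pmf (iid_mset \<psi> (size C)) C"
    using pmf_map_inj'[of "Star x" "iid_mset \<psi> (size C)" C] by (simp add: inj_on_def)
  finally show ?thesis .
qed

text \<open>The limit law of (degree, mark) of a uniform vertex under the tilt \<open>s\<close>; for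
  the solution \<open>t\<close> it is the \<gamma> of the theorem.\<close>

definition tilted_joint :: "nat pmf \<Rightarrow> 'x::finite pmf \<Rightarrow> ('x \<Rightarrow> real) \<Rightarrow> real \<Rightarrow> (nat \<times> 'x) pmf" where
  "tilted_joint \<alpha> \<nu> h s = bind_pmf \<alpha> (\<lambda>m. map_pmf (Pair m) (tilt \<nu> h (s * real m)))"

lemma pmf_tilted_joint: "pmf (tilted_joint \<alpha> \<nu> h s) (m, x) = pmf \<alpha> m * pmf (tilt \<nu> h (s * real m)) x"
proof -
  have "pmf (tilted_joint \<alpha> \<nu> h s) (m, x)
      = (\<Sum>k\<in>{m}. pmf (map_pmf (Pair k) (tilt \<nu> h (s * real k))) (m, x) * pmf \<alpha> k)"
    unfolding tilted_joint_def pmf_bind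
    by (rule integral_measure_pmf_real) (auto simp: pmf_eq_0_set_pmf)
  then show ?thesis using pmf_map_inj'[of "Pair m" "tilt \<nu> h (s * real m)" x] by (simp add: inj_on_def)
qed

section \<open>Concentration of the counts along a configuration-model sequence\<close>

locale cm_model =
  fixes M :: nat and \<kappa> :: real and \<alpha> :: "nat pmf" and \<alpha>n :: "nat \<Rightarrow> nat pmf"
    and \<nu> :: "'x::finite pmf" and h :: "'x \<Rightarrow> real"
  assumes CM: "CM_sequence M \<kappa> \<alpha> \<alpha>n"
begin

lemma kappa_pos: "0 < \<kappa>"
  and alpha_support: "set_pmf \<alpha> \<subseteq> {0..M}"
  and alpha_mean: "(\<Sum>i=0..M. real i * pmf \<alpha> i) = \<kappa>"
  using CM by (auto simp: CM_sequence_def)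

lemma alphan_support: "n \<ge> 1 \<Longrightarrow> set_pmf (\<alpha>n n) \<subseteq> {0..M}"
  using CM by (auto simp: CM_sequence_def)

lemma alphan_tendsto: "(\<lambda>n. pmf (\<alpha>n n) i) \<longlonglongrightarrow> pmf \<alpha> i"
  using CM by (intro weak_topology_pmf_tendsto) (simp add: CM_sequence_def)

lemma alphan_mean_tendsto: "(\<lambda>n. \<Sum>i=0..M. real i * pmf (\<alpha>n n) i) \<longlonglongrightarrow> \<kappa>"
  unfolding alpha_mean[symmetric] by (intro tendsto_intros alphan_tendsto)

lemma eventually_cm_graphs: "\<forall>\<^sub>F n in sequentially. n \<ge> 1 \<and> cm_graphs n (\<alpha>n n) \<noteq> {}"
proof -
  let ?K = "real (M * (M + 1) + 2 * ((2 + 2 * M) * M))"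
  have "filterlim (\<lambda>n. (\<Sum>i=0..M. real i * pmf (\<alpha>n n) i) * real n) at_top sequentially"
    by (rule filterlim_tendsto_pos_mult_at_top[OF alphan_mean_tendsto kappa_pos filterlim_real_sequentially])
  then have "\<forall>\<^sub>F n in sequentially. ?K < (\<Sum>i=0..M. real i * pmf (\<alpha>n n) i) * real n"
    by (simp only: filterlim_at_top_dense)
  with eventually_ge_at_top[of 1] show ?thesis
  proof eventually_elim
    case (elim n)
    have "cm_graphs n (\<alpha>n n) \<noteq> {}"
    proof (rule cm_graphs_nonempty[OF elim(1) alphan_support[OF elim(1)]])
      show "\<exists>k\<le>n. pmf (\<alpha>n n) i = real k / real n" for i
        using CM elim(1) unfolding CM_sequence_def by blast
      show "\<exists>k. real n * (\<Sum>i=0..M. real i * pmf (\<alpha>n n) i) = real (2 * k)"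
        using CM elim(1) unfolding CM_sequence_def by blast
      show "?K < real n * (\<Sum>i=0..M. real i * pmf (\<alpha>n n) i)" using elim(2) by (simp only: mult.commute)
    qed
    with elim show ?case by simp
  qed
qed

abbreviation P :: "real \<Rightarrow> nat \<Rightarrow> (nat set set \<times> (nat \<Rightarrow> 'x)) pmf" where
  "P s n \<equiv> tilted_CM n (\<alpha>n n) \<nu> h s"

abbreviation \<gamma> :: "real \<Rightarrow> (nat \<times> 'x) pmf" where
  "\<gamma> s \<equiv> tilted_joint \<alpha> \<nu> h s"

text \<open>Hoeffding's bound controls the fluctuation around the value computed with
  \<open>\<alpha>n n\<close>; that value is deterministic and converges with
  \<open>\<alpha>n\<close>.\<close>

lemma exp_conv_type:
  "exp_conv (P s) (\<lambda>n \<omega>. type_count n (snd \<omega>) d x {#} (fst \<omega>) / real n) (pmf (\<gamma> s) (d, x))"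
proof -
  let ?T = "\<lambda>n \<omega>. type_count n (snd \<omega>) d x {#} (fst \<omega>)"
  let ?q = "\<lambda>n. pmf (\<alpha>n n) d * pmf (tilt \<nu> h (s * real d)) x"
  have "exp_conv (P s) (\<lambda>n \<omega>. ?T n \<omega> / real n - ?q n) 0"
    unfolding exp_conv_def
  proof (intro allI impI)
    fix \<epsilon> :: real assume \<epsilon>: "0 < \<epsilon>"
    then obtain r where r: "r > 0" "\<forall>\<^sub>F n in sequentially.
        exp (- (2 * \<epsilon>\<^sup>2) * real n) + exp (- (2 * \<epsilon>\<^sup>2) * real n) \<le> exp (- r * real n)"
      using exp_rate_add[of "2 * \<epsilon>\<^sup>2" "2 * \<epsilon>\<^sup>2"] by auto
    have "\<forall>\<^sub>F n in sequentially. pr (P s n) {\<omega>. \<epsilon> \<le> \<bar>?T n \<omega> / real n - ?q n - 0\<bar>} \<le> exp (- r * real n)"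
      using r(2) eventually_cm_graphs
    proof eventually_elim
      case (elim n)
      have "\<epsilon> \<le> \<bar>?T n \<omega> / real n - ?q n - 0\<bar> \<longleftrightarrow> \<epsilon> * real n \<le> \<bar>?T n \<omega> - real n * ?q n\<bar>" for \<omega>
      proof -
        have "?T n \<omega> / real n - ?q n - 0 = (?T n \<omega> - real n * ?q n) / real n"
          using elim by (simp add: field_simps)
        then show ?thesis using elim by (simp add: abs_divide pos_le_divide_eq)
      qed
      then have "pr (P s n) {\<omega>. \<epsilon> \<le> \<bar>?T n \<omega> / real n - ?q n - 0\<bar>}
          \<le> 2 * exp (- 2 * \<epsilon>\<^sup>2 * real n)"
        using prob_type_count[of n "\<alpha>n n" \<epsilon> \<nu> h s d x] elim \<epsilon> by simp
      with elim show ?case by simp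
    qed
    with r(1) show "\<exists>r>0. \<forall>\<^sub>F n in sequentially.
      pr (P s n) {\<omega>. \<epsilon> \<le> \<bar>?T n \<omega> / real n - ?q n - 0\<bar>} \<le> exp (- r * real n)" by blast
  qed
  moreover have "exp_conv (P s) (\<lambda>n \<omega>. ?q n) (pmf (\<gamma> s) (d, x))"
    unfolding pmf_tilted_joint
    by (rule exp_conv_deterministic[of ?q]) (auto intro!: tendsto_intros alphan_tendsto)
  ultimately have "exp_conv (P s) (\<lambda>n \<omega>. ?T n \<omega> / real n - ?q n + ?q n) (0 + pmf (\<gamma> s) (d, x))"
    by (rule exp_conv_add)
  then show ?thesis by simp
qed

lemma exp_conv_drift:
  "exp_conv (P s) (\<lambda>n \<omega>. count_drift n (snd \<omega>) d x C (fst \<omega>) / real n) 0"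
  unfolding exp_conv_def
proof (intro allI impI)
  fix \<epsilon> :: real assume \<epsilon>: "0 < \<epsilon>"
  let ?W = "\<lambda>n \<omega>. count_drift n (snd \<omega>) d x C (fst \<omega>)"
  define K where "K = 2 ^ d * (real M * (2 * real (size C) + real d + 1) * (4 * 2 ^ d)) * (real M)\<^sup>2"
  define e where "e = real (M * (2 * M + 2 * M * M)) * 2 ^ d"
  \<comment> \<open>With \<open>\<theta> = \<epsilon> / (K + 1)\<close> (the summand 1 keeps the
    denominator positive) the quadratic term uses at most half of
    \<open>\<theta> * \<epsilon> * n\<close>, and for \<open>n \<ge> 4 * e / \<epsilon>\<close> the
    term \<open>e * \<theta>\<close> uses another quarter. The remaining quarter is
    \<open>r * n\<close>.\<close>
  define r where "r = \<epsilon>\<^sup>2 / (4 * (K + 1))"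
  have K: "0 \<le> K" and e: "0 \<le> e" by (auto simp: K_def e_def)
  have r: "0 < r" using K \<epsilon> by (simp add: r_def)
  have tail: "\<forall>\<^sub>F n in sequentially. pr (P s n) {\<omega>. \<epsilon> * real n \<le> \<sigma> * ?W n \<omega>} \<le> exp (- r * real n)"
    if \<sigma>: "\<sigma> \<in> {1, -1}" for \<sigma>
    using eventually_cm_graphs eventually_ge_at_top[of "nat \<lceil>4 * e / \<epsilon>\<rceil>"]
  proof eventually_elim
    case (elim n)
    define \<theta> where "\<theta> = \<epsilon> / (K + 1)"
    have \<theta>: "0 < \<theta>" using \<epsilon> K by (simp add: \<theta>_def)
    have \<theta>K: "\<theta> * (K + 1) = \<epsilon>" using K by (simp add: \<theta>_def)
    have "4 * e / \<epsilon> \<le> real n" using elim(2) by linarith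
    then have en: "4 * e \<le> \<epsilon> * real n" using \<epsilon> by (simp add: field_simps)
    have "real n * K * \<theta>\<^sup>2 / 2 + e * \<theta> - \<theta> * (\<epsilon> * real n)
        \<le> \<theta> * (real n * (\<theta> * (K + 1)) / 2 + e - \<epsilon> * real n)"
      using \<theta> by (simp add: power2_eq_square algebra_simps)
    also have "\<dots> = \<theta> * (e - \<epsilon> * real n / 2)" unfolding \<theta>K by (simp add: algebra_simps)
    also have "\<dots> \<le> \<theta> * (- (\<epsilon> * real n / 4))" using \<theta> en by (intro mult_left_mono) auto
    also have "\<dots> = - r * real n" using K by (simp add: \<theta>_def r_def power2_eq_square field_simps)
    finally have "exp (real n * K * \<theta>\<^sup>2 / 2 + e * \<theta> - \<theta> * (\<epsilon> * real n)) \<le> exp (- r * real n)" by simp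
    moreover have "pr (P s n) {\<omega>. \<epsilon> * real n \<le> \<sigma> * ?W n \<omega>}
        \<le> exp (real n * K * \<theta>\<^sup>2 / 2 + e * \<theta> - \<theta> * (\<epsilon> * real n))"
      unfolding K_def e_def by (rule prob_count_drift) (use elim \<theta> \<sigma> alphan_support in auto)
    ultimately show ?case by (rule order_trans[rotated])
  qed
  show "\<exists>r>0. \<forall>\<^sub>F n in sequentially. pr (P s n) {\<omega>. \<epsilon> \<le> \<bar>?W n \<omega> / real n - 0\<bar>} \<le> exp (- r * real n)"
  proof (rule exp_rate_shrink[OF _ r tail[of 1] r tail[of "-1"]])
    show "\<forall>\<^sub>F n in sequentially. {\<omega>. \<epsilon> \<le> \<bar>?W n \<omega> / real n - 0\<bar>} \<inter> set_pmf (P s n)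
        \<subseteq> {\<omega>. \<epsilon> * real n \<le> 1 * ?W n \<omega>} \<union> {\<omega>. \<epsilon> * real n \<le> - 1 * ?W n \<omega>}"
      using eventually_ge_at_top[of 1]
    proof eventually_elim
      case (elim n)
      then have "\<epsilon> \<le> \<bar>?W n \<omega> / real n - 0\<bar> \<longleftrightarrow> \<epsilon> * real n \<le> \<bar>?W n \<omega>\<bar>" for \<omega>
        by (simp add: abs_divide pos_le_divide_eq)
      then show ?case by auto
    qed
  qed auto
qed

lemma set_tilted_joint: "set_pmf (\<gamma> s) \<subseteq> {0..M} \<times> UNIV"
  using alpha_support by (auto simp: tilted_joint_def)

lemma pmf_size_biased_tilted:
  assumes "0 < s"
  shows "\<kappa> * pmf (size_biased M \<kappa> (\<gamma> s)) x = (\<Sum>i=0..M. real i * pmf (\<gamma> s) (i, x))"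
proof -
  \<comment> \<open>Any \<open>\<gamma> s\<close> with \<open>s > 0\<close> solves the system whose
    level is its own mean, so \<open>pmf_size_biased\<close> applies for every positive
    tilt.\<close>
  have "tilted_solution M \<alpha> \<nu> h (\<Sum>m=0..M. \<Sum>y\<in>UNIV. real m * h y * pmf (\<gamma> s) (m, y)) (\<gamma> s) s"
    unfolding tilted_solution_def using assms set_tilted_joint
    by (auto simp: pmf_tilted_joint pmf_tilt partition_sum_def)
  from pmf_size_biased[OF CM this] show ?thesis using kappa_pos by simp
qed

text \<open>The limit is the expected number of leaf subsets with marks \<open>C\<close> in a star
  with i.i.d. leaves: \<open>d choose size C\<close> subsets, each with the same probability. In the
  induction on \<open>size C\<close> the drift vanishes by \<open>exp_conv_drift\<close>, and
  \<open>count_drift_eq\<close> is solved for the count of \<open>C\<close>.\<close>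

lemma exp_conv_count:
  assumes s: "0 < s"
  shows "exp_conv (P s) (\<lambda>n \<omega>. type_count n (snd \<omega>) d x C (fst \<omega>) / real n)
    (pmf (\<gamma> s) (d, x) * real (d choose size C) * pmf (iid_mset (size_biased M \<kappa> (\<gamma> s)) (size C)) C)"
proof (induction "size C" arbitrary: C)
  case 0
  then show ?case using exp_conv_type[of s d x] by (simp add: iid_mset_0)
next
  case (Suc k)
  let ?\<psi> = "size_biased M \<kappa> (\<gamma> s)"
  let ?T = "\<lambda>C n \<omega>. type_count n (snd \<omega>) d x C (fst \<omega>) / real n"
  let ?W = "\<lambda>n \<omega>. count_drift n (snd \<omega>) d x C (fst \<omega>) / real n"
  let ?D = "\<lambda>y n \<omega>. \<Sum>i=0..M. real i * (type_count n (snd \<omega>) i y {#} (fst \<omega>) / real n)"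
  let ?c = "real d - real (size C) + 1"
  have sz: "size (C - {#y#}) = k" if "y \<in># C" for y
    using that Suc(2) by (simp add: size_Diff_singleton)
  have 1: "exp_conv (P s) (?T (C - {#y#})) (pmf (\<gamma> s) (d, x) * real (d choose k) * pmf (iid_mset ?\<psi> k) (C - {#y#}))"
    if "y \<in># C" for y using Suc(1)[of "C - {#y#}"] sz[OF that] by simp
  have 2: "exp_conv (P s) (?D y) (\<kappa> * pmf ?\<psi> y)" for y
    unfolding pmf_size_biased_tilted[OF s]
    by (intro exp_conv_sum exp_conv_mult exp_conv_const exp_conv_type) auto
  have 3: "exp_conv (P s) (\<lambda>n \<omega>. ?c * (\<Sum>y\<in>set_mset C. ?D y n \<omega> * ?T (C - {#y#}) n \<omega>))
      (?c * (\<Sum>y\<in>set_mset C. \<kappa> * pmf ?\<psi> y * (pmf (\<gamma> s) (d, x) * real (d choose k) * pmf (iid_mset ?\<psi> k) (C - {#y#}))))"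
    by (intro exp_conv_sum exp_conv_mult exp_conv_const 1 2) auto
  have 4: "exp_conv (P s) (\<lambda>n \<omega>. ?W n \<omega> + ?c * (\<Sum>y\<in>set_mset C. ?D y n \<omega> * ?T (C - {#y#}) n \<omega>))
      (0 + ?c * (\<Sum>y\<in>set_mset C. \<kappa> * pmf ?\<psi> y * (pmf (\<gamma> s) (d, x) * real (d choose k) * pmf (iid_mset ?\<psi> k) (C - {#y#}))))"
    by (intro exp_conv_add exp_conv_drift 3)
  have 5: "exp_conv (P s) (\<lambda>n \<omega>. 1 / ((\<Sum>i=0..M. pmf (\<alpha>n n) i * real i) * real (size C))) (1 / (\<kappa> * real (size C)))"
  proof (rule exp_conv_deterministic)
    have "(\<lambda>n. \<Sum>i=0..M. pmf (\<alpha>n n) i * real i) \<longlonglongrightarrow> \<kappa>"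
      using alphan_mean_tendsto by (simp add: mult.commute)
    then show "(\<lambda>n. 1 / ((\<Sum>i=0..M. pmf (\<alpha>n n) i * real i) * real (size C))) \<longlonglongrightarrow> 1 / (\<kappa> * real (size C))"
      by (rule tendsto_divide[OF tendsto_const tendsto_mult_right]) (unfold Suc(2)[symmetric], use kappa_pos in simp)
  qed simp
  note 6 = exp_conv_mult[OF 5 4]
  have "exp_conv (P s) (?T C) (1 / (\<kappa> * real (size C)) * (0 + ?c * (\<Sum>y\<in>set_mset C. \<kappa> * pmf ?\<psi> y
      * (pmf (\<gamma> s) (d, x) * real (d choose k) * pmf (iid_mset ?\<psi> k) (C - {#y#})))))"
  proof (rule exp_conv_cong[OF 6])
    have "\<forall>\<^sub>F n in sequentially. 0 < (\<Sum>i=0..M. real i * pmf (\<alpha>n n) i)"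
      using order_tendstoD(1)[OF alphan_mean_tendsto kappa_pos] .
    with eventually_cm_graphs show "\<forall>\<^sub>F n in sequentially. \<forall>\<omega>\<in>set_pmf (P s n). ?T C n \<omega> =
        1 / ((\<Sum>i=0..M. pmf (\<alpha>n n) i * real i) * real (size C))
        * (?W n \<omega> + ?c * (\<Sum>y\<in>set_mset C. ?D y n \<omega> * ?T (C - {#y#}) n \<omega>))"
    proof eventually_elim
      case (elim n)
      show ?case
      proof
        fix \<omega> assume "\<omega> \<in> set_pmf (P s n)"
        then have E: "fst \<omega> \<in> cm_graphs n (\<alpha>n n)" using set_tilted_CM[of n "\<alpha>n n" \<nu> h s] elim by auto
        have pos: "(\<Sum>i=0..M. pmf (\<alpha>n n) i * real i) * real (size C) \<noteq> 0"
          using elim unfolding Suc(2)[symmetric] by (simp add: mult.commute)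
        have "?W n \<omega> = (\<Sum>i=0..M. pmf (\<alpha>n n) i * real i) * real (size C) * ?T C n \<omega>
            - ?c * (\<Sum>y\<in>set_mset C. ?D y n \<omega> * ?T (C - {#y#}) n \<omega>)"
          by (rule count_drift_eq[OF E alphan_support]) (use elim in auto)
        then show "?T C n \<omega> = 1 / ((\<Sum>i=0..M. pmf (\<alpha>n n) i * real i) * real (size C))
            * (?W n \<omega> + ?c * (\<Sum>y\<in>set_mset C. ?D y n \<omega> * ?T (C - {#y#}) n \<omega>))"
          using pos by (simp only: diff_add_cancel) simp
      qed
    qed
  qed
  moreover have "1 / (\<kappa> * real (size C)) * (0 + ?c * (\<Sum>y\<in>set_mset C. \<kappa> * pmf ?\<psi> y
      * (pmf (\<gamma> s) (d, x) * real (d choose k) * pmf (iid_mset ?\<psi> k) (C - {#y#}))))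
    = pmf (\<gamma> s) (d, x) * real (d choose size C) * pmf (iid_mset ?\<psi> (size C)) C"
  proof -
    have "(\<Sum>y\<in>set_mset C. \<kappa> * pmf ?\<psi> y * (pmf (\<gamma> s) (d, x) * real (d choose k) * pmf (iid_mset ?\<psi> k) (C - {#y#})))
      = \<kappa> * (pmf (\<gamma> s) (d, x) * real (d choose k) * pmf (iid_mset ?\<psi> (Suc k)) C)"
      unfolding pmf_iid_mset_Suc by (simp add: sum_distrib_left mult_ac)
    \<comment> \<open>Since \<open>size C = Suc k\<close>, the factor \<open>?c\<close> is
      \<open>d - k\<close>, and binomial absorption produces the next binomial coefficient. For
      \<open>k > d\<close> the real factor is negative, but both coefficients are 0.\<close>
    moreover have "real (Suc k) * real (d choose Suc k) = (real d - real k) * real (d choose k)"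
    proof (cases "k \<le> d")
      case True
      have "Suc k * (d choose Suc k) = (d - k) * (d choose k)"
        by (simp only: binomial_absorb_comp binomial_absorption)
      then have "real (Suc k * (d choose Suc k)) = real ((d - k) * (d choose k))" by (simp only:)
      then show ?thesis using True by (simp only: of_nat_mult of_nat_diff)
    next
      case False
      then show ?thesis by (simp add: binomial_eq_0)
    qed
    then have "real (d choose Suc k) = (real d - real k) * real (d choose k) / real (Suc k)"
      by (simp add: field_simps)
    ultimately show ?thesis using kappa_pos unfolding Suc(2)[symmetric] by simp
  qed
  ultimately show ?case by simp
qed

end

section \<open>The empirical measure in terms of counts\<close>

lemma pmf_nbhd_empirical:
  assumes E: "E \<in> simple_graphs n" and n: "n \<ge> 1"
  shows "pmf (nbhd_empirical n (E, X)) (Star x C) = type_count n X (size C) x C E / real n"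
proof -
  have fin: "finite (nbrs E v)" for v by (rule finite_nbrs[OF E])
  have star: "star_class X v (nbrs E v) = Star x C \<longleftrightarrow> X v = x \<and> image_mset X (mset_set (nbrs E v)) = C" for v
    by (simp add: star_class_def)
  have "pmf (nbhd_empirical n (E, X)) (Star x C)
      = real (card ({1..n} \<inter> {v. star_class X v (nbrs E v) = Star x C})) / real n"
    unfolding nbhd_empirical_def using n by (simp add: pmf_map measure_pmf_of_set vimage_def)
  also have "real (card ({1..n} \<inter> {v. star_class X v (nbrs E v) = Star x C}))
      = (\<Sum>v\<in>{1..n}. if star_class X v (nbrs E v) = Star x C then 1 else 0)"
    by (simp add: sum.If_cases)
  also have "\<dots> = type_count n X (size C) x C E"
    unfolding type_count_def
  proof (rule sum.cong[OF refl])
    fix v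
    have "size C = deg E v" if "image_mset X (mset_set (nbrs E v)) = C"
      using that by auto
    then show "(if star_class X v (nbrs E v) = Star x C then 1 else 0)
        = (if deg E v = size C \<and> X v = x then real (sub_count X C (nbrs E v)) else 0)"
      unfolding star by (auto simp: sub_count_full[OF fin])
  qed
  finally show ?thesis .
qed

lemma expectation_nbhd_empirical:
  assumes E: "E \<in> simple_graphs n" and n: "n \<ge> 1"
  shows "measure_pmf.expectation (nbhd_empirical n (E, X)) (leaf_sum h)
    = (\<Sum>v\<in>{1..n}. real (deg E v) * h (X v)) / real n"
proof -
  have "measure_pmf.expectation (nbhd_empirical n (E, X)) (leaf_sum h)
      = (\<Sum>v\<in>{1..n}. leaf_sum h (star_class X v (nbrs E v))) / real n"
    unfolding nbhd_empirical_def using n by (simp add: integral_pmf_of_set)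
  also have "(\<Sum>v\<in>{1..n}. leaf_sum h (star_class X v (nbrs E v))) = (\<Sum>v\<in>{1..n}. \<Sum>u\<in>nbrs E v. h (X u))"
    by (simp add: leaf_sum_def star_class_def multiset.map_comp o_def sum_unfold_sum_mset)
  also have "\<dots> = (\<Sum>(v, u)\<in>arcs E. h (X u))" by (rule sum_arcs_fst[OF E, symmetric])
  also have "\<dots> = (\<Sum>v\<in>{1..n}. real (deg E v) * h (X v))" by (rule sum_arcs_snd[OF E])
  finally show ?thesis .
qed

text \<open>A finite set that carries all empirical measures of the model and all limit laws, so
  that weak neighborhoods reduce to finitely many coordinates.\<close>

definition stars :: "nat \<Rightarrow> 'x star set" where
  "stars M = {Star x C | x C. size C \<le> M}"

lemma finite_stars: "finite (stars M :: 'x::finite star set)"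
proof -
  have "{C :: 'x multiset. size C \<le> M} \<subseteq> mset ` {xs. set xs \<subseteq> UNIV \<and> length xs \<le> M}"
  proof
    fix C :: "'x multiset" assume C: "C \<in> {C. size C \<le> M}"
    obtain xs where xs: "mset xs = C" using ex_mset by blast
    then have "length xs \<le> M" using C by auto
    then show "C \<in> mset ` {xs. set xs \<subseteq> UNIV \<and> length xs \<le> M}" using xs by blast
  qed
  then have "finite {C :: 'x multiset. size C \<le> M}"
    by (rule finite_subset) (intro finite_imageI finite_lists_length_le finite)
  then have "finite ((\<lambda>(x, C). Star x C) ` ((UNIV :: 'x set) \<times> {C. size C \<le> M}))" by simp
  then show ?thesis by (rule finite_subset[rotated]) (auto simp: stars_def)
qed

lemma set_nbhd_empirical:
  assumes E: "E \<in> cm_graphs n a" and a: "set_pmf a \<subseteq> {0..M}" and n: "n \<ge> 1"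
  shows "set_pmf (nbhd_empirical n (E, X)) \<subseteq> stars M"
  using n cm_graphs_degree_le[OF E a] by (auto simp: nbhd_empirical_def star_class_def stars_def)

lemma tilt_0 [simp]: "tilt \<nu> h 0 = \<nu>"
  by (rule pmf_eqI) (simp add: pmf_tilt partition_sum_def sum_pmf_eq_1)

lemma marked_CM_eq_tilted: "marked_CM n a \<nu> = tilted_CM n a \<nu> h 0"
  by (simp add: marked_CM_def tilted_CM_def pair_pmf_def map_pmf_def)

text \<open>Serves to read the lower bound on \<open>c\<close> in the theorem as
  \<open>level 0 < c\<close>.\<close>

lemma expectation_true_law:
  fixes \<nu> :: "'x::finite pmf"
  assumes \<alpha>: "set_pmf \<alpha> \<subseteq> {0..M}"
  shows "measure_pmf.expectation (true_law \<alpha> \<nu>) (leaf_sum h)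
    = (\<Sum>i=0..M. real i * pmf \<alpha> i) * (\<Sum>x\<in>UNIV. h x * pmf \<nu> x)"
proof -
  have e: "measure_pmf.expectation (iid_mset \<nu> m) (\<lambda>C. leaf_sum h (Star x C)) = real m * (\<Sum>x\<in>UNIV. h x * pmf \<nu> x)" for x m
  proof -
    have fin: "finite (set_pmf (Pi_pmf {..<m} undefined (\<lambda>_. \<nu>)))"
      by (simp add: set_Pi_pmf finite_PiE_dflt)
    have "measure_pmf.expectation (iid_mset \<nu> m) (\<lambda>C. leaf_sum h (Star x C))
        = measure_pmf.expectation (Pi_pmf {..<m} undefined (\<lambda>_. \<nu>)) (\<lambda>Y. \<Sum>i<m. h (Y i))"
      by (simp add: iid_mset_def leaf_sum_def multiset.map_comp o_def sum_unfold_sum_mset)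
    also have "\<dots> = (\<Sum>i<m. measure_pmf.expectation (Pi_pmf {..<m} undefined (\<lambda>_. \<nu>)) (\<lambda>Y. h (Y i)))"
      by (rule Bochner_Integration.integral_sum) (rule integrable_measure_pmf_finite[OF fin])
    also have "\<dots> = (\<Sum>i<m. \<Sum>x\<in>UNIV. h x * pmf \<nu> x)"
    proof (rule sum.cong[OF refl])
      fix i assume i: "i \<in> {..<m}"
      have "measure_pmf.expectation (Pi_pmf {..<m} undefined (\<lambda>_. \<nu>)) (\<lambda>Y. h (Y i))
          = measure_pmf.expectation (map_pmf (\<lambda>Y. Y i) (Pi_pmf {..<m} undefined (\<lambda>_. \<nu>))) h" by simp
      also have "map_pmf (\<lambda>Y. Y i) (Pi_pmf {..<m} undefined (\<lambda>_. \<nu>)) = \<nu>"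
        using i by (subst Pi_pmf_component) auto
      also have "measure_pmf.expectation \<nu> h = (\<Sum>x\<in>UNIV. h x * pmf \<nu> x)"
        by (rule integral_measure_pmf_real) auto
      finally show "measure_pmf.expectation (Pi_pmf {..<m} undefined (\<lambda>_. \<nu>)) (\<lambda>Y. h (Y i))
          = (\<Sum>x\<in>UNIV. h x * pmf \<nu> x)" .
    qed
    finally show ?thesis by simp
  qed
  have "measure_pmf.expectation (true_law \<alpha> \<nu>) (leaf_sum h)
      = measure_pmf.expectation (bind_pmf (pair_pmf \<alpha> \<nu>) (\<lambda>(m, x). map_pmf (Star x) (iid_mset \<nu> m))) (leaf_sum h)"
    by (simp add: true_law_def star_law_def iid_mset_def pmf.map_comp o_def)
  also have "\<dots> = (\<Sum>p\<in>{0..M} \<times> UNIV. pmf (pair_pmf \<alpha> \<nu>) p *\<^sub>R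
      measure_pmf.expectation (case p of (m, x) \<Rightarrow> map_pmf (Star x) (iid_mset \<nu> m)) (leaf_sum h))"
  proof (rule pmf_expectation_bind)
    fix p :: "nat \<times> 'x"
    show "finite (set_pmf (case p of (m, x) \<Rightarrow> map_pmf (Star x) (iid_mset \<nu> m)))"
      by (auto simp: iid_mset_def set_Pi_pmf case_prod_beta intro!: finite_imageI finite_PiE_dflt)
  qed (use \<alpha> in auto)
  also have "\<dots> = (\<Sum>(m, x)\<in>{0..M} \<times> UNIV. pmf \<alpha> m * pmf \<nu> x * (real m * (\<Sum>x\<in>UNIV. h x * pmf \<nu> x)))"
    by (intro sum.cong refl) (auto simp: pmf_pair e)
  also have "\<dots> = (\<Sum>m=0..M. \<Sum>x\<in>UNIV. pmf \<alpha> m * pmf \<nu> x * (real m * (\<Sum>x\<in>UNIV. h x * pmf \<nu> x)))"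
    by (rule sum.cartesian_product[symmetric])
  also have "\<dots> = (\<Sum>m=0..M. (\<Sum>x\<in>UNIV. pmf \<nu> x) * (real m * pmf \<alpha> m * (\<Sum>x\<in>UNIV. h x * pmf \<nu> x)))"
    unfolding sum_distrib_right by (intro sum.cong refl) (simp add: mult_ac)
  also have "(\<Sum>x\<in>UNIV. pmf \<nu> x) = 1" by (rule sum_pmf_eq_1) auto
  finally show ?thesis by (simp add: sum_distrib_right)
qed

text \<open>The sum of all absolute deviations dominates each of them and tends to 0 exponentially
  fast by \<open>exp_conv_sum\<close>. The vanishing second sum in \<open>?Z\<close> is the limit in
  the form in which \<open>exp_conv_sum\<close> delivers it, and the covering set is listed twice
  because \<open>exp_rate_shrink\<close> takes two.\<close>

lemma exp_conv_finite_union: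
  assumes S: "finite S" and Y: "\<And>\<sigma>. \<sigma> \<in> S \<Longrightarrow> exp_conv P (Y \<sigma>) (y \<sigma>)" and \<epsilon>: "0 < \<epsilon>"
    and A: "\<forall>\<^sub>F n in sequentially. A n \<inter> set_pmf (P n) \<subseteq> {\<omega>. \<exists>\<sigma>\<in>S. \<epsilon> \<le> \<bar>Y \<sigma> n \<omega> - y \<sigma>\<bar>}"
  shows "\<exists>r>0. \<forall>\<^sub>F n in sequentially. pr (P n) (A n) \<le> exp (- r * real n)"
proof -
  let ?Z = "\<lambda>n \<omega>. \<bar>(\<Sum>\<sigma>\<in>S. \<bar>Y \<sigma> n \<omega> - y \<sigma>\<bar>) - (\<Sum>\<sigma>\<in>S. \<bar>y \<sigma> - y \<sigma>\<bar>)\<bar>"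
  have 1: "exp_conv P (\<lambda>n \<omega>. \<bar>Y \<sigma> n \<omega> - y \<sigma>\<bar>) \<bar>y \<sigma> - y \<sigma>\<bar>" if "\<sigma> \<in> S" for \<sigma>
    by (rule exp_conv_combine[OF Y[OF that] Y[OF that], where f = "\<lambda>a b. \<bar>a - y \<sigma>\<bar>"])
      (auto intro!: continuous_intros)
  have "exp_conv P (\<lambda>n \<omega>. \<Sum>\<sigma>\<in>S. \<bar>Y \<sigma> n \<omega> - y \<sigma>\<bar>) (\<Sum>\<sigma>\<in>S. \<bar>y \<sigma> - y \<sigma>\<bar>)"
    by (rule exp_conv_sum[OF S 1])
  then obtain r where r: "0 < r" "\<forall>\<^sub>F n in sequentially.
      pr (P n) {\<omega>. \<epsilon> \<le> ?Z n \<omega>} \<le> exp (- r * real n)"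
    using \<epsilon> unfolding exp_conv_def by blast
  show ?thesis
  proof (rule exp_rate_shrink[OF _ r r])
    show "\<forall>\<^sub>F n in sequentially. A n \<inter> set_pmf (P n)
      \<subseteq> {\<omega>. \<epsilon> \<le> ?Z n \<omega>}
      \<union> {\<omega>. \<epsilon> \<le> ?Z n \<omega>}"
      using A
    proof eventually_elim
      case (elim n)
      show ?case
      proof
        fix \<omega> assume "\<omega> \<in> A n \<inter> set_pmf (P n)"
        then obtain \<sigma> where \<sigma>: "\<sigma> \<in> S" "\<epsilon> \<le> \<bar>Y \<sigma> n \<omega> - y \<sigma>\<bar>" using elim by blast
        have "\<bar>Y \<sigma> n \<omega> - y \<sigma>\<bar> \<le> (\<Sum>\<sigma>\<in>S. \<bar>Y \<sigma> n \<omega> - y \<sigma>\<bar>)"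
          by (rule member_le_sum[OF \<sigma>(1)]) (auto simp: S)
        with \<sigma>(2) show "\<omega> \<in> {\<omega>. \<epsilon> \<le> ?Z n \<omega>}
          \<union> {\<omega>. \<epsilon> \<le> ?Z n \<omega>}"
          by simp
      qed
    qed
  qed
qed

section \<open>Concentration of the empirical measure under the tilted law\<close>

context cm_model
begin

definition mean :: "nat \<Rightarrow> nat set set \<times> (nat \<Rightarrow> 'x) \<Rightarrow> real" where
  "mean n \<omega> = measure_pmf.expectation (nbhd_empirical n \<omega>) (leaf_sum h)"

text \<open>The limit of \<open>mean\<close> under the tilt \<open>s\<close>; the second equation of
  \<open>tilted_solution\<close> becomes \<open>level t = c\<close>.\<close>

definition level :: "real \<Rightarrow> real" where
  "level s = (\<Sum>i=0..M. real i * pmf \<alpha> i * tilted_mean \<nu> h (s * real i))"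

abbreviation \<mu> :: "real \<Rightarrow> 'x star pmf" where
  "\<mu> s \<equiv> mu_star M \<kappa> (\<gamma> s)"

lemma pmf_mu: "pmf (\<mu> s) (Star x C) = pmf (\<gamma> s) (size C, x) * pmf (iid_mset (size_biased M \<kappa> (\<gamma> s)) (size C)) C"
  by (simp add: mu_star_def pmf_star_law)

lemma set_mu: "set_pmf (\<mu> s) \<subseteq> stars M"
proof
  fix \<sigma> assume "\<sigma> \<in> set_pmf (\<mu> s)"
  then show "\<sigma> \<in> stars M"
    using set_tilted_joint by (cases \<sigma>) (fastforce simp: set_pmf_iff pmf_mu stars_def)
qed

lemma exp_conv_star:
  assumes s: "0 < s"
  shows "exp_conv (P s) (\<lambda>n \<omega>. pmf (nbhd_empirical n \<omega>) \<sigma>) (pmf (\<mu> s) \<sigma>)"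
proof (cases \<sigma>)
  case (Star x C)
  have "exp_conv (P s) (\<lambda>n \<omega>. type_count n (snd \<omega>) (size C) x C (fst \<omega>) / real n) (pmf (\<mu> s) \<sigma>)"
    using exp_conv_count[OF s, of "size C" x C] by (simp add: Star pmf_mu)
  then show ?thesis
  proof (rule exp_conv_cong)
    show "\<forall>\<^sub>F n in sequentially. \<forall>\<omega>\<in>set_pmf (P s n). pmf (nbhd_empirical n \<omega>) \<sigma>
        = type_count n (snd \<omega>) (size C) x C (fst \<omega>) / real n"
      using eventually_cm_graphs
    proof eventually_elim
      case (elim n)
      show ?case
      proof
        fix \<omega> assume "\<omega> \<in> set_pmf (P s n)"
        then have "fst \<omega> \<in> simple_graphs n"
          using subsetD[OF set_tilted_CM, of n "\<alpha>n n" \<omega> \<nu> h s] cm_graphs_subset[of n "\<alpha>n n"] elim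
          by (auto simp: mem_Times_iff)
        then show "pmf (nbhd_empirical n \<omega>) \<sigma> = type_count n (snd \<omega>) (size C) x C (fst \<omega>) / real n"
          using pmf_nbhd_empirical[of "fst \<omega>" n "snd \<omega>" x C] elim by (simp add: Star)
      qed
    qed
  qed
qed

lemma exp_rate_outside_nbhd:
  assumes s: "0 < s" and A: "openin weak_topology A" "\<mu> s \<in> A"
  shows "\<exists>r>0. \<forall>\<^sub>F n in sequentially. pr (P s n) {\<omega>. nbhd_empirical n \<omega> \<notin> A} \<le> exp (- r * real n)"
proof -
  obtain \<epsilon> where \<epsilon>: "\<epsilon> > 0"
    "\<And>p. set_pmf p \<subseteq> stars M \<Longrightarrow> \<forall>\<sigma>\<in>stars M. \<bar>pmf p \<sigma> - pmf (\<mu> s) \<sigma>\<bar> < \<epsilon> \<Longrightarrow> p \<in> A"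
    using openin_weak_topology_nbhd[OF A finite_stars set_mu] by blast
  show ?thesis
  proof (rule exp_conv_finite_union[OF finite_stars exp_conv_star[OF s] \<epsilon>(1)])
    show "\<forall>\<^sub>F n in sequentially. {\<omega>. nbhd_empirical n \<omega> \<notin> A} \<inter> set_pmf (P s n)
        \<subseteq> {\<omega>. \<exists>\<sigma>\<in>stars M. \<epsilon> \<le> \<bar>pmf (nbhd_empirical n \<omega>) \<sigma> - pmf (\<mu> s) \<sigma>\<bar>}"
      using eventually_cm_graphs
    proof eventually_elim
      case (elim n)
      show ?case
      proof
        fix \<omega> assume \<omega>: "\<omega> \<in> {\<omega>. nbhd_empirical n \<omega> \<notin> A} \<inter> set_pmf (P s n)"
        then have "fst \<omega> \<in> cm_graphs n (\<alpha>n n)" using set_tilted_CM[of n "\<alpha>n n" \<nu> h s] elim by auto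
        then have "set_pmf (nbhd_empirical n \<omega>) \<subseteq> stars M"
          using set_nbhd_empirical[of "fst \<omega>" n "\<alpha>n n" M "snd \<omega>"] alphan_support elim by simp
        then show "\<omega> \<in> {\<omega>. \<exists>\<sigma>\<in>stars M. \<epsilon> \<le> \<bar>pmf (nbhd_empirical n \<omega>) \<sigma> - pmf (\<mu> s) \<sigma>\<bar>}"
          using \<epsilon>(2)[of "nbhd_empirical n \<omega>"] \<omega> by (auto simp: not_le[symmetric])
      qed
    qed
  qed
qed

lemma level_eq: "level s = (\<Sum>i=0..M. \<Sum>y\<in>UNIV. real i * h y * pmf (\<gamma> s) (i, y))"
  unfolding level_def tilted_mean_eq pmf_tilted_joint sum_distrib_left
  by (intro sum.cong refl) (simp add: mult_ac)

text \<open>Regrouped by degree and mark, the mean is a fixed linear combination of counts with the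
  empty multiset, so the concentration of the marks suffices here.\<close>

lemma exp_conv_mean: "exp_conv (P s) mean (level s)"
proof -
  let ?T = "\<lambda>n \<omega>. \<Sum>i=0..M. \<Sum>y\<in>UNIV. real i * h y * (type_count n (snd \<omega>) i y {#} (fst \<omega>) / real n)"
  have "exp_conv (P s) ?T (level s)"
    unfolding level_eq by (intro exp_conv_sum exp_conv_mult exp_conv_const exp_conv_type) auto
  then show ?thesis
  proof (rule exp_conv_cong)
    show "\<forall>\<^sub>F n in sequentially. \<forall>\<omega>\<in>set_pmf (P s n). mean n \<omega> = ?T n \<omega>"
      using eventually_cm_graphs
    proof eventually_elim
      case (elim n)
      show ?case
      proof
        fix \<omega> assume "\<omega> \<in> set_pmf (P s n)"
        then obtain E X where \<omega>: "\<omega> = (E, X)" "E \<in> cm_graphs n (\<alpha>n n)"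
          using set_tilted_CM[of n "\<alpha>n n" \<nu> h s] elim by (cases \<omega>) auto
        then have sg: "E \<in> simple_graphs n" using cm_graphs_subset by blast
        have deg: "deg E v \<le> M" for v by (rule cm_graphs_degree_le[OF \<omega>(2) alphan_support]) (use elim in simp)
        have "(\<Sum>v\<in>{1..n}. real (deg E v) * h (X v))
            = (\<Sum>v\<in>{1..n}. \<Sum>y\<in>UNIV. h y * (if X v = y then real (deg E v) else 0))"
          by (intro sum.cong refl) (simp add: if_distrib[of "\<lambda>z. _ * z"] mult.commute cong: if_cong)
        also have "\<dots> = (\<Sum>y\<in>UNIV. \<Sum>v\<in>{1..n}. h y * (if X v = y then real (deg E v) else 0))"
          by (rule sum.swap)
        also have "\<dots> = (\<Sum>y\<in>UNIV. \<Sum>i=0..M. real i * h y * type_count n X i y {#} E)"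
          unfolding sum_distrib_left[symmetric] sum_degree_of_mark[OF sg deg]
          by (simp add: sum_distrib_left mult_ac)
        also have "\<dots> = (\<Sum>i=0..M. \<Sum>y\<in>UNIV. real i * h y * type_count n X i y {#} E)"
          by (rule sum.swap)
        finally show "mean n \<omega> = ?T n \<omega>"
          using elim by (simp add: mean_def \<omega>(1) expectation_nbhd_empirical[OF sg] sum_divide_distrib)
      qed
    qed
  qed
qed

end

section \<open>The level set probabilities\<close>

context cm_model
begin

definition log_mgf :: "real \<Rightarrow> real" where
  "log_mgf s = (\<Sum>i=0..M. pmf \<alpha> i * ln (partition_sum \<nu> h (s * real i)))"

definition log_mgf_n :: "nat \<Rightarrow> real \<Rightarrow> real" where
  "log_mgf_n n s = (\<Sum>i=0..M. pmf (\<alpha>n n) i * ln (partition_sum \<nu> h (s * real i)))"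

lemma log_mgf_n_tendsto: "(\<lambda>n. log_mgf_n n s) \<longlonglongrightarrow> log_mgf s"
  unfolding log_mgf_n_def log_mgf_def by (intro tendsto_intros alphan_tendsto)

lemma continuous_level: "continuous_on A level"
  unfolding level_def by (intro continuous_intros)

lemma continuous_log_mgf: "continuous_on A log_mgf"
  unfolding log_mgf_def
  by (intro continuous_intros) (auto simp: less_imp_neq[OF partition_sum_pos, symmetric])

text \<open>The tilt multiplies the mark probabilities by \<open>exp (s * deg E v * h (X v))\<close>
  and divides by the partition sums. The product of the latter depends on the degrees only and is
  constant over the model by \<open>sum_degree_function\<close>, so the density is a function of
  \<open>mean\<close> alone.\<close>

lemma pmf_untilt:
  assumes n: "n \<ge> 1" and ne: "cm_graphs n (\<alpha>n n) \<noteq> {}"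
  shows "pmf (P 0 n) \<omega> = pmf (P s n) \<omega> * exp (- (real n * (s * mean n \<omega> - log_mgf_n n s)))"
proof (cases "\<omega> \<in> cm_graphs n (\<alpha>n n) \<times> markings n")
  case True
  obtain E X where \<omega>: "\<omega> = (E, X)" by (cases \<omega>)
  have E: "E \<in> cm_graphs n (\<alpha>n n)" and X: "X \<in> markings n" using True \<omega> by auto
  have sg: "E \<in> simple_graphs n" using E cm_graphs_subset by blast
  let ?d = "\<lambda>v. real (deg E v)"
  have m: "real n * mean n \<omega> = (\<Sum>v\<in>{1..n}. ?d v * h (X v))"
    using n by (simp add: mean_def \<omega> expectation_nbhd_empirical[OF sg])
  have Z: "real n * log_mgf_n n s = (\<Sum>v\<in>{1..n}. ln (partition_sum \<nu> h (s * ?d v)))"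
    using sum_degree_function[OF E alphan_support[OF n], of "\<lambda>i. ln (partition_sum \<nu> h (s * real i))"] n
    by (simp add: log_mgf_n_def)
  have "(\<Prod>v\<in>{1..n}. pmf (tilt \<nu> h (s * ?d v)) (X v))
      = (\<Prod>v\<in>{1..n}. pmf \<nu> (X v) * exp (s * (?d v * h (X v)) - ln (partition_sum \<nu> h (s * ?d v))))"
    by (intro prod.cong refl)
      (simp add: pmf_tilt exp_diff exp_ln[OF partition_sum_pos] mult.assoc)
  also have "\<dots> = (\<Prod>v\<in>{1..n}. pmf \<nu> (X v))
      * exp (\<Sum>v\<in>{1..n}. s * (?d v * h (X v)) - ln (partition_sum \<nu> h (s * ?d v)))"
    by (simp add: prod.distrib exp_sum)
  also have "(\<Sum>v\<in>{1..n}. s * (?d v * h (X v)) - ln (partition_sum \<nu> h (s * ?d v)))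
      = real n * (s * mean n \<omega> - log_mgf_n n s)"
    using m Z by (simp add: sum_subtractf right_diff_distrib mult.left_commute flip: sum_distrib_left)
  finally have "(\<Prod>v\<in>{1..n}. pmf (tilt \<nu> h (s * ?d v)) (X v)) * exp (- (real n * (s * mean n \<omega> - log_mgf_n n s)))
      = (\<Prod>v\<in>{1..n}. pmf \<nu> (X v))"
    by (simp add: mult.assoc flip: exp_add)
  then show ?thesis using E X by (simp add: \<omega> pmf_tilted_CM[OF ne])
next
  case False
  then show ?thesis by (cases \<omega>) (auto simp: pmf_tilted_CM[OF ne])
qed

text \<open>For \<open>s \<ge> 0\<close> the untilting factor is largest at the smallest admissible
  mean \<open>b\<close>. With \<open>B = UNIV\<close> this bounds the probability of the condition,
  with the event outside \<open>A\<close> the numerator of the conditional probability.\<close>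

lemma prob_mean_ge_le:
  assumes n: "n \<ge> 1" and ne: "cm_graphs n (\<alpha>n n) \<noteq> {}" and s: "0 \<le> s"
  shows "pr (P 0 n) {\<omega>. \<omega> \<in> B \<and> b \<le> mean n \<omega>}
    \<le> exp (- (real n * (s * b - log_mgf_n n s))) * pr (P s n) B"
proof -
  let ?S = "cm_graphs n (\<alpha>n n) \<times> markings n"
  let ?c = "exp (- (real n * (s * b - log_mgf_n n s)))"
  have "pr (P 0 n) {\<omega>. \<omega> \<in> B \<and> b \<le> mean n \<omega>}
      = (\<Sum>\<omega>\<in>{\<omega>. \<omega> \<in> B \<and> b \<le> mean n \<omega>} \<inter> ?S. pmf (P 0 n) \<omega>)" by (rule prob_tilted_CM[OF ne])
  also have "\<dots> \<le> (\<Sum>\<omega>\<in>{\<omega>. \<omega> \<in> B \<and> b \<le> mean n \<omega>} \<inter> ?S. ?c * pmf (P s n) \<omega>)"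
  proof (rule sum_mono)
    fix \<omega> assume "\<omega> \<in> {\<omega>. \<omega> \<in> B \<and> b \<le> mean n \<omega>} \<inter> ?S"
    then have "real n * (s * b - log_mgf_n n s) \<le> real n * (s * mean n \<omega> - log_mgf_n n s)"
      using s by (auto intro!: mult_left_mono)
    then have "pmf (P s n) \<omega> * exp (- (real n * (s * mean n \<omega> - log_mgf_n n s))) \<le> pmf (P s n) \<omega> * ?c"
      by (intro mult_left_mono) auto
    then show "pmf (P 0 n) \<omega> \<le> ?c * pmf (P s n) \<omega>"
      unfolding pmf_untilt[OF n ne, of \<omega> s] by (simp add: mult.commute)
  qed
  also have "\<dots> \<le> (\<Sum>\<omega>\<in>B \<inter> ?S. ?c * pmf (P s n) \<omega>)"
    by (rule sum_mono2) (auto simp: finite_cm_graphs finite_markings)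
  also have "\<dots> = ?c * pr (P s n) B"
    unfolding prob_tilted_CM[OF ne] sum_distrib_left ..
  finally show ?thesis .
qed

text \<open>The untilting factor decreases in the mean, so a lower bound needs the cut at
  \<open>b'\<close>.\<close>

lemma prob_mean_ge_ge:
  assumes n: "n \<ge> 1" and ne: "cm_graphs n (\<alpha>n n) \<noteq> {}" and s: "0 \<le> s"
  shows "exp (- (real n * (s * b' - log_mgf_n n s))) * pr (P s n) {\<omega>. b \<le> mean n \<omega> \<and> mean n \<omega> \<le> b'}
    \<le> pr (P 0 n) {\<omega>. b \<le> mean n \<omega>}"
proof -
  let ?S = "cm_graphs n (\<alpha>n n) \<times> markings n"
  let ?c = "exp (- (real n * (s * b' - log_mgf_n n s)))"
  have "?c * pr (P s n) {\<omega>. b \<le> mean n \<omega> \<and> mean n \<omega> \<le> b'}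
      = (\<Sum>\<omega>\<in>{\<omega>. b \<le> mean n \<omega> \<and> mean n \<omega> \<le> b'} \<inter> ?S. ?c * pmf (P s n) \<omega>)"
    unfolding prob_tilted_CM[OF ne] sum_distrib_left ..
  also have "\<dots> \<le> (\<Sum>\<omega>\<in>{\<omega>. b \<le> mean n \<omega> \<and> mean n \<omega> \<le> b'} \<inter> ?S. pmf (P 0 n) \<omega>)"
  proof (rule sum_mono)
    fix \<omega> assume "\<omega> \<in> {\<omega>. b \<le> mean n \<omega> \<and> mean n \<omega> \<le> b'} \<inter> ?S"
    then have "real n * (s * mean n \<omega> - log_mgf_n n s) \<le> real n * (s * b' - log_mgf_n n s)"
      using s by (auto intro!: mult_left_mono)
    then have "pmf (P s n) \<omega> * ?c \<le> pmf (P s n) \<omega> * exp (- (real n * (s * mean n \<omega> - log_mgf_n n s)))"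
      by (intro mult_left_mono) auto
    then show "?c * pmf (P s n) \<omega> \<le> pmf (P 0 n) \<omega>"
      unfolding pmf_untilt[OF n ne, of \<omega> s] by (simp add: mult.commute)
  qed
  also have "\<dots> \<le> (\<Sum>\<omega>\<in>{\<omega>. b \<le> mean n \<omega>} \<inter> ?S. pmf (P 0 n) \<omega>)"
    by (rule sum_mono2) (auto simp: finite_cm_graphs finite_markings)
  also have "\<dots> = pr (P 0 n) {\<omega>. b \<le> mean n \<omega>}" by (rule prob_tilted_CM[OF ne, symmetric])
  finally show ?thesis .
qed

lemma level_0: "level 0 = measure_pmf.expectation (true_law \<alpha> \<nu>) (leaf_sum h)"
  unfolding expectation_true_law[OF alpha_support] level_def tilted_mean_eq
  by (simp add: sum_distrib_right)

lemma level_mono: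
  assumes "s \<le> t"
  shows "level s \<le> level t"
  unfolding level_def using assms by (intro sum_mono mult_left_mono tilted_mean_mono mult_right_mono) auto

lemma alpha_positive_degree: "\<exists>i\<in>{0..M}. 0 < real i * pmf \<alpha> i"
proof (rule ccontr)
  assume "\<not> ?thesis"
  then have "(\<Sum>i=0..M. real i * pmf \<alpha> i) \<le> 0" by (intro sum_nonpos) (auto simp: not_less)
  then show False using alpha_mean kappa_pos by simp
qed

lemma level_strict_mono:
  assumes "s < t" and xy: "x \<in> set_pmf \<nu>" "y \<in> set_pmf \<nu>" "h x \<noteq> h y"
  shows "level s < level t"
proof -
  obtain i where i: "i \<in> {0..M}" "0 < real i * pmf \<alpha> i" using alpha_positive_degree by blast
  then have "0 < real i" by (cases i) auto
  show ?thesis unfolding level_def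
  proof (rule sum_strict_mono_ex1)
    show "\<forall>i\<in>{0..M}. real i * pmf \<alpha> i * tilted_mean \<nu> h (s * real i)
        \<le> real i * pmf \<alpha> i * tilted_mean \<nu> h (t * real i)"
      using assms by (intro ballI mult_left_mono tilted_mean_mono mult_right_mono) auto
    show "\<exists>i\<in>{0..M}. real i * pmf \<alpha> i * tilted_mean \<nu> h (s * real i)
        < real i * pmf \<alpha> i * tilted_mean \<nu> h (t * real i)"
      using i assms \<open>0 < real i\<close> by (intro bexI[OF _ i(1)] mult_strict_left_mono tilted_mean_strict_mono) auto
  qed simp
qed

lemma level_constant:
  assumes "\<And>x y. x \<in> set_pmf \<nu> \<Longrightarrow> y \<in> set_pmf \<nu> \<Longrightarrow> h x = h y"
  shows "level s = level t"
proof -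
  obtain x0 where x0: "x0 \<in> set_pmf \<nu>" using set_pmf_not_empty[of \<nu>] by blast
  have "tilted_mean \<nu> h u = h x0" for u
  proof -
    have "(\<Sum>x\<in>UNIV. h x * (pmf \<nu> x * exp (u * h x))) = (\<Sum>x\<in>UNIV. h x0 * (pmf \<nu> x * exp (u * h x)))"
    proof (rule sum.cong[OF refl])
      fix x show "h x * (pmf \<nu> x * exp (u * h x)) = h x0 * (pmf \<nu> x * exp (u * h x))"
        using assms[OF _ x0, of x] by (cases "x \<in> set_pmf \<nu>") (auto simp: set_pmf_iff)
    qed
    then show ?thesis
      using partition_sum_pos[of \<nu> h u] unfolding tilted_mean_def
      by (simp add: partition_sum_def sum_distrib_left[symmetric])
  qed
  then show ?thesis by (simp add: level_def)
qed

text \<open>The assumption excludes an \<open>h\<close> that is constant on the support of \<nu>,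
  for which \<open>level\<close> would be constant. Strictness yields the uniqueness of the tilt and
  the convergence of inverse values.\<close>

lemma level_strict_mono':
  assumes "level 0 < level u" "s < t"
  shows "level s < level t"
proof -
  have "\<exists>x\<in>set_pmf \<nu>. \<exists>y\<in>set_pmf \<nu>. h x \<noteq> h y"
  proof (rule ccontr)
    assume "\<not> ?thesis"
    then have "level 0 = level u" by (intro level_constant) blast
    then show False using assms(1) by simp
  qed
  then obtain x y where "x \<in> set_pmf \<nu>" "y \<in> set_pmf \<nu>" "h x \<noteq> h y" by blast
  with assms(2) show ?thesis by (rule level_strict_mono)
qed

lemma level_at_top: "(level \<longlongrightarrow> \<kappa> * Max (h ` set_pmf \<nu>)) at_top"
proof -
  have "((\<lambda>s. real i * pmf \<alpha> i * tilted_mean \<nu> h (s * real i)) \<longlongrightarrow> real i * pmf \<alpha> i * Max (h ` set_pmf \<nu>)) at_top" for i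
  proof (cases "i = 0")
    case False
    then have "filterlim (\<lambda>s. s * real i) at_top at_top"
      by (subst mult.commute) (intro filterlim_tendsto_pos_mult_at_top[OF tendsto_const _ filterlim_ident], simp)
    then show ?thesis by (intro tendsto_intros filterlim_compose[OF tilted_mean_at_top])
  qed simp
  then have "(level \<longlongrightarrow> (\<Sum>i=0..M. real i * pmf \<alpha> i * Max (h ` set_pmf \<nu>))) at_top"
    unfolding level_def by (intro tendsto_sum)
  then show ?thesis by (simp add: alpha_mean flip: sum_distrib_right)
qed

lemma level_IVT:
  assumes b: "level 0 < b" "b < level t" and t: "0 < t"
  shows "\<exists>s. 0 < s \<and> s < t \<and> level s = b"
proof -
  obtain s where s: "0 \<le> s" "s \<le> t" "level s = b"
    using IVT'[of level 0 b t] b t continuous_level[of "{0..t}"] by auto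
  then have "s \<noteq> 0" "s \<noteq> t" using b by auto
  with s show ?thesis by (intro exI[of _ s]) auto
qed

text \<open>The formula determines the law from \<open>t\<close> on \<open>{0..M}\<close>, and both
  laws vanish elsewhere; what remains is one scalar equation.\<close>

lemma tilted_solution_iff:
  "tilted_solution M \<alpha> \<nu> h c \<gamma>' t \<longleftrightarrow> 0 < t \<and> \<gamma>' = \<gamma> t \<and> level t = c"
proof
  assume T: "tilted_solution M \<alpha> \<nu> h c \<gamma>' t"
  have "pmf \<gamma>' p = pmf (\<gamma> t) p" for p
  proof (cases p)
    case (Pair m x)
    show ?thesis
    proof (cases "m \<le> M")
      case True
      then show ?thesis using T
        by (simp add: Pair tilted_solution_def pmf_tilted_joint pmf_tilt partition_sum_def)
    next
      case False
      then have "p \<notin> set_pmf \<gamma>'" "p \<notin> set_pmf (\<gamma> t)"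
        using T set_tilted_joint[of t] by (auto simp: Pair tilted_solution_def)
      then show ?thesis by (simp add: set_pmf_iff)
    qed
  qed
  then have eq: "\<gamma>' = \<gamma> t" by (rule pmf_eqI)
  then show "0 < t \<and> \<gamma>' = \<gamma> t \<and> level t = c"
    using T unfolding eq tilted_solution_def level_eq by blast
next
  assume *: "0 < t \<and> \<gamma>' = \<gamma> t \<and> level t = c"
  then show "tilted_solution M \<alpha> \<nu> h c \<gamma>' t"
    using set_tilted_joint[of t] unfolding level_eq tilted_solution_def
    by (auto simp: pmf_tilted_joint pmf_tilt partition_sum_def)
qed

text \<open>\<open>level\<close> is continuous and increases from \<open>level 0\<close> to \<kappa>
  times the maximum of \<open>h\<close> over the support of \<nu>, which is why that maximum
  appears; existence is the intermediate value theorem.\<close>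

lemma ex1_tilted_solution:
  assumes c: "level 0 < c" "c < \<kappa> * Max (h ` set_pmf \<nu>)"
  shows "\<exists>!(\<gamma>', t). tilted_solution M \<alpha> \<nu> h c \<gamma>' t"
proof -
  have "\<forall>\<^sub>F t in at_top. c < level t \<and> 0 < t"
    using order_tendstoD(1)[OF level_at_top c(2)] eventually_gt_at_top[of 0] by eventually_elim simp
  then obtain u where u: "c < level u" "0 < u" by (auto simp: eventually_at_top_linorder)
  obtain t where t: "0 < t" "level t = c" using level_IVT[OF c(1) u] by blast
  show ?thesis
  proof (rule ex1I[of _ "(\<gamma> t, t)"])
    show "case (\<gamma> t, t) of (\<gamma>', t) \<Rightarrow> tilted_solution M \<alpha> \<nu> h c \<gamma>' t"
      using t by (simp add: tilted_solution_iff)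
    fix p assume "case p of (\<gamma>', t) \<Rightarrow> tilted_solution M \<alpha> \<nu> h c \<gamma>' t"
    then obtain t' where t': "p = (\<gamma> t', t')" "0 < t'" "level t' = c"
      by (auto simp: tilted_solution_iff)
    have "level 0 < level t" using c t by simp
    then have "t' = t"
      using level_strict_mono'[of t t t'] level_strict_mono'[of t t' t] t t' by (cases t t' rule: linorder_cases) auto
    then show "p = (\<gamma> t, t)" using t' by simp
  qed
qed

text \<open>The Legendre transform of \<open>log_mgf\<close> at \<open>level s\<close>:
  \<open>log_mgf\<close> is convex with derivative \<open>level\<close>.\<close>

definition rate :: "real \<Rightarrow> real" where
  "rate s = s * level s - log_mgf s"

lemma continuous_rate: "continuous_on A rate"
  unfolding rate_def by (intro continuous_intros continuous_level continuous_log_mgf)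

text \<open>Under the tilt \<open>s\<close> the mean concentrates exactly at the threshold, which
  decides nothing about the event. The lower bound therefore tilts by some \<open>u > s\<close>,
  moving the mean into its interior; the upper bound is \<open>prob_mean_ge_le\<close> with the tilt
  \<open>s\<close> itself.\<close>

lemma log_prob_mean_ge:
  assumes s: "0 < s" and lv: "level 0 < level s"
  shows "\<forall>\<^sub>F n in sequentially. 0 < pr (P 0 n) {\<omega>. level s \<le> mean n \<omega>}"
    and "(\<lambda>n. ln (pr (P 0 n) {\<omega>. level s \<le> mean n \<omega>}) / real n) \<longlonglongrightarrow> - rate s"
proof -
  let ?p = "\<lambda>n. pr (P 0 n) {\<omega>. level s \<le> mean n \<omega>}"
  have lower: "\<forall>\<^sub>F n in sequentially. 0 < ?p n \<and> - rate s - \<eta> \<le> ln (?p n) / real n" if \<eta>: "0 < \<eta>" for \<eta>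
  proof -
    \<comment> \<open>\<open>F u\<close> is the exponential cost of the tilt \<open>u\<close> with
      the window ending at \<open>level u + (u - s)\<close>; the summand \<open>u - s\<close> puts
      \<open>level u\<close> strictly inside. Since \<open>F s = rate s\<close>, continuity makes
      the extra cost small for \<open>u\<close> near \<open>s\<close>.\<close>
    define F where "F u = u * (level u + (u - s)) - log_mgf u" for u
    have "continuous_on UNIV F" unfolding F_def
      by (intro continuous_intros continuous_level continuous_log_mgf)
    then have "isCont F s" by (simp add: continuous_on_eq_continuous_at)
    then obtain d where d: "d > 0" "\<And>u. \<bar>u - s\<bar> < d \<Longrightarrow> \<bar>F u - F s\<bar> < \<eta> / 2"
      using \<eta> unfolding continuous_at_eps_delta dist_real_def by (meson half_gt_zero)
    define u where "u = s + d / 2"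
    have u: "s < u" "0 \<le> u" using d(1) s by (auto simp: u_def)
    have "\<bar>F u - F s\<bar> < \<eta> / 2" using d(2)[of u] d(1) by (simp add: u_def)
    moreover have "F s = rate s" by (simp add: F_def rate_def)
    ultimately have Fu: "F u < rate s + \<eta> / 2" by linarith
    define b' where "b' = level u + (u - s)"
    have lu: "level s < level u" by (rule level_strict_mono'[OF lv u(1)])
    have "(\<lambda>n. pr (P u n) {\<omega>. level s \<le> mean n \<omega> \<and> mean n \<omega> \<le> b'}) \<longlonglongrightarrow> 1"
      by (rule exp_conv_eventually_in_interval[OF exp_conv_mean]) (use lu u in \<open>auto simp: b'_def\<close>)
    then have half: "\<forall>\<^sub>F n in sequentially. 1 / 2 < pr (P u n) {\<omega>. level s \<le> mean n \<omega> \<and> mean n \<omega> \<le> b'}"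
      by (rule order_tendstoD) simp
    have "(\<lambda>n. - (u * b' - log_mgf_n n u) + ln (1 / 2) / real n) \<longlonglongrightarrow> - (u * b' - log_mgf u) + 0"
      by (intro tendsto_intros log_mgf_n_tendsto real_tendsto_divide_at_top[OF tendsto_const] filterlim_real_sequentially)
    moreover have "- rate s - \<eta> < - (u * b' - log_mgf u) + 0"
      using Fu \<eta> by (simp add: F_def b'_def)
    ultimately have "\<forall>\<^sub>F n in sequentially. - rate s - \<eta> < - (u * b' - log_mgf_n n u) + ln (1 / 2) / real n"
      by (rule order_tendstoD)
    with half eventually_cm_graphs show ?thesis
    proof eventually_elim
      case (elim n)
      let ?q = "pr (P u n) {\<omega>. level s \<le> mean n \<omega> \<and> mean n \<omega> \<le> b'}"
      let ?e = "- (real n * (u * b' - log_mgf_n n u))"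
      have "exp ?e * (1 / 2) \<le> exp ?e * ?q" using elim by (intro mult_left_mono) auto
      also have "\<dots> \<le> ?p n" by (rule prob_mean_ge_ge) (use elim u in auto)
      finally have le: "exp ?e * (1 / 2) \<le> ?p n" .
      moreover have "0 < exp ?e * (1 / 2 :: real)" by simp
      ultimately have pos: "0 < ?p n" by (rule less_le_trans[rotated])
      have "ln (exp ?e * (1 / 2)) \<le> ln (?p n)" using le by (intro ln_mono) auto
      moreover have "ln (exp ?e * (1 / 2)) = ?e + ln (1 / 2)" by (subst ln_mult) auto
      ultimately have "?e + ln (1 / 2) \<le> ln (?p n)" by linarith
      then have "(?e + ln (1 / 2)) / real n \<le> ln (?p n) / real n" by (rule divide_right_mono) simp
      moreover have "(?e + ln (1 / 2)) / real n = - (u * b' - log_mgf_n n u) + ln (1 / 2) / real n"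
      proof -
        have "(- (real n * x) + y) / real n = - x + y / real n" for x y
          using elim by (simp add: field_simps)
        then show ?thesis .
      qed
      ultimately have "- rate s - \<eta> \<le> ln (?p n) / real n" using elim by linarith
      with pos show ?case by blast
    qed
  qed
  show pos: "\<forall>\<^sub>F n in sequentially. 0 < ?p n" using lower[of 1] by (simp add: eventually_conj_iff)
  have upper: "\<forall>\<^sub>F n in sequentially. ln (?p n) / real n \<le> - (s * level s - log_mgf_n n s)"
    using pos eventually_cm_graphs
  proof eventually_elim
    case (elim n)
    have "?p n \<le> exp (- (real n * (s * level s - log_mgf_n n s)))"
      using prob_mean_ge_le[of n s UNIV "level s"] elim s by simp
    then have "ln (?p n) \<le> - (real n * (s * level s - log_mgf_n n s))"
      using elim by (metis ln_exp ln_mono)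
    then have "ln (?p n) \<le> - (s * level s - log_mgf_n n s) * real n" by (simp add: algebra_simps)
    then show ?case by (subst pos_divide_le_eq) (use elim in auto)
  qed
  show "(\<lambda>n. ln (?p n) / real n) \<longlonglongrightarrow> - rate s"
  proof (rule order_tendstoI)
    fix a assume a: "- rate s < a"
    have "(\<lambda>n. - (s * level s - log_mgf_n n s)) \<longlonglongrightarrow> - rate s"
      unfolding rate_def by (intro tendsto_intros log_mgf_n_tendsto)
    then have "\<forall>\<^sub>F n in sequentially. - (s * level s - log_mgf_n n s) < a" using a by (rule order_tendstoD)
    with upper show "\<forall>\<^sub>F n in sequentially. ln (?p n) / real n < a" by eventually_elim linarith
  next
    fix a assume a: "a < - rate s"
    have "\<forall>\<^sub>F n in sequentially. 0 < ?p n \<and> - rate s - (- rate s - a) / 2 \<le> ln (?p n) / real n"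
      by (rule lower) (use a in simp)
    then show "\<forall>\<^sub>F n in sequentially. a < ln (?p n) / real n"
    proof eventually_elim
      case (elim n)
      have "a < - rate s - (- rate s - a) / 2" using a by (simp add: field_simps)
      then show ?case using elim by linarith
    qed
  qed
qed

text \<open>The gain \<open>r\<close> does not depend on \<open>b\<close>, so one tilt serves all
  levels near \<open>level s\<close>. Half of the original rate is spent on replacing
  \<open>log_mgf_n n s\<close> by its limit.\<close>

lemma prob_outside_nbhd_le:
  assumes s: "0 < s" and A: "openin weak_topology A" "\<mu> s \<in> A"
  shows "\<exists>r>0. \<forall>\<^sub>F n in sequentially. \<forall>b.
    pr (P 0 n) {\<omega>. nbhd_empirical n \<omega> \<notin> A \<and> b \<le> mean n \<omega>}
    \<le> exp (real n * (- (s * b - log_mgf s) - r))"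
proof -
  obtain r where r: "r > 0"
    "\<forall>\<^sub>F n in sequentially. pr (P s n) {\<omega>. nbhd_empirical n \<omega> \<notin> A} \<le> exp (- r * real n)"
    using exp_rate_outside_nbhd[OF s A] by blast
  have "\<forall>\<^sub>F n in sequentially. log_mgf_n n s < log_mgf s + r / 2"
    by (rule order_tendstoD(2)[OF log_mgf_n_tendsto]) (use r in simp)
  with r(2) eventually_cm_graphs
  have "\<forall>\<^sub>F n in sequentially. \<forall>b.
    pr (P 0 n) {\<omega>. nbhd_empirical n \<omega> \<notin> A \<and> b \<le> mean n \<omega>}
    \<le> exp (real n * (- (s * b - log_mgf s) - r / 2))"
  proof eventually_elim
    case (elim n)
    show ?case
    proof
      fix b
      have "pr (P 0 n) {\<omega>. nbhd_empirical n \<omega> \<notin> A \<and> b \<le> mean n \<omega>}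
          \<le> exp (- (real n * (s * b - log_mgf_n n s))) * pr (P s n) {\<omega>. nbhd_empirical n \<omega> \<notin> A}"
        using prob_mean_ge_le[of n s "{\<omega>. nbhd_empirical n \<omega> \<notin> A}" b] elim s by simp
      also have "\<dots> \<le> exp (- (real n * (s * b - log_mgf_n n s))) * exp (- r * real n)"
        using elim by (intro mult_left_mono) auto
      also have "\<dots> = exp (real n * (- (s * b - log_mgf_n n s) - r))"
        by (simp add: algebra_simps flip: exp_add)
      also have "\<dots> \<le> exp (real n * (- (s * b - log_mgf s) - r / 2))"
        unfolding exp_le_cancel_iff by (rule mult_left_mono) (use elim in auto)
      finally show "pr (P 0 n) {\<omega>. nbhd_empirical n \<omega> \<notin> A \<and> b \<le> mean n \<omega>}
          \<le> exp (real n * (- (s * b - log_mgf s) - r / 2))" .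
    qed
  qed
  then show ?thesis using r(1) by (intro exI[of _ "r / 2"]) auto
qed

text \<open>\<open>S \<delta>\<close> is the tilt belonging to the lowered level. The intermediate
  value theorem provides it, and the strict monotonicity of \<open>level\<close> forces its
  convergence.\<close>

lemma ex_inverse_level:
  assumes t: "0 < t" and lv: "level 0 < level t"
  obtains S where "\<And>\<delta>. 0 < \<delta> \<Longrightarrow> \<delta> < level t - level 0 \<Longrightarrow> 0 < S \<delta> \<and> S \<delta> < t \<and> level (S \<delta>) = level t - \<delta>"
    and "(S \<longlongrightarrow> t) (at_right 0)"
proof -
  have "\<exists>s. 0 < \<delta> \<longrightarrow> \<delta> < level t - level 0 \<longrightarrow> 0 < s \<and> s < t \<and> level s = level t - \<delta>" for \<delta>
    using level_IVT[of "level t - \<delta>" t] t by auto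
  then obtain S where S: "\<And>\<delta>. 0 < \<delta> \<Longrightarrow> \<delta> < level t - level 0 \<Longrightarrow> 0 < S \<delta> \<and> S \<delta> < t \<and> level (S \<delta>) = level t - \<delta>"
    by metis
  have ev: "\<forall>\<^sub>F \<delta> in at_right 0. 0 < \<delta> \<and> \<delta> < d" if "0 < d" for d :: real
    using eventually_at_right_real[OF that] by (simp add: eventually_mono greaterThanLessThan_iff)
  have "(S \<longlongrightarrow> t) (at_right 0)"
  proof (rule order_tendstoI)
    fix a assume a: "a < t"
    have "0 < level t - level a" using level_strict_mono'[OF lv a] by simp
    from ev[OF this] ev[of "level t - level 0"] lv have "\<forall>\<^sub>F \<delta> in at_right 0. 0 < \<delta> \<and> \<delta> < level t - level a \<and> \<delta> < level t - level 0"
      by (auto elim: eventually_elim2)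
    then show "\<forall>\<^sub>F \<delta> in at_right 0. a < S \<delta>"
    proof eventually_elim
      case (elim \<delta>)
      then have "level a < level (S \<delta>)" using S[of \<delta>] by simp
      then show ?case using level_mono[of "S \<delta>" a] by (meson not_le less_imp_le)
    qed
  next
    fix a assume a: "t < a"
    have "\<forall>\<^sub>F \<delta> in at_right 0. 0 < \<delta> \<and> \<delta> < level t - level 0" by (rule ev) (use lv in simp)
    then show "\<forall>\<^sub>F \<delta> in at_right 0. S \<delta> < a"
      by eventually_elim (use S a in fastforce)
  qed
  with S show ?thesis by (rule that)
qed

text \<open>Needed to let \<delta> tend to 0 in \<open>\<mu> (S \<delta>)\<close>. The domain is
  \<open>{0<..}\<close> because \<open>pmf_size_biased_tilted\<close> asks for a positive
  tilt.\<close>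

lemma continuous_pmf_mu: "continuous_on {0<..} (\<lambda>s. pmf (\<mu> s) \<sigma>)"
proof (cases \<sigma>)
  case (Star x C)
  have jc: "continuous_on {0<..} (\<lambda>s. pmf (\<gamma> s) (i, y))" for i y
    unfolding pmf_tilted_joint by (intro continuous_intros)
  have sc: "continuous_on {0<..} (\<lambda>s. pmf (size_biased M \<kappa> (\<gamma> s)) y)" for y
  proof -
    have "continuous_on {0<..} (\<lambda>s. (\<Sum>i=0..M. real i * pmf (\<gamma> s) (i, y)) / \<kappa>)"
      using kappa_pos by (intro continuous_intros jc) auto
    then show ?thesis
      by (rule continuous_on_eq) (use kappa_pos in \<open>simp add: pmf_size_biased_tilted[symmetric]\<close>)
  qed
  have "continuous_on {0<..} (\<lambda>s. pmf (iid_mset (size_biased M \<kappa> (\<gamma> s)) m) C)" for m C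
    by (induction m arbitrary: C) (auto simp: iid_mset_0 pmf_iid_mset_Suc intro!: continuous_intros sc)
  then show ?thesis unfolding Star pmf_mu by (intro continuous_intros jc)
qed

end

section \<open>Conditioning\<close>

text \<open>Monotonicity alone makes the outer limit in \<delta> exist as an extended real, possibly
  -\<infinity>.\<close>

lemma tendsto_Inf_at_right_0:
  fixes R :: "real \<Rightarrow> ereal"
  assumes mono: "\<And>x y. 0 < x \<Longrightarrow> x \<le> y \<Longrightarrow> R x \<le> R y"
  shows "(R \<longlongrightarrow> (INF x\<in>{0<..}. R x)) (at_right 0)"
proof (rule order_tendstoI)
  fix a assume a: "a < (INF x\<in>{0<..}. R x)"
  show "\<forall>\<^sub>F x in at_right 0. a < R x"
    using eventually_at_right_less[of "0 :: real"]
    by eventually_elim (rule less_le_trans[OF a], rule INF_lower, simp)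
next
  fix a assume "(INF x\<in>{0<..}. R x) < a"
  then obtain y where y: "0 < y" "R y < a" by (auto simp: INF_less_iff)
  show "\<forall>\<^sub>F x in at_right 0. R x < a"
    using eventually_at_right_real[OF y(1)]
  proof eventually_elim
    case (elim x)
    then have "R x \<le> R y" by (intro mono) auto
    then show ?case using y(2) by (rule le_less_trans)
  qed
qed

lemma ln_ereal_mono: "0 \<le> p \<Longrightarrow> p \<le> q \<Longrightarrow> ln_ereal p \<le> ln_ereal q"
  by (auto simp: ln_ereal_def)

lemma ln_ereal_exp: "ln_ereal (exp x) = ereal x"
  by (simp add: ln_ereal_def)

text \<open>The first summand is always finite, so the identity is meaningful also for
  \<open>p = 0\<close>, where both sides are -\<infinity>.\<close>

lemma ln_ereal_divide:
  assumes "0 \<le> p" "0 < q" "0 < n"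
  shows "ereal (1 / real n) * ln_ereal (p / q) = ereal (- (ln q / real n)) + ereal (1 / real n) * ln_ereal p"
proof (cases "p = 0")
  case True
  then show ?thesis using assms by (simp add: ln_ereal_def)
next
  case False
  then have "ln (p / q) = ln p - ln q" using assms by (simp add: ln_div)
  then show ?thesis using False assms by (simp add: ln_ereal_def diff_divide_distrib)
qed

context cm_model
begin

lemma mean_exceeds_iff: "mean_exceeds (leaf_sum h) b n \<omega> \<longleftrightarrow> b \<le> mean n \<omega>"
  by (simp add: mean_exceeds_def mean_def)

lemma cond_prob_eq:
  "\<P>(\<omega> in measure_pmf (marked_CM n (\<alpha>n n) \<nu>). nbhd_empirical n \<omega> \<notin> A \<bar> mean_exceeds (leaf_sum h) b n \<omega>)
    = pr (P 0 n) {\<omega>. nbhd_empirical n \<omega> \<notin> A \<and> b \<le> mean n \<omega>}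
      / pr (P 0 n) {\<omega>. b \<le> mean n \<omega>}"
  by (simp add: cond_prob_def mean_exceeds_iff marked_CM_eq_tilted[of n "\<alpha>n n" \<nu> h])

text \<open>The denominator has a true limit on the logarithmic scale, so the limsup of the quotient
  splits into \<open>rate (S \<delta>)\<close> and the limsup of the numerator. The former converges
  by continuity and the latter by monotonicity in \<delta>. The numerator is bounded with the fixed
  tilt \<open>t\<close>, at a loss of \<open>t * \<delta>\<close>.\<close>

lemma conditional_decay:
  assumes t: "0 < t" and lv: "level 0 < level t" and A: "openin weak_topology A" "\<mu> t \<in> A"
  shows "\<exists>l<0. ((\<lambda>\<delta>. limsup (\<lambda>n. ereal (1 / real n) *
      ln_ereal \<P>(\<omega> in measure_pmf (marked_CM n (\<alpha>n n) \<nu>).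
        nbhd_empirical n \<omega> \<notin> A \<bar> mean_exceeds (leaf_sum h) (level t - \<delta>) n \<omega>)))
    \<longlongrightarrow> l) (at_right (0::real))"
proof -
  let ?L = "\<lambda>\<delta>. limsup (\<lambda>n. ereal (1 / real n) *
      ln_ereal \<P>(\<omega> in measure_pmf (marked_CM n (\<alpha>n n) \<nu>).
        nbhd_empirical n \<omega> \<notin> A \<bar> mean_exceeds (leaf_sum h) (level t - \<delta>) n \<omega>))"
  obtain S where S: "\<And>\<delta>. 0 < \<delta> \<Longrightarrow> \<delta> < level t - level 0 \<Longrightarrow> 0 < S \<delta> \<and> S \<delta> < t \<and> level (S \<delta>) = level t - \<delta>"
    and S_lim: "(S \<longlongrightarrow> t) (at_right 0)" by (rule ex_inverse_level[OF t lv]) blast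
  obtain r where r: "r > 0" "\<forall>\<^sub>F n in sequentially. \<forall>b.
      pr (P 0 n) {\<omega>. nbhd_empirical n \<omega> \<notin> A \<and> b \<le> mean n \<omega>}
      \<le> exp (real n * (- (t * b - log_mgf t) - r))"
    using prob_outside_nbhd_le[OF t A] by blast
  define num where "num \<delta> n = pr (P 0 n) {\<omega>. nbhd_empirical n \<omega> \<notin> A \<and> level t - \<delta> \<le> mean n \<omega>}" for \<delta> n
  define den where "den \<delta> n = pr (P 0 n) {\<omega>. level t - \<delta> \<le> mean n \<omega>}" for \<delta> n
  define R where "R \<delta> = limsup (\<lambda>n. ereal (1 / real n) * ln_ereal (num \<delta> n))" for \<delta>
  have R_mono: "R x \<le> R y" if "x \<le> y" for x y
    unfolding R_def
  proof (intro Limsup_mono always_eventually allI ereal_mult_left_mono ln_ereal_mono)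
    fix n
    show "num x n \<le> num y n" unfolding num_def
      by (rule measure_pmf.finite_measure_mono) (use that in auto)
  qed (auto simp: num_def)
  then have R_lim: "(R \<longlongrightarrow> (INF x\<in>{0<..}. R x)) (at_right 0)" by (rule tendsto_Inf_at_right_0)
  have R_le: "R \<delta> \<le> ereal (- rate t + t * \<delta> - r)" for \<delta>
  proof -
    have "R \<delta> \<le> limsup (\<lambda>n. ereal (- rate t + t * \<delta> - r))"
      unfolding R_def
    proof (rule Limsup_mono)
      show "\<forall>\<^sub>F n in sequentially. ereal (1 / real n) * ln_ereal (num \<delta> n) \<le> ereal (- rate t + t * \<delta> - r)"
        using r(2) eventually_gt_at_top[of 0]
      proof eventually_elim
        case (elim n)
        have "num \<delta> n \<le> exp (real n * (- (t * (level t - \<delta>) - log_mgf t) - r))"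
          unfolding num_def using elim by blast
        then have "ln_ereal (num \<delta> n) \<le> ereal (real n * (- (t * (level t - \<delta>) - log_mgf t) - r))"
          unfolding ln_ereal_exp[symmetric] by (intro ln_ereal_mono) (auto simp: num_def)
        then have "ereal (1 / real n) * ln_ereal (num \<delta> n)
            \<le> ereal (1 / real n) * ereal (real n * (- (t * (level t - \<delta>) - log_mgf t) - r))"
          by (intro ereal_mult_left_mono) auto
        also have "\<dots> = ereal (- rate t + t * \<delta> - r)"
          using elim by (simp add: rate_def right_diff_distrib)
        finally show ?case .
      qed
    qed
    then show ?thesis by (simp add: Limsup_const)
  qed
  define J where "J \<delta> = rate (S \<delta>)" for \<delta>
  have "continuous_on UNIV rate" by (rule continuous_rate)
  then have "isCont rate t" by (simp add: continuous_on_eq_continuous_at)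
  then have J_lim: "(J \<longlongrightarrow> rate t) (at_right 0)"
    unfolding J_def by (rule isCont_tendsto_compose[OF _ S_lim])
  have eq: "?L \<delta> = ereal (J \<delta>) + R \<delta>"
    if \<delta>: "0 < \<delta>" "\<delta> < level t - level 0" for \<delta>
  proof -
    have s: "0 < S \<delta>" "level (S \<delta>) = level t - \<delta>" using S[OF \<delta>] by auto
    have lv': "level 0 < level (S \<delta>)" using s \<delta> by simp
    note den = log_prob_mean_ge[OF s(1) lv', unfolded s(2), folded den_def]
    have "limsup (\<lambda>n. ereal (1 / real n) * ln_ereal (num \<delta> n / den \<delta> n))
        = limsup (\<lambda>n. ereal (- (ln (den \<delta> n) / real n)) + ereal (1 / real n) * ln_ereal (num \<delta> n))"
    proof (rule Limsup_eq)
      show "\<forall>\<^sub>F n in sequentially. ereal (1 / real n) * ln_ereal (num \<delta> n / den \<delta> n)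
          = ereal (- (ln (den \<delta> n) / real n)) + ereal (1 / real n) * ln_ereal (num \<delta> n)"
        using den(1) eventually_gt_at_top[of 0]
        by eventually_elim (rule ln_ereal_divide, auto simp: num_def)
    qed
    also have "\<dots> = ereal (J \<delta>) + R \<delta>"
      unfolding R_def
    proof (rule ereal_limsup_lim_add)
      show "(\<lambda>n. ereal (- (ln (den \<delta> n) / real n))) \<longlonglongrightarrow> ereal (J \<delta>)"
        using tendsto_minus[OF den(2)] by (simp add: J_def)
    qed simp
    finally show ?thesis unfolding cond_prob_eq num_def den_def .
  qed
  let ?l = "ereal (rate t) + (INF x\<in>{0<..}. R x)"
  have "((\<lambda>\<delta>. ereal (J \<delta>) + R \<delta>) \<longlongrightarrow> ?l) (at_right 0)"
    by (rule tendsto_add_ereal_general2) (use J_lim R_lim in auto)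
  moreover have "\<forall>\<^sub>F \<delta> in at_right 0. ereal (J \<delta>) + R \<delta> = ?L \<delta>"
    using eventually_at_right_real[of 0 "level t - level 0"] lv
    by (auto simp: eq elim!: eventually_mono)
  ultimately have "(?L
    \<longlongrightarrow> ?l) (at_right (0::real))"
    by (rule Lim_transform_eventually)
  moreover have "?l < 0"
  proof -
    \<comment> \<open>At \<open>\<delta> = r / (2 * t)\<close> the loss \<open>t * \<delta>\<close>
      is exactly half of the gain \<open>r\<close>.\<close>
    have "(INF x\<in>{0<..}. R x) \<le> R (r / (2 * t))" using r(1) t by (intro INF_lower) auto
    also have "\<dots> \<le> ereal (- rate t + t * (r / (2 * t)) - r)" by (rule R_le)
    also have "- rate t + t * (r / (2 * t)) - r = - rate t - r / 2" using t by (simp add: field_simps)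
    finally have "?l \<le> ereal (rate t) + ereal (- rate t - r / 2)" by (rule add_left_mono)
    also have "\<dots> < 0" using r(1) by simp
    finally show ?thesis .
  qed
  ultimately show ?thesis by blast
qed

text \<open>Here the tilt belongs to the conditioning level itself, so no loss occurs; half of the
  gain \<open>r\<close> covers the error in the logarithm of the denominator.\<close>

lemma conditional_prob_tendsto_0:
  assumes s: "0 < s" and lv: "level 0 < level s" and A: "openin weak_topology A" "\<mu> s \<in> A"
  shows "(\<lambda>n. pr (P 0 n) {\<omega>. nbhd_empirical n \<omega> \<notin> A \<and> level s \<le> mean n \<omega>}
    / pr (P 0 n) {\<omega>. level s \<le> mean n \<omega>}) \<longlonglongrightarrow> 0"
proof -
  let ?num = "\<lambda>n. pr (P 0 n) {\<omega>. nbhd_empirical n \<omega> \<notin> A \<and> level s \<le> mean n \<omega>}"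
  let ?den = "\<lambda>n. pr (P 0 n) {\<omega>. level s \<le> mean n \<omega>}"
  obtain r where r: "r > 0" "\<forall>\<^sub>F n in sequentially. \<forall>b.
      pr (P 0 n) {\<omega>. nbhd_empirical n \<omega> \<notin> A \<and> b \<le> mean n \<omega>}
      \<le> exp (real n * (- (s * b - log_mgf s) - r))"
    using prob_outside_nbhd_le[OF s A] by blast
  note den = log_prob_mean_ge[OF s lv]
  have "\<forall>\<^sub>F n in sequentially. - rate s - r / 2 < ln (?den n) / real n"
    by (rule order_tendstoD(1)[OF den(2)]) (use r in simp)
  with r(2) den(1) eventually_gt_at_top[of 0]
  have "\<forall>\<^sub>F n in sequentially. ?num n / ?den n \<le> exp (- (r / 2) * real n)"
  proof eventually_elim
    case (elim n)
    have "real n * (- rate s - r / 2) \<le> ln (?den n)" using elim by (simp add: field_simps)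
    then have "exp (real n * (- rate s - r / 2)) \<le> ?den n" using elim by (metis exp_le_cancel_iff exp_ln)
    moreover have "?num n \<le> exp (real n * (- rate s - r))" using elim by (simp add: rate_def)
    ultimately have "?num n / ?den n \<le> exp (real n * (- rate s - r)) / exp (real n * (- rate s - r / 2))"
      by (intro frac_le) auto
    also have "\<dots> = exp (- (r / 2) * real n)" by (simp add: algebra_simps flip: exp_diff)
    finally show ?case .
  qed
  note le = this
  have lim: "(\<lambda>n. exp (- (r / 2) * real n)) \<longlonglongrightarrow> 0"
    by (intro filterlim_compose[OF exp_at_bot]
        filterlim_tendsto_neg_mult_at_bot[OF tendsto_const _ filterlim_real_sequentially]) (use r in auto)
  show ?thesis
    by (rule tendsto_sandwich[OF always_eventually le tendsto_const lim]) simp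
qed

text \<open>On the preimage \<open>A\<close> of a ball the test function is within
  \<open>e / 2\<close> of its value at \<open>\<mu> s\<close>. Outside \<open>A\<close> boundedness
  is enough, since the conditional probability of that event vanishes.\<close>

lemma weak_limit_cond_law:
  assumes s: "0 < s" and lv: "level 0 < level s"
  shows "weak_limit weak_topology (cond_law \<alpha>n \<nu> (leaf_sum h) (level s))
    (return (borel_of weak_topology) (\<mu> s)) sequentially"
  unfolding weak_limit_def
proof (intro allI impI, elim conjE)
  fix g :: "'x star pmf \<Rightarrow> real"
  assume g: "continuous_map weak_topology euclideanreal g" and bd: "bounded (g ` topspace weak_topology)"
  have gm [measurable]: "g \<in> borel_measurable (borel_of weak_topology)"
    by (rule continuous_map_measurable_borel_of[OF g])
  obtain K where K: "\<And>p. \<bar>g p\<bar> \<le> K" using bd by (auto simp: bounded_iff)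
  have K0: "0 \<le> K" using K[of undefined] by linarith
  define U where "U n = uniform_measure (measure_pmf (P 0 n)) {\<omega>. level s \<le> mean n \<omega>}" for n
  \<comment> \<open>The integral is pulled back to the conditioned marked graph, where every set is
    measurable.\<close>
  have int_eq: "(\<integral>y. g y \<partial>cond_law \<alpha>n \<nu> (leaf_sum h) (level s) n) = (\<integral>\<omega>. g (nbhd_empirical n \<omega>) \<partial>U n)" for n
    unfolding cond_law_def mean_exceeds_iff marked_CM_eq_tilted[of n "\<alpha>n n" \<nu> h] U_def
    by (rule integral_distr[OF _ gm]) (auto simp: measurable_def)
  have "(\<integral>y. g y \<partial>return (borel_of weak_topology) (\<mu> s)) = g (\<mu> s)"
    by (rule integral_return) (auto simp: gm)
  moreover have "(\<lambda>n. \<integral>\<omega>. g (nbhd_empirical n \<omega>) \<partial>U n) \<longlonglongrightarrow> g (\<mu> s)"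
  proof (rule tendstoI)
    fix e :: real assume e: "0 < e"
    define A where "A = {p \<in> topspace weak_topology. g p \<in> ball (g (\<mu> s)) (e / 2)}"
    have A: "openin weak_topology A" "\<mu> s \<in> A"
    proof -
      show "openin weak_topology A" unfolding A_def by (rule openin_continuous_map_preimage[OF g]) simp
      show "\<mu> s \<in> A" using e by (simp add: A_def)
    qed
    let ?num = "\<lambda>n. pr (P 0 n) {\<omega>. nbhd_empirical n \<omega> \<notin> A \<and> level s \<le> mean n \<omega>}"
    let ?den = "\<lambda>n. pr (P 0 n) {\<omega>. level s \<le> mean n \<omega>}"
    have "(\<lambda>n. e / 2 + 2 * K * (?num n / ?den n)) \<longlonglongrightarrow> e / 2 + 2 * K * 0"
      by (intro tendsto_intros conditional_prob_tendsto_0[OF s lv A])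
    then have "\<forall>\<^sub>F n in sequentially. e / 2 + 2 * K * (?num n / ?den n) < e"
      by (rule order_tendstoD) (use e in simp)
    with log_prob_mean_ge(1)[OF s lv] show "\<forall>\<^sub>F n in sequentially. dist (\<integral>\<omega>. g (nbhd_empirical n \<omega>) \<partial>U n) (g (\<mu> s)) < e"
    proof eventually_elim
      case (elim n)
      have em: "emeasure (measure_pmf (P 0 n)) {\<omega>. level s \<le> mean n \<omega>} \<noteq> 0"
        using elim(1) by (simp add: measure_pmf.emeasure_eq_measure)
      interpret U: prob_space "U n"
        unfolding U_def by (rule prob_space_uniform_measure[OF em]) simp
      have sets [simp]: "sets (U n) = UNIV" by (simp add: U_def)
      have sp [simp]: "space (U n) = UNIV" by (simp add: U_def)
      have meas: "f \<in> borel_measurable (U n)" for f :: "_ \<Rightarrow> real" by (simp add: measurable_def)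
      have intg: "integrable (U n) f" if "\<And>\<omega>. \<bar>f \<omega>\<bar> \<le> B" for f :: "_ \<Rightarrow> real" and B
        by (rule U.integrable_const_bound[of _ B]) (auto simp: that meas)
      have ind: "integrable (U n) (indicat_real {\<omega>. nbhd_empirical n \<omega> \<notin> A})"
        by (rule intg[of _ 1]) (auto simp: indicator_def)
      have "(\<integral>\<omega>. g (nbhd_empirical n \<omega>) \<partial>U n) - g (\<mu> s) = (\<integral>\<omega>. g (nbhd_empirical n \<omega>) - g (\<mu> s) \<partial>U n)"
        by (subst Bochner_Integration.integral_diff) (auto intro: intg[OF K] simp: U.prob_space[simplified])
      also have "\<bar>\<dots>\<bar> \<le> (\<integral>\<omega>. \<bar>g (nbhd_empirical n \<omega>) - g (\<mu> s)\<bar> \<partial>U n)"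
        by (rule integral_abs_bound)
      also have "\<dots> \<le> (\<integral>\<omega>. e / 2 + 2 * K * indicat_real {\<omega>. nbhd_empirical n \<omega> \<notin> A} \<omega> \<partial>U n)"
      proof (rule integral_mono)
        show "integrable (U n) (\<lambda>\<omega>. \<bar>g (nbhd_empirical n \<omega>) - g (\<mu> s)\<bar>)"
        proof (rule intg[of _ "2 * K"])
          fix \<omega> show "\<bar>\<bar>g (nbhd_empirical n \<omega>) - g (\<mu> s)\<bar>\<bar> \<le> 2 * K"
            using K[of "nbhd_empirical n \<omega>"] K[of "\<mu> s"] by linarith
        qed
        show "integrable (U n) (\<lambda>\<omega>. e / 2 + 2 * K * indicat_real {\<omega>. nbhd_empirical n \<omega> \<notin> A} \<omega>)"
          using ind by auto
        fix \<omega>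
        show "\<bar>g (nbhd_empirical n \<omega>) - g (\<mu> s)\<bar> \<le> e / 2 + 2 * K * indicat_real {\<omega>. nbhd_empirical n \<omega> \<notin> A} \<omega>"
          using K[of "nbhd_empirical n \<omega>"] K[of "\<mu> s"] e
          by (cases "nbhd_empirical n \<omega> \<in> A") (auto simp: A_def dist_real_def abs_minus_commute)
      qed
      also have "\<dots> = e / 2 + 2 * K * measure (U n) {\<omega>. nbhd_empirical n \<omega> \<notin> A}"
        using ind by (simp add: U.prob_space[simplified])
      also have "measure (U n) {\<omega>. nbhd_empirical n \<omega> \<notin> A} = ?num n / ?den n"
        unfolding U_def using em
        by (subst measure_uniform_measure) (auto simp: Int_def conj_commute)
      finally show ?case using elim(2) by (simp add: dist_real_def)
    qed
  qed
  ultimately show "(\<lambda>n. \<integral>y. g y \<partial>cond_law \<alpha>n \<nu> (leaf_sum h) (level s) n)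
      \<longlonglongrightarrow> (\<integral>y. g y \<partial>return (borel_of weak_topology) (\<mu> s))" by (simp add: int_eq)
qed

text \<open>For fixed small \<delta> the conditional laws concentrate at the star law of the level
  \<open>level t - \<delta>\<close>, so the inner limits are point masses at
  \<open>\<mu> (S \<delta>)\<close>. The outer limit is then the continuity of \<open>\<mu>\<close>
  in the tilt.\<close>

lemma iterated_weak_limit:
  assumes t: "0 < t" and lv: "level 0 < level t"
  shows "\<exists>Q. (\<forall>\<^sub>F \<delta> in at_right (0::real). borel_prob weak_topology (Q \<delta>) \<and>
        weak_limit weak_topology (cond_law \<alpha>n \<nu> (leaf_sum h) (level t - \<delta>)) (Q \<delta>) sequentially) \<and>
      weak_limit weak_topology Q (return (borel_of weak_topology) (\<mu> t)) (at_right 0)"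
proof -
  obtain S where S: "\<And>\<delta>. 0 < \<delta> \<Longrightarrow> \<delta> < level t - level 0 \<Longrightarrow> 0 < S \<delta> \<and> S \<delta> < t \<and> level (S \<delta>) = level t - \<delta>"
    and S_lim: "(S \<longlongrightarrow> t) (at_right 0)" by (rule ex_inverse_level[OF t lv]) blast
  define Q where "Q \<delta> = return (borel_of weak_topology) (\<mu> (S \<delta>))" for \<delta>
  have sp: "p \<in> space (borel_of weak_topology)" for p :: "'x star pmf" by simp
  have "\<forall>\<^sub>F \<delta> in at_right (0::real). borel_prob weak_topology (Q \<delta>) \<and>
      weak_limit weak_topology (cond_law \<alpha>n \<nu> (leaf_sum h) (level t - \<delta>)) (Q \<delta>) sequentially"
    using eventually_at_right_real[of 0 "level t - level 0"]
  proof (rule eventually_mono)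
    show "0 < level t - level 0" using lv by simp
    fix \<delta> assume "\<delta> \<in> {0<..<level t - level 0}"
    then have s: "0 < S \<delta>" "level (S \<delta>) = level t - \<delta>" "level 0 < level t - \<delta>" using S[of \<delta>] by auto
    have "borel_prob weak_topology (Q \<delta>)"
      unfolding borel_prob_def Q_def by (simp add: prob_space_return[OF sp])
    moreover have "weak_limit weak_topology (cond_law \<alpha>n \<nu> (leaf_sum h) (level t - \<delta>)) (Q \<delta>) sequentially"
      using weak_limit_cond_law[OF s(1)] s by (simp add: Q_def)
    ultimately show "borel_prob weak_topology (Q \<delta>) \<and>
      weak_limit weak_topology (cond_law \<alpha>n \<nu> (leaf_sum h) (level t - \<delta>)) (Q \<delta>) sequentially" ..
  qed
  moreover have "weak_limit weak_topology Q (return (borel_of weak_topology) (\<mu> t)) (at_right 0)"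
    unfolding weak_limit_def
  proof (intro allI impI, elim conjE)
    fix g :: "'x star pmf \<Rightarrow> real"
    assume g: "continuous_map weak_topology euclideanreal g"
    have ret: "(\<integral>y. g y \<partial>return (borel_of weak_topology) p) = g p" for p
      by (rule integral_return) (auto simp: continuous_map_measurable_borel_of[OF g])
    have "((\<lambda>\<delta>. g (\<mu> (S \<delta>))) \<longlongrightarrow> g (\<mu> t)) (at_right 0)"
    proof (rule weak_continuous_tendsto[OF g finite_stars set_mu set_mu])
      fix \<sigma>
      have "isCont (\<lambda>s. pmf (\<mu> s) \<sigma>) t"
        using continuous_pmf_mu[of \<sigma>] t by (simp add: continuous_on_eq_continuous_at)
      then show "((\<lambda>\<delta>. pmf (\<mu> (S \<delta>)) \<sigma>) \<longlongrightarrow> pmf (\<mu> t) \<sigma>) (at_right 0)"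
        by (rule isCont_tendsto_compose[OF _ S_lim])
    qed
    then show "((\<lambda>\<delta>. \<integral>y. g y \<partial>Q \<delta>) \<longlongrightarrow> (\<integral>y. g y \<partial>return (borel_of weak_topology) (\<mu> t))) (at_right 0)"
      by (simp add: Q_def ret)
  qed
  ultimately show ?thesis by blast
qed

end

text \<open>\<open>l\<close> is an extended real, so the value -\<infinity> is covered.
  \<open>Q\<close> names the inner limits, asserted for all small \<delta> > 0. Existence of a
  solution is tied to the maximum over the support of \<nu>, because \<kappa> times it is the
  supremum of \<open>level\<close>; both limit statements hold for every solution.\<close>

theorem proposition3p5:
  fixes M :: nat and \<kappa> c :: real
    and \<alpha> :: "nat pmf" and \<alpha>n :: "nat \<Rightarrow> nat pmf"
    and \<nu> :: "'x::finite pmf" and h :: "'x \<Rightarrow> real"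
  assumes "CM_sequence M \<kappa> \<alpha> \<alpha>n"
    and "measure_pmf.expectation (true_law \<alpha> \<nu>) (leaf_sum h) < c"
    and "c < \<kappa> * Max (range h)"
  shows "(c < \<kappa> * Max (h ` set_pmf \<nu>) \<longrightarrow> (\<exists>!(\<gamma>, t). tilted_solution M \<alpha> \<nu> h c \<gamma> t)) \<and>
    (\<forall>\<gamma> t. tilted_solution M \<alpha> \<nu> h c \<gamma> t \<longrightarrow>
      (\<forall>A. openin weak_topology A \<and> mu_star M \<kappa> \<gamma> \<in> A \<longrightarrow>
        (\<exists>l<0. ((\<lambda>\<delta>. limsup (\<lambda>n. ereal (1 / real n) *
             ln_ereal \<P>(\<omega> in measure_pmf (marked_CM n (\<alpha>n n) \<nu>).
               nbhd_empirical n \<omega> \<notin> A \<bar> mean_exceeds (leaf_sum h) (c - \<delta>) n \<omega>)))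
           \<longlongrightarrow> l) (at_right (0::real)))) \<and>
      (\<exists>Q. (\<forall>\<^sub>F \<delta> in at_right (0::real). borel_prob weak_topology (Q \<delta>) \<and>
              weak_limit weak_topology (cond_law \<alpha>n \<nu> (leaf_sum h) (c - \<delta>)) (Q \<delta>) sequentially) \<and>
           weak_limit weak_topology Q (return (borel_of weak_topology) (mu_star M \<kappa> \<gamma>)) (at_right 0)))"
proof -
  interpret cm_model M \<kappa> \<alpha> \<alpha>n \<nu> h by unfold_locales (rule assms(1))
  have c: "level 0 < c" using assms(2) by (simp add: level_0)
  show ?thesis
  proof (intro conjI allI impI)
    assume "c < \<kappa> * Max (h ` set_pmf \<nu>)"
    then show "\<exists>!(\<gamma>, t). tilted_solution M \<alpha> \<nu> h c \<gamma> t" by (rule ex1_tilted_solution[OF c])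
  next
    fix \<gamma>' t A
    assume "tilted_solution M \<alpha> \<nu> h c \<gamma>' t" and A: "openin weak_topology A \<and> mu_star M \<kappa> \<gamma>' \<in> A"
    then have t: "0 < t" "\<gamma>' = \<gamma> t" "level t = c" by (auto simp: tilted_solution_iff)
    show "\<exists>l<0. ((\<lambda>\<delta>. limsup (\<lambda>n. ereal (1 / real n) *
             ln_ereal \<P>(\<omega> in measure_pmf (marked_CM n (\<alpha>n n) \<nu>).
               nbhd_empirical n \<omega> \<notin> A \<bar> mean_exceeds (leaf_sum h) (c - \<delta>) n \<omega>)))
           \<longlongrightarrow> l) (at_right (0::real))"
      using conditional_decay[OF t(1), of A] c A t by simp
  next
    fix \<gamma>' t
    assume "tilted_solution M \<alpha> \<nu> h c \<gamma>' t"
    then have t: "0 < t" "\<gamma>' = \<gamma> t" "level t = c" by (auto simp: tilted_solution_iff)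
    show "\<exists>Q. (\<forall>\<^sub>F \<delta> in at_right (0::real). borel_prob weak_topology (Q \<delta>) \<and>
              weak_limit weak_topology (cond_law \<alpha>n \<nu> (leaf_sum h) (c - \<delta>)) (Q \<delta>) sequentially) \<and>
           weak_limit weak_topology Q (return (borel_of weak_topology) (mu_star M \<kappa> \<gamma>')) (at_right 0)"
      using iterated_weak_limit[OF t(1)] c t by simp
  qed
qed

end
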